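(* A ($5$-dimensional) solvable Lie group does not admit any left-invariant double hypo structure.
   Context: An $SU(2)$-structure on a $5$-manifold is a quadruplet $(\eta,\omega_1,\omega_2,\omega_3)$ of a $1$-form $\eta$ and $2$-forms $\omega_i$ with $\omega_i\wedge\omega_j=\delta_{ij}v$ for some $4$-form $v$ with $v\wedge\eta$ nowhere zero, and such that $X\lrcorner\omega_1=Y\lrcorner\omega_2$ implies $\omega_3(X,Y)\ge 0$. It is nearly hypo if $d\omega_1=3\eta\wedge\omega_2$ and $d(\eta\wedge\omega_3)=-2\omega_1\wedge\omega_1$. It is double hypo if it is nearly hypo and also hypo, where here hypo is understood with $\omega_3$ as the closed form, i.e. $d\omega_3=0$, $d(\eta\wedge\omega_1)=0$, $d(\eta\wedge\omega_2)=0$. *)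

theory Defs
  imports
    "HOL-Analysis.Analysis"
    "HOL-Algebra.Solvable_Groups"
    "HOL-Combinatorics.Permutations"
begin

section \<open>Smooth manifolds and Lie groups\<close>

text \<open>The next two notions are only used on open sets.\<close>

fun Ck_on :: "nat \<Rightarrow> 'a::real_normed_vector set \<Rightarrow> ('a \<Rightarrow> 'b::real_normed_vector) \<Rightarrow> bool" where
  "Ck_on 0 S f \<longleftrightarrow> continuous_on S f"
| "Ck_on (Suc k) S f \<longleftrightarrow>
     (\<forall>x\<in>S. f differentiable (at x)) \<and> (\<forall>v. Ck_on k S (\<lambda>x. frechet_derivative f (at x) v))"

definition smooth_on :: "'a::real_normed_vector set \<Rightarrow> ('a \<Rightarrow> 'b::real_normed_vector) \<Rightarrow> bool" where
  "smooth_on S f \<longleftrightarrow> (\<forall>k. Ck_on k S f)"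

text \<open>A chart is a pair of its domain and its coordinate map (arbitrary outside the domain).\<close>

type_synonym ('m, 'v) chart = "'m set \<times> ('m \<Rightarrow> 'v)"

definition is_chart :: "('m::topological_space, 'v::euclidean_space) chart \<Rightarrow> bool" where
  "is_chart c \<longleftrightarrow> (case c of (U, \<phi>) \<Rightarrow>
     open U \<and> open (\<phi> ` U) \<and> homeomorphism U (\<phi> ` U) \<phi> (inv_into U \<phi>))"

definition smooth_atlas :: "('m::topological_space, 'v::euclidean_space) chart set \<Rightarrow> bool" where
  "smooth_atlas A \<longleftrightarrow>
     (\<Union>(U, \<phi>)\<in>A. U) = UNIV \<and> (\<forall>c\<in>A. is_chart c) \<and>
     (\<forall>(U, \<phi>)\<in>A. \<forall>(V, \<psi>)\<in>A. smooth_on (\<phi> ` (U \<inter> V)) (\<psi> \<circ> inv_into U \<phi>))"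

definition smooth_map ::
    "('m::topological_space, 'v::euclidean_space) chart set \<Rightarrow>
     ('n::topological_space, 'w::euclidean_space) chart set \<Rightarrow> ('m \<Rightarrow> 'n) \<Rightarrow> bool" where
  "smooth_map A B f \<longleftrightarrow> continuous_on UNIV f \<and>
     (\<forall>(U, \<phi>)\<in>A. \<forall>(V, \<psi>)\<in>B. smooth_on (\<phi> ` (U \<inter> f -` V)) (\<psi> \<circ> f \<circ> inv_into U \<phi>))"

definition prod_atlas ::
    "('m, 'v) chart set \<Rightarrow> ('n, 'w) chart set \<Rightarrow> ('m \<times> 'n, 'v \<times> 'w) chart set" where
  "prod_atlas A B = {(U \<times> V, map_prod \<phi> \<psi>) | U \<phi> V \<psi>. (U, \<phi>) \<in> A \<and> (V, \<psi>) \<in> B}"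

text \<open>The dimension is that of the model space \<open>'v\<close>. Hausdorffness and second countability
  are part of the sort of \<open>'g\<close>.\<close>

definition lie_group ::
    "('g::{t2_space, second_countable_topology}) monoid \<Rightarrow>
     ('g, 'v::euclidean_space) chart set \<Rightarrow> bool" where
  "lie_group G A \<longleftrightarrow>
     group G \<and> carrier G = UNIV \<and> smooth_atlas A \<and>
     smooth_map (prod_atlas A A) A (\<lambda>(x, y). x \<otimes>\<^bsub>G\<^esub> y) \<and>
     smooth_map A A (\<lambda>x. inv\<^bsub>G\<^esub> x)"


section \<open>Alternating forms on a vector space\<close>

text \<open>A \<open>k\<close>-form is evaluated on a sequence of vectors, of which only the entries with index
  below \<open>k\<close> matter; thus equality of \<open>k\<close>-forms is equality of functions.\<close>

type_synonym 'v form = "(nat \<Rightarrow> 'v) \<Rightarrow> real"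

definition alternating_form :: "nat \<Rightarrow> 'v::real_vector form \<Rightarrow> bool" where
  "alternating_form k \<alpha> \<longleftrightarrow>
     (\<forall>v w. (\<forall>i<k. v i = w i) \<longrightarrow> \<alpha> v = \<alpha> w) \<and>
     (\<forall>i<k. \<forall>v. linear (\<lambda>x. \<alpha> (v(i := x)))) \<and>
     (\<forall>v. \<forall>i<k. \<forall>j<k. i \<noteq> j \<and> v i = v j \<longrightarrow> \<alpha> v = 0)"

text \<open>The normalisation is the one for which \<open>e\<^sup>1 \<and> \<dots> \<and> e\<^sup>k\<close> takes the value 1 on
  \<open>(e\<^sub>1, \<dots>, e\<^sub>k)\<close>.\<close>

definition wedge :: "nat \<Rightarrow> nat \<Rightarrow> 'v form \<Rightarrow> 'v form \<Rightarrow> 'v form" where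
  "wedge k l \<alpha> \<beta> = (\<lambda>v. (\<Sum>\<sigma> | \<sigma> permutes {..<k + l}.
     of_int (sign \<sigma>) * \<alpha> (\<lambda>i. v (\<sigma> i)) * \<beta> (\<lambda>i. v (\<sigma> (k + i)))) / (fact k * fact l))"

definition interior_product :: "'v \<Rightarrow> 'v form \<Rightarrow> 'v form" where
  "interior_product X \<alpha> = (\<lambda>v. \<alpha> (case_nat X v))"

definition pullback :: "('v \<Rightarrow> 'w) \<Rightarrow> 'w form \<Rightarrow> 'v form" where
  "pullback L \<alpha> = (\<lambda>v. \<alpha> (\<lambda>i. L (v i)))"


section \<open>Differential forms on a manifold\<close>

text \<open>A differential form is given by its local representatives: \<open>\<alpha> (U, \<phi>) p\<close> is the
  representative of \<open>\<alpha>\<close> in the chart \<open>(U, \<phi>)\<close> at \<open>p \<in> \<phi> ` U\<close>. Values for charts outside the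
  atlas or points outside \<open>\<phi> ` U\<close> are irrelevant.\<close>

type_synonym ('m, 'v) dform = "('m, 'v) chart \<Rightarrow> 'v \<Rightarrow> 'v form"

text \<open>\<open>f\<^sup>* \<alpha> = \<alpha>\<close>, written out in charts.\<close>

definition invariant_under ::
    "('m, 'v::euclidean_space) chart set \<Rightarrow> ('m \<Rightarrow> 'm) \<Rightarrow> ('m, 'v) dform \<Rightarrow> bool" where
  "invariant_under A f \<alpha> \<longleftrightarrow>
     (\<forall>(U, \<phi>)\<in>A. \<forall>(V, \<psi>)\<in>A. \<forall>x\<in>U. f x \<in> V \<longrightarrow>
        \<alpha> (U, \<phi>) (\<phi> x) =
        pullback (frechet_derivative (\<psi> \<circ> f \<circ> inv_into U \<phi>) (at (\<phi> x))) (\<alpha> (V, \<psi>) (\<psi> (f x))))"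

text \<open>Invariance under the identity is the compatibility of the local representatives.\<close>

definition diff_form ::
    "('m, 'v::euclidean_space) chart set \<Rightarrow> nat \<Rightarrow> ('m, 'v) dform \<Rightarrow> bool" where
  "diff_form A k \<alpha> \<longleftrightarrow>
     (\<forall>(U, \<phi>)\<in>A. (\<forall>p\<in>\<phi> ` U. alternating_form k (\<alpha> (U, \<phi>) p)) \<and>
                  (\<forall>v. smooth_on (\<phi> ` U) (\<lambda>p. \<alpha> (U, \<phi>) p v))) \<and>
     invariant_under A (\<lambda>x. x) \<alpha>"

definition dform_eq :: "('m, 'v) chart set \<Rightarrow> ('m, 'v) dform \<Rightarrow> ('m, 'v) dform \<Rightarrow> bool" where
  "dform_eq A \<alpha> \<beta> \<longleftrightarrow> (\<forall>(U, \<phi>)\<in>A. \<forall>p\<in>\<phi> ` U. \<alpha> (U, \<phi>) p = \<beta> (U, \<phi>) p)"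

definition dzero :: "('m, 'v) dform" where
  "dzero = (\<lambda>c p v. 0)"

definition dscale :: "real \<Rightarrow> ('m, 'v) dform \<Rightarrow> ('m, 'v) dform" where
  "dscale r \<alpha> = (\<lambda>c p v. r * \<alpha> c p v)"

definition dwedge :: "nat \<Rightarrow> nat \<Rightarrow> ('m, 'v) dform \<Rightarrow> ('m, 'v) dform \<Rightarrow> ('m, 'v) dform" where
  "dwedge k l \<alpha> \<beta> = (\<lambda>c p. wedge k l (\<alpha> c p) (\<beta> c p))"

text \<open>The argument \<open>k\<close> is the degree of \<open>\<alpha>\<close>; the inner sequence is \<open>v\<close> with \<open>v i\<close> omitted.\<close>

definition ext_deriv :: "nat \<Rightarrow> ('m, 'v::euclidean_space) dform \<Rightarrow> ('m, 'v) dform" where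
  "ext_deriv k \<alpha> = (\<lambda>c p v. \<Sum>i\<le>k. (-1) ^ i *
     frechet_derivative (\<lambda>q. \<alpha> c q (\<lambda>j. if j < i then v j else v (Suc j))) (at p) (v i))"

definition nowhere_zero :: "('m, 'v) chart set \<Rightarrow> ('m, 'v) dform \<Rightarrow> bool" where
  "nowhere_zero A \<alpha> \<longleftrightarrow> (\<forall>(U, \<phi>)\<in>A. \<forall>p\<in>\<phi> ` U. \<alpha> (U, \<phi>) p \<noteq> (\<lambda>v. 0))"

definition left_invariant ::
    "'g monoid \<Rightarrow> ('g, 'v::euclidean_space) chart set \<Rightarrow> ('g, 'v) dform \<Rightarrow> bool" where
  "left_invariant G A \<alpha> \<longleftrightarrow> (\<forall>g\<in>carrier G. invariant_under A (\<lambda>x. g \<otimes>\<^bsub>G\<^esub> x) \<alpha>)"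


section \<open>SU(2)-structures on 5-manifolds\<close>

text \<open>The triple \<open>(\<omega>\<^sub>1, \<omega>\<^sub>2, \<omega>\<^sub>3)\<close> is the family \<open>\<omega>\<close> restricted to the indices 1, 2, 3. The
  sequence \<open>case_nat X (\<lambda>_. Y)\<close> starts with \<open>X, Y\<close>.\<close>

definition SU2_structure ::
    "('m, real^5) chart set \<Rightarrow> ('m, real^5) dform \<Rightarrow> (nat \<Rightarrow> ('m, real^5) dform) \<Rightarrow> bool" where
  "SU2_structure A \<eta> \<omega> \<longleftrightarrow>
     diff_form A 1 \<eta> \<and> (\<forall>i\<in>{1, 2, 3}. diff_form A 2 (\<omega> i)) \<and>
     (\<exists>v. diff_form A 4 v \<and>
        (\<forall>i\<in>{1, 2, 3}. \<forall>j\<in>{1, 2, 3}.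
           dform_eq A (dwedge 2 2 (\<omega> i) (\<omega> j)) (if i = j then v else dzero)) \<and>
        nowhere_zero A (dwedge 4 1 v \<eta>)) \<and>
     (\<forall>(U, \<phi>)\<in>A. \<forall>p\<in>\<phi> ` U. \<forall>X Y.
        interior_product X (\<omega> 1 (U, \<phi>) p) = interior_product Y (\<omega> 2 (U, \<phi>) p) \<longrightarrow>
        \<omega> 3 (U, \<phi>) p (case_nat X (\<lambda>_. Y)) \<ge> 0)"

definition nearly_hypo ::
    "('m, real^5) chart set \<Rightarrow> ('m, real^5) dform \<Rightarrow> (nat \<Rightarrow> ('m, real^5) dform) \<Rightarrow> bool" where
  "nearly_hypo A \<eta> \<omega> \<longleftrightarrow>
     SU2_structure A \<eta> \<omega> \<and>
     dform_eq A (ext_deriv 2 (\<omega> 1)) (dscale 3 (dwedge 1 2 \<eta> (\<omega> 2))) \<and>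
     dform_eq A (ext_deriv 3 (dwedge 1 2 \<eta> (\<omega> 3))) (dscale (-2) (dwedge 2 2 (\<omega> 1) (\<omega> 1)))"

text \<open>The convention is that \<open>\<omega>\<^sub>3\<close> is the closed 2-form.\<close>

definition hypo ::
    "('m, real^5) chart set \<Rightarrow> ('m, real^5) dform \<Rightarrow> (nat \<Rightarrow> ('m, real^5) dform) \<Rightarrow> bool" where
  "hypo A \<eta> \<omega> \<longleftrightarrow>
     SU2_structure A \<eta> \<omega> \<and>
     dform_eq A (ext_deriv 2 (\<omega> 3)) dzero \<and>
     dform_eq A (ext_deriv 3 (dwedge 1 2 \<eta> (\<omega> 1))) dzero \<and>
     dform_eq A (ext_deriv 3 (dwedge 1 2 \<eta> (\<omega> 2))) dzero"

definition double_hypo ::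
    "('m, real^5) chart set \<Rightarrow> ('m, real^5) dform \<Rightarrow> (nat \<Rightarrow> ('m, real^5) dform) \<Rightarrow> bool" where
  "double_hypo A \<eta> \<omega> \<longleftrightarrow> nearly_hypo A \<eta> \<omega> \<and> hypo A \<eta> \<omega>"

end

theory Submission
  imports Defs
begin

text \<open>A left-invariant form is determined by its value at the identity, so a left-invariant double
  hypo structure amounts to linear algebra on the tangent space at the identity together with the
  Lie bracket there, through the formula \<open>d\<alpha>(x, y) = - \<alpha>[x, y]\<close> and its analogues in higher degree
  (\<open>ext_deriv_2\<close>, \<open>ext_deriv_3\<close>). What remains is to show that no solvable Lie algebra of dimension
  five carries such data (\<open>not_solvable_bracket\<close>).

  Solvability is a property of the abstract group. It passes to the bracket through the adjoint
  representation: call an operator \<open>X\<close> tangent to a subgroup \<open>H\<close> if it is the one-sided derivative of \<open>Ad\<close> along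
  some family of elements of \<open>H\<close>, with no continuity or closedness required. Commutators of two such
  families show that brackets of tangents to \<open>H\<close> are tangent to the derived subgroup of \<open>H\<close>, and only
  \<open>0\<close> is tangent to the trivial group. Hence a set of vectors contained in the span of its own
  brackets is trivial (\<open>solvable_bracket_br\<close>). The Jacobi identity comes from the same source: each
  \<open>Ad g\<close> preserves the bracket, and differentiating this in \<open>g\<close> shows that \<open>ad\<close> acts by derivations.

  At the identity choose a frame \<open>e1, ..., e5\<close> in which \<open>\<eta> = e\<^sup>5\<close>, \<open>\<omega>1 = e\<^sup>1\<^sup>2 + e\<^sup>3\<^sup>4\<close>,
  \<open>\<omega>2 = e\<^sup>1\<^sup>3 + e\<^sup>4\<^sup>2\<close>, \<open>\<omega>3 = e\<^sup>1\<^sup>4 + e\<^sup>2\<^sup>3\<close> (\<open>adapted_frame_exists\<close>); the group \<open>SU(2)\<close> of such choices acts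
  simply transitively on the unit sphere of \<open>ker \<eta>\<close>, so one direction may be prescribed. The equations
  give \<open>\<eta>[e5, x] = 0\<close> for all \<open>x\<close>, and solvability gives a nonzero closed 1-form with \<open>\<beta>(e5) = 0\<close>
  (\<open>closed_form\<close>): the trace form if that does not vanish, and otherwise any closed form. Prescribe
  \<open>e\<^sup>1\<close> proportional to \<open>\<beta>\<close>. The linear equations then determine the bracket in terms of a symmetric
  \<open>3 \<times> 3\<close> matrix \<open>N\<close>, the operator \<open>ad e5\<close>, and \<open>d\<eta>\<close>. The Jacobi identity turns into
  \<open>2 N\<^sup>2 - 1/2 (tr N) N = S\<close> with \<open>S\<close> explicit, where the positivity condition of the SU(2)-structure
  has fixed the sign of \<open>S\<close>. Real arithmetic refutes this equation, in one branch with the help of a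
  further relation: there, unless the relation holds, \<open>e2, e3, [e2, e3]\<close> span a perfect subalgebra,
  which solvability forbids (\<open>structure_equations_inconsistent\<close>, \<open>not_solvable\<close>).\<close>


section \<open>Lie algebras with a double hypo structure\<close>

text \<open>The Chevalley--Eilenberg differential in degrees 1 and 2, and the low-degree wedge products as
  shuffle sums on vectors. By the Leibniz rule \<open>d(\<eta> \<and> \<omega>)\<close> is the difference of \<open>wedge22 (d\<eta>) \<omega>\<close> and
  \<open>wedge13 \<eta> (d\<omega>)\<close>.\<close>

definition one_d :: "('a \<Rightarrow> 'a \<Rightarrow> 'a) \<Rightarrow> ('a \<Rightarrow> real) \<Rightarrow> 'a \<Rightarrow> 'a \<Rightarrow> real" where
  "one_d br \<alpha> x y = - \<alpha> (br x y)"

definition two_d :: "('a \<Rightarrow> 'a \<Rightarrow> 'a) \<Rightarrow> ('a \<Rightarrow> 'a \<Rightarrow> real) \<Rightarrow> 'a \<Rightarrow> 'a \<Rightarrow> 'a \<Rightarrow> real" where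
  "two_d br \<omega> x y z = - \<omega> (br x y) z + \<omega> (br x z) y - \<omega> (br y z) x"

definition wedge12 :: "('a \<Rightarrow> real) \<Rightarrow> ('a \<Rightarrow> 'a \<Rightarrow> real) \<Rightarrow> 'a \<Rightarrow> 'a \<Rightarrow> 'a \<Rightarrow> real" where
  "wedge12 \<alpha> \<omega> x y z = \<alpha> x * \<omega> y z - \<alpha> y * \<omega> x z + \<alpha> z * \<omega> x y"

definition wedge13 ::
    "('a \<Rightarrow> real) \<Rightarrow> ('a \<Rightarrow> 'a \<Rightarrow> 'a \<Rightarrow> real) \<Rightarrow> 'a \<Rightarrow> 'a \<Rightarrow> 'a \<Rightarrow> 'a \<Rightarrow> real" where
  "wedge13 \<alpha> \<tau> x y z w = \<alpha> x * \<tau> y z w - \<alpha> y * \<tau> x z w + \<alpha> z * \<tau> x y w - \<alpha> w * \<tau> x y z"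

definition wedge22 ::
    "('a \<Rightarrow> 'a \<Rightarrow> real) \<Rightarrow> ('a \<Rightarrow> 'a \<Rightarrow> real) \<Rightarrow> 'a \<Rightarrow> 'a \<Rightarrow> 'a \<Rightarrow> 'a \<Rightarrow> real" where
  "wedge22 \<alpha> \<beta> x y z w = \<alpha> x y * \<beta> z w - \<alpha> x z * \<beta> y w + \<alpha> x w * \<beta> y z
     + \<alpha> y z * \<beta> x w - \<alpha> y w * \<beta> x z + \<alpha> z w * \<beta> x y"

locale lie_algebra =
  fixes br :: "'a::euclidean_space \<Rightarrow> 'a \<Rightarrow> 'a"
  assumes bilinear: "bilinear br"
    and alt: "br x x = 0"
    and jacobi: "br x (br y z) + br y (br z x) + br z (br x y) = 0"
begin

lemmas br_simps = bilinear_ladd[OF bilinear] bilinear_radd[OF bilinear] bilinear_lmul[OF bilinear]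
  bilinear_rmul[OF bilinear] bilinear_lneg[OF bilinear] bilinear_rneg[OF bilinear]
  bilinear_lsub[OF bilinear] bilinear_rsub[OF bilinear] bilinear_lzero[OF bilinear]
  bilinear_rzero[OF bilinear]

lemma anti: "br y x = - br x y"
proof -
  have "br (x + y) (x + y) = br x x + br y x + (br x y + br y y)" by (simp only: br_simps)
  then have "br x y + br y x = 0" by (simp add: alt add.commute)
  then show ?thesis by (rule minus_unique[symmetric])
qed

text \<open>In finite dimension this is equivalent to the vanishing of the derived series: the last nonzero term of
  a derived series that does not reach \<open>0\<close> is its own derived algebra. In this form it is used twice,
  for the whole algebra and for a set of three vectors.\<close>

definition solvable_bracket :: bool where
  "solvable_bracket \<longleftrightarrow>
     (\<forall>S. S \<subseteq> span {br x y | x y. x \<in> S \<and> y \<in> S} \<longrightarrow> S \<subseteq> {0})"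

end

text \<open>The standard model of an SU(2)-structure on a 5-dimensional vector space. The vectors and the
  dual coordinates are separate parameters rather than families, so that structure constants are the
  plain terms \<open>tk (br ei ej)\<close>, atoms for linear arithmetic.\<close>

locale adapted_coframe =
  fixes e1 e2 e3 e4 e5 :: "'a::euclidean_space"
    and t1 t2 t3 t4 t5 :: "'a \<Rightarrow> real"
    and \<eta> :: "'a \<Rightarrow> real" and \<omega>1 \<omega>2 \<omega>3 :: "'a \<Rightarrow> 'a \<Rightarrow> real"
  assumes lin: "linear t1" "linear t2" "linear t3" "linear t4" "linear t5"
    and dual: "t1 e1 = 1" "t1 e2 = 0" "t1 e3 = 0" "t1 e4 = 0" "t1 e5 = 0"
      "t2 e1 = 0" "t2 e2 = 1" "t2 e3 = 0" "t2 e4 = 0" "t2 e5 = 0"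
      "t3 e1 = 0" "t3 e2 = 0" "t3 e3 = 1" "t3 e4 = 0" "t3 e5 = 0"
      "t4 e1 = 0" "t4 e2 = 0" "t4 e3 = 0" "t4 e4 = 1" "t4 e5 = 0"
      "t5 e1 = 0" "t5 e2 = 0" "t5 e3 = 0" "t5 e4 = 0" "t5 e5 = 1"
    and expand: "x = t1 x *\<^sub>R e1 + t2 x *\<^sub>R e2 + t3 x *\<^sub>R e3 + t4 x *\<^sub>R e4 + t5 x *\<^sub>R e5"
    and eta: "\<eta> x = t5 x"
    and omega1: "\<omega>1 x y = t1 x * t2 y - t2 x * t1 y + t3 x * t4 y - t4 x * t3 y"
    and omega2: "\<omega>2 x y = t1 x * t3 y - t3 x * t1 y + t4 x * t2 y - t2 x * t4 y"
    and omega3: "\<omega>3 x y = t1 x * t4 y - t4 x * t1 y + t2 x * t3 y - t3 x * t2 y"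
begin

lemmas t_simps = lin[THEN linear_add] lin[THEN linear_scale] lin[THEN linear_neg]
  lin[THEN linear_diff] lin[THEN linear_0] dual

lemma coord_eqI:
  assumes "t1 x = t1 y" "t2 x = t2 y" "t3 x = t3 y" "t4 x = t4 y" "t5 x = t5 y"
  shows "x = y"
  using expand[of x] expand[of y] unfolding assms by (rule trans[OF _ sym])

end

locale double_hypo_algebra = lie_algebra br
  for br :: "'a::euclidean_space \<Rightarrow> 'a \<Rightarrow> 'a" +
  fixes \<eta> :: "'a \<Rightarrow> real" and \<omega>1 \<omega>2 \<omega>3 :: "'a \<Rightarrow> 'a \<Rightarrow> real"
  assumes d_omega1: "two_d br \<omega>1 x y z = 3 * wedge12 \<eta> \<omega>2 x y z"
    and d_omega3: "two_d br \<omega>3 x y z = 0"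
    and d_eta_omega3: "wedge22 (one_d br \<eta>) \<omega>3 x y z w - wedge13 \<eta> (two_d br \<omega>3) x y z w
       = -2 * wedge22 \<omega>1 \<omega>1 x y z w"
    and d_eta_omega1: "wedge22 (one_d br \<eta>) \<omega>1 x y z w - wedge13 \<eta> (two_d br \<omega>1) x y z w = 0"
    and d_eta_omega2: "wedge22 (one_d br \<eta>) \<omega>2 x y z w - wedge13 \<eta> (two_d br \<omega>2) x y z w = 0"

locale double_hypo_frame = double_hypo_algebra br \<eta> \<omega>1 \<omega>2 \<omega>3
    + adapted_coframe e1 e2 e3 e4 e5 t1 t2 t3 t4 t5 \<eta> \<omega>1 \<omega>2 \<omega>3
  for br :: "'a::euclidean_space \<Rightarrow> 'a \<Rightarrow> 'a" and \<eta> :: "'a \<Rightarrow> real"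
    and \<omega>1 \<omega>2 \<omega>3 :: "'a \<Rightarrow> 'a \<Rightarrow> real" and e1 e2 e3 e4 e5 t1 t2 t3 t4 t5
begin

lemma br_swap: "br e2 e1 = - br e1 e2" "br e3 e1 = - br e1 e3" "br e4 e1 = - br e1 e4"
  "br e1 e5 = - br e5 e1" "br e3 e2 = - br e2 e3" "br e2 e4 = - br e4 e2" "br e2 e5 = - br e5 e2"
  "br e4 e3 = - br e3 e4" "br e3 e5 = - br e5 e3" "br e4 e5 = - br e5 e4"
  by (rule anti)+

lemmas d_simps = two_d_def one_d_def wedge12_def wedge13_def wedge22_def eta omega1 omega2 omega3
  t_simps br_swap alt

text \<open>Write \<open>d\<eta> = \<eta> \<and> \<beta> + \<gamma>\<close>. In \<open>d\<eta> \<and> \<omega>3 = - 2 \<omega>1 \<and> \<omega>1\<close> the right side has no factor \<open>\<eta>\<close>, so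
  \<open>\<beta> \<and> \<omega>3 = 0\<close>; multiplication by \<open>\<omega>3\<close> is injective on 1-forms in dimension four, so \<open>\<beta> = 0\<close>.\<close>

lemma eta_ad_xi: "t5 (br e5 e1) = 0" "t5 (br e5 e2) = 0" "t5 (br e5 e3) = 0" "t5 (br e5 e4) = 0"
  using d_eta_omega3[of e5 e1 e2 e3] d_eta_omega3[of e5 e1 e2 e4] d_eta_omega3[of e5 e1 e3 e4]
    d_eta_omega3[of e5 e2 e3 e4] d_omega3[of e1 e2 e3] d_omega3[of e1 e2 e4] d_omega3[of e1 e3 e4]
    d_omega3[of e2 e3 e4]
  by (simp_all add: d_simps)

text \<open>On \<open>ker \<eta>\<close> the terms \<open>\<eta> \<and> d\<omega>i\<close> drop out, and the equations for \<open>d(\<eta> \<and> \<omega>i)\<close> say that the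
  self-dual part of \<open>d\<eta>\<close> there is \<open>- 2 \<omega>3\<close>.\<close>

lemma d_eta_V:
  "t5 (br e1 e4) + t5 (br e2 e3) = 4"
  "t5 (br e1 e2) + t5 (br e3 e4) = 0"
  "t5 (br e1 e3) + t5 (br e4 e2) = 0"
  using d_eta_omega3[of e1 e2 e3 e4] d_eta_omega1[of e1 e2 e3 e4] d_eta_omega2[of e1 e2 e3 e4]
  by (simp_all add: d_simps)

text \<open>The equations do not prescribe \<open>d\<omega>2\<close>; but the components of \<open>d(\<eta> \<and> \<omega>2) = 0\<close> that involve \<open>\<eta>\<close>
  make \<open>d\<omega>2\<close> vanish on \<open>ker \<eta>\<close>.\<close>

lemma omega2_V:
  "two_d br \<omega>2 e1 e2 e3 = 0" "two_d br \<omega>2 e1 e2 e4 = 0" "two_d br \<omega>2 e1 e3 e4 = 0"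
  "two_d br \<omega>2 e2 e3 e4 = 0"
  using d_eta_omega2[of e5 e1 e2 e3] d_eta_omega2[of e5 e1 e2 e4] d_eta_omega2[of e5 e1 e3 e4]
    d_eta_omega2[of e5 e2 e3 e4] 
  by (simp_all add: d_simps eta_ad_xi)


text \<open>The trace of \<open>ad x\<close>. It is a closed 1-form because traces of commutators vanish.\<close>

definition chi :: "'a \<Rightarrow> real" where
  "chi x = t1 (br x e1) + t2 (br x e2) + t3 (br x e3) + t4 (br x e4) + t5 (br x e5)"

lemma linear_chi: "linear chi"
  unfolding chi_def by (rule linearI) (simp_all add: t_simps br_simps algebra_simps)

lemma chi_br: "chi (br x y) = 0"
proof -
  have ex: "f (br u z) = t1 z * f (br u e1) + t2 z * f (br u e2) + t3 z * f (br u e3)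
      + t4 z * f (br u e4) + t5 z * f (br u e5)" if f: "linear f" for f :: "'a \<Rightarrow> real" and u z
    using arg_cong[OF expand[of z], of "\<lambda>z. f (br u z)"]
    by (simp add: br_simps linear_add[OF f] linear_scale[OF f])
  have jac: "br (br x y) z = br x (br y z) - br y (br x z)" for z
  proof -
    have "br (br x y) z = - br z (br x y)" by (rule anti)
    also have "\<dots> = br x (br y z) + br y (br z x)" by (rule minus_unique) (use jacobi[of x y z] in \<open>simp add: add.commute add.left_commute\<close>)
    also have "br z x = - br x z" by (rule anti)
    finally show ?thesis by (simp add: br_simps)
  qed
  note ex5 = lin[THEN ex, of x "br y e1"] lin[THEN ex, of x "br y e2"] lin[THEN ex, of x "br y e3"]
    lin[THEN ex, of x "br y e4"] lin[THEN ex, of x "br y e5"]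
    lin[THEN ex, of y "br x e1"] lin[THEN ex, of y "br x e2"] lin[THEN ex, of y "br x e3"]
    lin[THEN ex, of y "br x e4"] lin[THEN ex, of y "br x e5"]
  show ?thesis
    unfolding chi_def jac t_simps by (simp only: ex5) (simp add: algebra_simps)
qed

text \<open>Closedness of \<open>\<omega>3\<close> makes \<open>ad e5\<close> act on \<open>ker \<eta>\<close> as an element of the symplectic Lie algebra of
  \<open>\<omega>3\<close>, which has trace zero.\<close>

lemma chi_xi: "chi e5 = 0"
  using d_omega3[of e5 e1 e4] d_omega3[of e5 e2 e3] eta_ad_xi
  by (simp add: chi_def d_simps br_simps)

text \<open>Solvability makes the brackets span a proper subspace, so nonzero closed 1-forms \<open>\<beta>\<close> exist; the
  point is \<open>\<beta> e5 = 0\<close>. The trace form has this property. If it vanishes identically, every 4-form is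
  closed, and \<open>d(\<eta> \<and> \<beta> \<and> \<omega>3)\<close>, which equals \<open>2 \<beta> \<and> \<omega>3 \<and> \<omega>3\<close>, is a nonzero multiple of \<open>\<beta> e5\<close>
  times the volume form.\<close>

lemma closed_form:
  assumes "solvable_bracket"
  obtains \<beta> :: "'a \<Rightarrow> real" where "linear \<beta>" "\<forall>x y. \<beta> (br x y) = 0" "\<beta> e5 = 0" "\<exists>x. \<beta> x \<noteq> 0"
proof (cases "\<exists>x. chi x \<noteq> 0")
  case True
  then show ?thesis using that[of chi] linear_chi chi_br chi_xi by blast
next
  case False
  have "\<not> UNIV \<subseteq> span {br x y | x y. x \<in> UNIV \<and> y \<in> UNIV}"
  proof
    assume "UNIV \<subseteq> span {br x y | x y. x \<in> UNIV \<and> y \<in> UNIV}"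
    then have "UNIV \<subseteq> {0 :: 'a}" using assms unfolding solvable_bracket_def by blast
    then have "e1 = 0" by blast
    then show False using dual(1) linear_0[OF lin(1)] by simp
  qed
  then have "span {br x y | x y. x \<in> UNIV \<and> y \<in> UNIV} \<noteq> UNIV" by blast
  then obtain a where a: "a \<noteq> 0" "\<And>z. z \<in> span {br x y | x y. x \<in> UNIV \<and> y \<in> UNIV} \<Longrightarrow> a \<bullet> z = 0"
    using span_not_UNIV_orthogonal by blast
  have br: "a \<bullet> br x y = 0" for x y by (rule a(2)) (auto intro!: span_base)
  have ex: "t1 z * (a \<bullet> e1) + t2 z * (a \<bullet> e2) + t3 z * (a \<bullet> e3) + t4 z * (a \<bullet> e4) + t5 z * (a \<bullet> e5)
      = a \<bullet> z" for z
    using arg_cong[OF expand[of z], of "\<lambda>z. a \<bullet> z"] by (simp add: inner_simps)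
  have chi0: "chi x = 0" for x using False by blast
  \<comment> \<open>The components of \<open>d\<omega>3 = 0\<close> on \<open>ker \<eta>\<close>, rewritten with traces.\<close>
  have tr: "t1 (br e1 e4) + t1 (br e2 e3) = - chi e4"
    "t2 (br e1 e4) + t2 (br e2 e3) = - chi e3"
    "t3 (br e1 e4) + t3 (br e2 e3) = chi e2"
    "t4 (br e1 e4) + t4 (br e2 e3) = chi e1"
    using d_omega3[of e2 e3 e4] d_omega3[of e1 e3 e4] d_omega3[of e1 e2 e4] d_omega3[of e1 e2 e3]
      eta_ad_xi by (simp_all add: chi_def d_simps br_simps)
  have "0 = (a \<bullet> br e1 e4) + (a \<bullet> br e2 e3)" by (simp add: br)
  also have "\<dots> = (t1 (br e1 e4) + t1 (br e2 e3)) * (a \<bullet> e1) + (t2 (br e1 e4) + t2 (br e2 e3)) * (a \<bullet> e2)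
     + (t3 (br e1 e4) + t3 (br e2 e3)) * (a \<bullet> e3) + (t4 (br e1 e4) + t4 (br e2 e3)) * (a \<bullet> e4)
     + (t5 (br e1 e4) + t5 (br e2 e3)) * (a \<bullet> e5)"
    unfolding ex[symmetric, of "br e1 e4"] ex[symmetric, of "br e2 e3"] by (simp add: algebra_simps)
  also have "\<dots> = 4 * (a \<bullet> e5)" unfolding tr d_eta_V by (simp add: chi0)
  finally have "a \<bullet> e5 = 0" by simp
  moreover have "linear (\<lambda>x. a \<bullet> x)" by (simp add: bounded_linear.linear bounded_linear_inner_right)
  moreover have "\<exists>x. a \<bullet> x \<noteq> 0" using a(1) by (intro exI[of _ a]) simp
  ultimately show ?thesis using that[of "\<lambda>x. a \<bullet> x"] br by blast
qed

end

text \<open>The diagonal entries \<open>n2\<close>, \<open>n3\<close>, \<open>n4\<close> and the entries \<open>n24\<close>, \<open>n34\<close> belong to a symmetric matrix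
  \<open>N\<close> with \<open>n23 = 0\<close>; \<open>M22\<close>, \<open>M33\<close>, \<open>M44\<close>, \<open>M24\<close> are entries of
  \<open>2 N\<^sup>2 - 1/2 (tr N) N = S\<close>, and \<open>D\<close> says mainly that \<open>ad e5\<close> is a derivation. If \<open>c = 0\<close>, then
  \<open>n2 = n24 = 0\<close> and the trace of the equation equates a nonnegative quantity with \<open>- 12\<close>. If \<open>c\<close> and
  \<open>q\<close> are nonzero, then \<open>g = 0\<close>, and comparing two entries gives \<open>n3 * n3 = - 6\<close>. If \<open>q = 0\<close> and
  \<open>c \<noteq> 0\<close>, then \<open>n3 = 0\<close>, or \<open>c = - 3\<close> and \<open>n2 = n3\<close>; both contradict \<open>M33\<close> in the presence of \<open>nu\<close>.\<close>

lemma structure_equations_inconsistent: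
  fixes n2 n3 n4 n24 n34 c q g :: real
  assumes M22: "2 * (n2\<^sup>2 + n24\<^sup>2) - (n2 + n3 + n4) / 2 * n2 = (2 - g) * c"
    and M33: "2 * (n3\<^sup>2 + n34\<^sup>2) - (n2 + n3 + n4) / 2 * n3 = - 3 * (2 - g)"
    and M44: "2 * (n4\<^sup>2 + n24\<^sup>2 + n34\<^sup>2) - (n2 + n3 + n4) / 2 * n4 = - (2 + g) * (c + 3)"
    and M24: "2 * (n2 * n24 + n24 * n4) - (n2 + n3 + n4) / 2 * n24 = (2 - g) * q"
    and D: "3 * n2 = - c * n3" "3 * n24 = - q * n3" "c * n34 = 0" "q * g = 0"
    and nu: "c \<noteq> 0 \<Longrightarrow> q = 0 \<Longrightarrow> 3 * (2 + g) + n3 * n4 = 0"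
  shows False
proof (cases "c = 0")
  case True
  then have n2: "n2 = 0" using D(1) by simp
  with True M22 have n24: "n24 = 0" by simp
  have "4 * n3\<^sup>2 + 4 * n34\<^sup>2 - (n3\<^sup>2 + n3 * n4) = - 12 + 6 * g"
    using M33 n2 by (simp add: power2_eq_square field_simps)
  moreover have "4 * n4\<^sup>2 + 4 * n34\<^sup>2 - (n3 * n4 + n4\<^sup>2) = - 12 - 6 * g"
    using M44 n2 n24 True by (simp add: power2_eq_square field_simps)
  moreover have "(n3 - n4)\<^sup>2 = n3\<^sup>2 + n4\<^sup>2 - 2 * (n3 * n4)"
    by (simp add: power2_eq_square algebra_simps)
  moreover have "0 \<le> (n3 - n4)\<^sup>2" "0 \<le> n34\<^sup>2" "0 \<le> n3\<^sup>2" "0 \<le> n4\<^sup>2" by simp_all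
  ultimately show False by linarith
next
  case c: False
  then have n34: "n34 = 0" using D(3) by simp
  show False
  proof (cases "q = 0")
    case False
    then have g: "g = 0" using D(4) by simp
    have m33: "n3 * (2 * n3 - (n2 + n3 + n4) / 2) = - 6"
      using M33 g n34 by (simp add: power2_eq_square algebra_simps)
    have "n24 * (2 * n2 + 2 * n4 - (n2 + n3 + n4) / 2) = 2 * q"
      using M24 g by (simp add: algebra_simps)
    then have "q * (n3 * (2 * n2 + 2 * n4 - (n2 + n3 + n4) / 2)) = q * (- 6)"
      using D(2) by (simp add: algebra_simps) algebra
    then have "n3 * (2 * n2 + 2 * n4 - (n2 + n3 + n4) / 2) = - 6"
      using False unfolding mult_cancel_left by blast
    with m33 have "n3 * (2 * (n2 + n4 - n3)) = 0" by (simp add: algebra_simps)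
    moreover have "n3 \<noteq> 0" using m33 by auto
    ultimately have "n2 + n4 = n3" by simp
    then have T: "n2 + n3 + n4 = 2 * n3" by simp
    have "n3 * n3 = - 6" using m33 unfolding T by simp
    moreover have "0 \<le> n3 * n3" by simp
    ultimately show False by linarith
  next
    case q: True
    then have n24: "n24 = 0" using D(2) by simp
    have nu': "3 * (2 + g) + n3 * n4 = 0" using nu c q by blast
    show False
    proof (cases "n3 = 0")
      case True
      then show False using nu' M33 n34 by simp
    next
      case n3: False
      have "c * (2 * n2 * n3) = c * (2 * n3 * n3)"
      proof -
        have "3 * (2 * n2\<^sup>2 - (n2 + n3 + n4) / 2 * n2) = - c * (2 * n3\<^sup>2 - (n2 + n3 + n4) / 2 * n3)"
        proof -
          have a: "2 * n2\<^sup>2 - (n2 + n3 + n4) / 2 * n2 = (2 - g) * c" using M22 n24 by simp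
          have b: "2 * n3\<^sup>2 - (n2 + n3 + n4) / 2 * n3 = - 3 * (2 - g)" using M33 n34 by simp
          show ?thesis unfolding a b by (simp add: algebra_simps)
        qed
        then have "2 * n2 * (3 * n2) - (n2 + n3 + n4) / 2 * (3 * n2)
            = - c * (2 * n3\<^sup>2 - (n2 + n3 + n4) / 2 * n3)"
          by (simp add: power2_eq_square algebra_simps)
        then show ?thesis unfolding D(1) by (simp add: power2_eq_square algebra_simps)
      qed
      then have n2: "n2 = n3" using c n3 by simp
      have "(c + 3) * n3 = 0" using D(1) n2 by (simp add: algebra_simps)
      then have c3: "c = - 3" using n3 by simp
      have "n4 * (3 * n4 - 2 * n3) = 0" using M44 n24 n34 n2 c3
        by (simp add: power2_eq_square algebra_simps)
      then consider "n4 = 0" | "n3 = 3 / 2 * n4" by fastforce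
      then show False
      proof cases
        case 1
        then have "n3 * n3 = - 12" using nu' M33 n34 n2
          by (simp add: power2_eq_square field_simps)
        then show False using zero_le_square[of n3] by linarith
      next
        case 2
        have m33: "3 / 2 * (n4 * n4) = - 3 * (2 - g)" using M33 n34 n2 2
          by (simp add: power2_eq_square field_simps)
        have "3 / 2 * (n4 * n4) = - 3 * (2 + g)" using nu' 2 by (simp add: field_simps)
        with m33 have "n4 * n4 = - 4" by simp
        then show False using zero_le_square[of n4] by linarith
      qed
    qed
  qed
qed

context double_hypo_frame
begin

text \<open>With \<open>e\<^sup>1\<close> closed, all brackets lie in the span of \<open>e2, ..., e5\<close>. Vanishing of \<open>d\<omega>i\<close> on \<open>ker \<eta>\<close> leaves
  a symmetric matrix \<open>N\<close>, given by the cyclic brackets of \<open>e2, e3, e4\<close> modulo \<open>e5\<close>, and forces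
  \<open>ad e1 = 1/2 (tr N) - N\<close> there; the equations for \<open>d\<omega>1\<close> and \<open>d\<omega>3\<close> in the direction \<open>e5\<close> leave two
  constants \<open>c\<close>, \<open>q\<close> in \<open>ad e5\<close>; and \<open>d\<eta>\<close> is \<open>- 2 \<omega>3\<close> plus an anti-self-dual form with coefficients
  \<open>g\<close>, \<open>g34\<close>, \<open>g42\<close>.\<close>

lemma not_solvable:
  assumes closed: "\<And>x y. t1 (br x y) = 0"
  shows "\<not> solvable_bracket"
proof
  assume solv: "solvable_bracket"
  define c where "c = t2 (br e5 e3)"
  define q where "q = t4 (br e5 e3)"
  define n2 where "n2 = t2 (br e3 e4)"
  define n23 where "n23 = t3 (br e3 e4)"
  define n24 where "n24 = t4 (br e3 e4)"
  define n3 where "n3 = t3 (br e4 e2)"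
  define n34 where "n34 = t4 (br e4 e2)"
  define n4 where "n4 = t4 (br e2 e3)"
  define g where "g = t5 (br e2 e3) - 2"
  define g34 where "g34 = t5 (br e3 e4)"
  define g42 where "g42 = t5 (br e4 e2)"
  note defs = c_def q_def n2_def n23_def n24_def n3_def n34_def n4_def g_def g34_def g42_def
  note dsimps = d_simps closed eta_ad_xi
  have c5: "t2 (br e5 e1) = - q" "t3 (br e5 e1) = 0" "t4 (br e5 e1) = c + 3"
    "t2 (br e5 e2) = 0" "t3 (br e5 e2) = 3" "t4 (br e5 e2) = 0" "t3 (br e5 e3) = 0"
    "t2 (br e5 e4) = 0" "t3 (br e5 e4) = 0" "t4 (br e5 e4) = 0"
    using d_omega1[of e5 e1 e2] d_omega1[of e5 e1 e3] d_omega1[of e5 e1 e4]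
      d_omega1[of e5 e2 e3] d_omega1[of e5 e2 e4] d_omega1[of e5 e3 e4]
      d_omega3[of e5 e1 e2] d_omega3[of e5 e1 e3] d_omega3[of e5 e1 e4]
      d_omega3[of e5 e2 e3] d_omega3[of e5 e2 e4] d_omega3[of e5 e3 e4]
    unfolding defs by (simp_all add: dsimps)
  have cV: "t2 (br e2 e3) = n24" "t3 (br e2 e3) = n34" "t2 (br e4 e2) = n23"
    "t2 (br e1 e2) = (n3 + n4 - n2) / 2" "t3 (br e1 e2) = - n23" "t4 (br e1 e2) = - n24"
    "t2 (br e1 e3) = - n23" "t3 (br e1 e3) = (n2 + n4 - n3) / 2" "t4 (br e1 e3) = - n34"
    "t2 (br e1 e4) = - n24" "t3 (br e1 e4) = - n34" "t4 (br e1 e4) = (n2 + n3 - n4) / 2"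
    using d_omega1[of e1 e2 e3] d_omega1[of e1 e2 e4] d_omega1[of e1 e3 e4] d_omega1[of e2 e3 e4]
      d_omega3[of e1 e2 e3] d_omega3[of e1 e2 e4] d_omega3[of e1 e3 e4] d_omega3[of e2 e3 e4]
      omega2_V
    unfolding defs by (simp_all add: dsimps)
  have c0: "t5 (br e1 e2) = - g34" "t5 (br e1 e3) = - g42" "t5 (br e1 e4) = 2 - g"
    "t5 (br e2 e3) = 2 + g"
    using d_eta_V unfolding defs by simp_all
  note coeffs = closed eta_ad_xi c5 cV c0 defs[symmetric]
  have tab: "br e5 e1 = - q *\<^sub>R e2 + (c + 3) *\<^sub>R e4" "br e5 e2 = 3 *\<^sub>R e3"
    "br e5 e3 = c *\<^sub>R e2 + q *\<^sub>R e4" "br e5 e4 = 0"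
    "br e3 e4 = n2 *\<^sub>R e2 + n23 *\<^sub>R e3 + n24 *\<^sub>R e4 + g34 *\<^sub>R e5"
    "br e4 e2 = n23 *\<^sub>R e2 + n3 *\<^sub>R e3 + n34 *\<^sub>R e4 + g42 *\<^sub>R e5"
    "br e2 e3 = n24 *\<^sub>R e2 + n34 *\<^sub>R e3 + n4 *\<^sub>R e4 + (2 + g) *\<^sub>R e5"
    "br e1 e2 = ((n3 + n4 - n2) / 2) *\<^sub>R e2 - n23 *\<^sub>R e3 - n24 *\<^sub>R e4 - g34 *\<^sub>R e5"
    "br e1 e3 = - n23 *\<^sub>R e2 + ((n2 + n4 - n3) / 2) *\<^sub>R e3 - n34 *\<^sub>R e4 - g42 *\<^sub>R e5"
    "br e1 e4 = - n24 *\<^sub>R e2 - n34 *\<^sub>R e3 + ((n2 + n3 - n4) / 2) *\<^sub>R e4 + (2 - g) *\<^sub>R e5"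
    by (rule coord_eqI; simp add: t_simps coeffs)+
  note jac = arg_cong[OF jacobi, of t2] arg_cong[OF jacobi, of t3] arg_cong[OF jacobi, of t4]
  note jsimps = tab br_swap alt br_simps t_simps
  have n23: "n23 = 0"
    using jac(2)[of e5 e4 e2] by (simp add: jsimps)
  have der: "3 * n2 = - c * n3" "3 * n24 = - q * n3" "c * n34 = 0"
    using jac(2)[of e5 e3 e4] jac(2)[of e5 e2 e3] jac(3)[of e5 e3 e4]
    by (simp_all add: jsimps n23 add_eq_0_iff)
  have g34: "g34 = 0"
    using jac(2)[of e2 e3 e4] by (simp add: jsimps n23)
  have g42: "c * g42 = 0"
    using jac(1)[of e2 e3 e4] by (auto simp: jsimps n23 g34)
  have "t2 (br e1 (br e3 e4) + br e3 (br e4 e1) + br e4 (br e1 e3))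
      = (2 - g) * c - (2 * (n2\<^sup>2 + n24\<^sup>2) - (n2 + n3 + n4) / 2 * n2)"
    "t3 (br e1 (br e4 e2) + br e4 (br e2 e1) + br e2 (br e1 e4))
      = - 3 * (2 - g) - (2 * (n3\<^sup>2 + n34\<^sup>2) - (n2 + n3 + n4) / 2 * n3)"
    "t4 (br e1 (br e2 e3) + br e2 (br e3 e1) + br e3 (br e1 e2))
      = - (2 + g) * (c + 3) - (2 * (n4\<^sup>2 + n24\<^sup>2 + n34\<^sup>2) - (n2 + n3 + n4) / 2 * n4)"
    "t4 (br e1 (br e3 e4) + br e3 (br e4 e1) + br e4 (br e1 e3))
      = (2 - g) * q - (2 * (n2 * n24 + n24 * n4) - (n2 + n3 + n4) / 2 * n24)"
    "t2 (br e1 (br e2 e3) + br e2 (br e3 e1) + br e3 (br e1 e2))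
      = (2 + g) * q - (2 * (n2 * n24 + n24 * n4) - (n2 + n3 + n4) / 2 * n24)"
    by (simp_all add: jsimps n23 g34 power2_eq_square field_simps)
  then have M: "2 * (n2\<^sup>2 + n24\<^sup>2) - (n2 + n3 + n4) / 2 * n2 = (2 - g) * c"
    "2 * (n3\<^sup>2 + n34\<^sup>2) - (n2 + n3 + n4) / 2 * n3 = - 3 * (2 - g)"
    "2 * (n4\<^sup>2 + n24\<^sup>2 + n34\<^sup>2) - (n2 + n3 + n4) / 2 * n4 = - (2 + g) * (c + 3)"
    "2 * (n2 * n24 + n24 * n4) - (n2 + n3 + n4) / 2 * n24 = (2 - g) * q"
    "2 * (n2 * n24 + n24 * n4) - (n2 + n3 + n4) / 2 * n24 = (2 + g) * q"
    unfolding jacobi by (simp_all only: t_simps)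
  have qg: "q * g = 0" using trans[OF M(4)[symmetric] M(5)] unfolding mult_cancel_right by auto
  \<comment> \<open>Otherwise \<open>e2\<close>, \<open>e3\<close> and their bracket \<open>z\<close> reproduce each other up to nonzero factors.\<close>
  have nu: "3 * (2 + g) + n3 * n4 = 0" if c: "c \<noteq> 0" and q: "q = 0"
  proof (rule ccontr)
    define nu where "nu = 3 * (2 + g) + n3 * n4"
    assume "3 * (2 + g) + n3 * n4 \<noteq> 0"
    then have nz: "nu \<noteq> 0" by (simp only: nu_def not_False_eq_True)
    define z where "z = br e2 e3"
    define S where "S = {e2, e3, z}"
    have n: "n24 = 0" "n34 = 0" "g42 = 0" using der g42 c q by simp_all
    have n2: "n2 = - c * n3 / 3" using der(1) by simp
    have z: "z = n4 *\<^sub>R e4 + (2 + g) *\<^sub>R e5" unfolding z_def tab by (simp add: n)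
    have ze2: "br z e2 = nu *\<^sub>R e3"
      unfolding z by (rule coord_eqI) (simp_all add: nu_def jsimps n n23)
    have ze3: "br z e3 = (c / 3 * nu) *\<^sub>R e2"
      unfolding z by (rule coord_eqI) (simp_all add: nu_def jsimps n n23 n2 g34 q field_simps)
    have "S \<subseteq> span {br x y | x y. x \<in> S \<and> y \<in> S}" (is "S \<subseteq> span ?B")
    proof -
      have "br z e2 \<in> ?B" "br z e3 \<in> ?B" "z \<in> ?B" unfolding S_def z_def by blast+
      then have B: "br z e2 \<in> span ?B" "br z e3 \<in> span ?B" "z \<in> span ?B" by (simp_all add: span_base)
      have "(1 / nu) *\<^sub>R br z e2 \<in> span ?B" "(1 / (c / 3 * nu)) *\<^sub>R br z e3 \<in> span ?B"
        using B by (simp_all only: span_mul)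
      then have "e3 \<in> span ?B" "e2 \<in> span ?B" unfolding ze2 ze3 using nz c by simp_all
      then show ?thesis using B unfolding S_def by simp
    qed
    then have "S \<subseteq> {0}" using solv unfolding solvable_bracket_def by blast
    then have "e2 = 0" unfolding S_def by simp
    then show False using dual(7) linear_0[OF lin(2)] by simp
  qed
  show False
    by (rule structure_equations_inconsistent[OF M(1-4) der qg nu])
qed

end

section \<open>Adapted frames of an SU(2)-structure at a point\<close>

text \<open>Sending \<open>w\<close> to an orthonormal basis by means of \<open>\<theta>\<close> has the obvious right inverse, and in finite
  dimension a one-sided inverse is two-sided.\<close>

lemma dual_family_expand:
  fixes w :: "nat \<Rightarrow> 'a::euclidean_space"
  assumes lin: "\<And>i. i < DIM('a) \<Longrightarrow> linear (\<theta> i)"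
    and dual: "\<And>i j. i < DIM('a) \<Longrightarrow> j < DIM('a) \<Longrightarrow> \<theta> i (w j) = (if i = j then 1 else 0)"
  shows "x = (\<Sum>i<DIM('a). \<theta> i x *\<^sub>R w i)"
proof -
  obtain b where "bij_betw b {0..<card (Basis :: 'a set)} (Basis :: 'a set)"
    using ex_bij_betw_nat_finite[OF finite_Basis] by blast
  then have b: "bij_betw b {..<DIM('a)} (Basis :: 'a set)" by (simp add: lessThan_atLeast0)
  have bB: "b i \<in> Basis" if "i < DIM('a)" for i using b that by (auto simp: bij_betw_def)
  have ort: "b i \<bullet> b j = (if i = j then 1 else 0)" if "i < DIM('a)" "j < DIM('a)" for i j
    using that bB inj_onD[OF bij_betw_imp_inj_on[OF b]] by (auto simp: inner_Basis)
  define \<Phi> where "\<Phi> = (\<lambda>x. \<Sum>i<DIM('a). \<theta> i x *\<^sub>R b i)"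
  define \<Psi> where "\<Psi> = (\<lambda>x. \<Sum>i<DIM('a). (x \<bullet> b i) *\<^sub>R w i)"
  have l\<Phi>: "linear \<Phi>" unfolding \<Phi>_def
    by (rule linear_compose_sum) (auto intro!: linearI simp: linear_add[OF lin] linear_scale[OF lin] scaleR_add_left)
  have l\<Psi>: "linear \<Psi>" unfolding \<Psi>_def
    by (rule linear_compose_sum) (auto intro!: linearI simp: inner_simps algebra_simps)
  have th\<Psi>: "\<theta> i (\<Psi> y) = y \<bullet> b i" if "i < DIM('a)" for i y
    unfolding \<Psi>_def using that
    by (simp add: linear_sum[OF lin] linear_scale[OF lin] dual if_distrib cong: if_cong)
  have "\<Phi> (\<Psi> y) = y" for y
  proof -
    have "\<Phi> (\<Psi> y) = (\<Sum>i<DIM('a). (y \<bullet> b i) *\<^sub>R b i)" unfolding \<Phi>_def by (simp add: th\<Psi>)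
    also have "\<dots> = (\<Sum>u\<in>Basis. (y \<bullet> u) *\<^sub>R u)"
      by (rule sum.reindex_bij_betw[OF b, of "\<lambda>u. (y \<bullet> u) *\<^sub>R u"])
    finally show ?thesis by (simp add: euclidean_representation)
  qed
  then have "\<Phi> \<circ> \<Psi> = id" by auto
  then have "\<Psi> \<circ> \<Phi> = id" using linear_inverse_left[OF l\<Phi> l\<Psi>] by simp
  then have "x = \<Psi> (\<Phi> x)" by (metis comp_apply id_apply)
  also have "\<dots> = (\<Sum>i<DIM('a). \<theta> i x *\<^sub>R w i)"
    unfolding \<Psi>_def \<Phi>_def
    by (intro sum.cong refl) (simp add: inner_sum_left ort if_distrib cong: if_cong)
  finally show ?thesis .
qed

lemma dual_five_expand:
  fixes w0 w1 w2 w3 w4 :: "'a::euclidean_space"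
  assumes dim: "DIM('a) = 5"
    and lin: "linear f0" "linear f1" "linear f2" "linear f3" "linear f4"
    and dual: "f0 w0 = 1" "f0 w1 = 0" "f0 w2 = 0" "f0 w3 = 0" "f0 w4 = 0"
      "f1 w0 = 0" "f1 w1 = 1" "f1 w2 = 0" "f1 w3 = 0" "f1 w4 = 0"
      "f2 w0 = 0" "f2 w1 = 0" "f2 w2 = 1" "f2 w3 = 0" "f2 w4 = 0"
      "f3 w0 = 0" "f3 w1 = 0" "f3 w2 = 0" "f3 w3 = 1" "f3 w4 = 0"
      "f4 w0 = 0" "f4 w1 = 0" "f4 w2 = 0" "f4 w3 = 0" "f4 w4 = 1"
  shows "x = f0 x *\<^sub>R w0 + f1 x *\<^sub>R w1 + f2 x *\<^sub>R w2 + f3 x *\<^sub>R w3 + f4 x *\<^sub>R w4"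
proof -
  let ?w = "\<lambda>i. [w0, w1, w2, w3, w4] ! i" and ?f = "\<lambda>i. [f0, f1, f2, f3, f4] ! i"
  have c: "i = 0 \<or> i = 1 \<or> i = 2 \<or> i = 3 \<or> i = 4" if "i < DIM('a)" for i using that dim by auto
  have "x = (\<Sum>i<DIM('a). ?f i x *\<^sub>R ?w i)"
  proof (rule dual_family_expand)
    show "linear (?f i)" if "i < DIM('a)" for i using c[OF that] lin by auto
    show "?f i (?w j) = (if i = j then 1 else 0)" if "i < DIM('a)" "j < DIM('a)" for i j
      using c[OF that(1)] c[OF that(2)] dual by auto
  qed
  then show ?thesis by (simp add: dim eval_nat_numeral)
qed

definition form_indices :: "nat set" where
  "form_indices = {1, 2, 3}"

locale su2_point =
  fixes \<eta> :: "'a::euclidean_space \<Rightarrow> real" and \<omega> :: "nat \<Rightarrow> 'a \<Rightarrow> 'a \<Rightarrow> real"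
  assumes dim: "DIM('a) = 5"
    and eta: "linear \<eta>"
    and bil: "i \<in> form_indices \<Longrightarrow> bilinear (\<omega> i)"
    and alt: "i \<in> form_indices \<Longrightarrow> \<omega> i x x = 0"
    and orth: "i \<in> form_indices \<Longrightarrow> j \<in> form_indices \<Longrightarrow> i \<noteq> j \<Longrightarrow> wedge22 (\<omega> i) (\<omega> j) x y z w = 0"
    and same: "i \<in> form_indices \<Longrightarrow> wedge22 (\<omega> i) (\<omega> i) x y z w = wedge22 (\<omega> 1) (\<omega> 1) x y z w"
    and nonzero: "\<exists>w0 w1 w2 w3 w4. wedge22 (\<omega> 1) (\<omega> 1) w0 w1 w2 w3 * \<eta> w4
      - wedge22 (\<omega> 1) (\<omega> 1) w0 w1 w2 w4 * \<eta> w3 + wedge22 (\<omega> 1) (\<omega> 1) w0 w1 w3 w4 * \<eta> w2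
      - wedge22 (\<omega> 1) (\<omega> 1) w0 w2 w3 w4 * \<eta> w1 + wedge22 (\<omega> 1) (\<omega> 1) w1 w2 w3 w4 * \<eta> w0 \<noteq> 0"
    and pos: "(\<And>z. \<omega> 1 x z = \<omega> 2 y z) \<Longrightarrow> 0 \<le> \<omega> 3 x y"
begin

lemma I: "1 \<in> form_indices" "2 \<in> form_indices" "3 \<in> form_indices" "Suc 0 \<in> form_indices" by (simp_all add: form_indices_def)

lemma anti: "\<omega> i y x = - \<omega> i x y" if i: "i \<in> form_indices"
proof -
  have "\<omega> i (x + y) (x + y) = \<omega> i x x + \<omega> i y x + (\<omega> i x y + \<omega> i y y)"
    by (simp only: bilinear_ladd[OF bil[OF i]] bilinear_radd[OF bil[OF i]])
  then show ?thesis by (simp add: alt[OF i])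
qed

text \<open>The 5-form \<open>\<omega>i \<and> \<omega>i \<and> \<eta>\<close>, in Pfaffian form. It does not depend on \<open>i\<close>, and it is what makes the
  three 2-forms nondegenerate on \<open>ker \<eta>\<close> at the same time.\<close>

definition vol :: "nat \<Rightarrow> 'a \<Rightarrow> 'a \<Rightarrow> 'a \<Rightarrow> 'a \<Rightarrow> 'a \<Rightarrow> real" where
  "vol i w0 w1 w2 w3 w4 = wedge22 (\<omega> i) (\<omega> i) w0 w1 w2 w3 * \<eta> w4
      - wedge22 (\<omega> i) (\<omega> i) w0 w1 w2 w4 * \<eta> w3 + wedge22 (\<omega> i) (\<omega> i) w0 w1 w3 w4 * \<eta> w2
      - wedge22 (\<omega> i) (\<omega> i) w0 w2 w3 w4 * \<eta> w1 + wedge22 (\<omega> i) (\<omega> i) w1 w2 w3 w4 * \<eta> w0"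

lemma vol_same: "i \<in> form_indices \<Longrightarrow> vol i w0 w1 w2 w3 w4 = vol 1 w0 w1 w2 w3 w4"
  unfolding vol_def by (simp add: same)

lemmas bs = bilinear_ladd[OF bil] bilinear_radd[OF bil] bilinear_lmul[OF bil] bilinear_rmul[OF bil]
  bilinear_lneg[OF bil] bilinear_rneg[OF bil] bilinear_lsub[OF bil] bilinear_rsub[OF bil]
  bilinear_lzero[OF bil] bilinear_rzero[OF bil]
lemmas es = linear_add[OF eta] linear_scale[OF eta] linear_neg[OF eta] linear_diff[OF eta]
  linear_0[OF eta]

lemma vol_linear:
  assumes "i \<in> form_indices"
  shows "linear (\<lambda>x. vol i x w1 w2 w3 w4)" "linear (\<lambda>x. vol i w0 x w2 w3 w4)"
    "linear (\<lambda>x. vol i w0 w1 x w3 w4)" "linear (\<lambda>x. vol i w0 w1 w2 x w4)"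
    "linear (\<lambda>x. vol i w0 w1 w2 w3 x)"
  using assms by (auto intro!: linearI simp: vol_def wedge22_def bs es algebra_simps)

lemma vol_alt:
  assumes i: "i \<in> form_indices"
  shows "vol i x x a b c = 0" "vol i x a x b c = 0" "vol i x a b x c = 0" "vol i x a b c x = 0"
    "vol i a x x b c = 0" "vol i a x b x c = 0" "vol i a x b c x = 0"
    "vol i a b x x c = 0" "vol i a b x c x = 0" "vol i a b c x x = 0"
  unfolding vol_def wedge22_def
  using alt[OF i] anti[OF i, of x a] anti[OF i, of x b] anti[OF i, of x c]
    anti[OF i, of a b] anti[OF i, of a c] anti[OF i, of b c]
  by (simp_all add: algebra_simps)

text \<open>Cramer's rule: replacing one argument of a nonzero top-degree form gives the dual basis. The same
  coordinates are available with \<open>\<omega> i\<close> for every \<open>i\<close>, which lets later arguments insert a kernel vector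
  of whichever form is at hand.\<close>

lemma ex_basis:
  obtains w0 w1 w2 w3 w4 where "vol 1 w0 w1 w2 w3 w4 \<noteq> 0"
    "\<forall>i\<in>form_indices. \<forall>x. vol 1 w0 w1 w2 w3 w4 *\<^sub>R x = vol i x w1 w2 w3 w4 *\<^sub>R w0 + vol i w0 x w2 w3 w4 *\<^sub>R w1
      + vol i w0 w1 x w3 w4 *\<^sub>R w2 + vol i w0 w1 w2 x w4 *\<^sub>R w3 + vol i w0 w1 w2 w3 x *\<^sub>R w4"
proof -
  obtain w0 w1 w2 w3 w4 where F: "vol 1 w0 w1 w2 w3 w4 \<noteq> 0" using nonzero unfolding vol_def by blast
  have "vol 1 w0 w1 w2 w3 w4 *\<^sub>R x = vol i x w1 w2 w3 w4 *\<^sub>R w0 + vol i w0 x w2 w3 w4 *\<^sub>R w1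
      + vol i w0 w1 x w3 w4 *\<^sub>R w2 + vol i w0 w1 w2 x w4 *\<^sub>R w3 + vol i w0 w1 w2 w3 x *\<^sub>R w4"
    if i: "i \<in> form_indices" for i x
  proof -
    let ?F = "vol i w0 w1 w2 w3 w4"
    have F: "?F \<noteq> 0" using F vol_same[OF i] by simp
    have sc: "linear (\<lambda>x. f x / ?F)" if "linear f" for f :: "'a \<Rightarrow> real"
      using linear_compose_scale_right[OF that, of "1 / ?F"] by simp
    have "x = (vol i x w1 w2 w3 w4 / ?F) *\<^sub>R w0 + (vol i w0 x w2 w3 w4 / ?F) *\<^sub>R w1
      + (vol i w0 w1 x w3 w4 / ?F) *\<^sub>R w2 + (vol i w0 w1 w2 x w4 / ?F) *\<^sub>R w3
      + (vol i w0 w1 w2 w3 x / ?F) *\<^sub>R w4"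
      by (rule dual_five_expand[OF dim, where x = x and ?f0.0 = "\<lambda>x. vol i x w1 w2 w3 w4 / ?F"
          and ?f1.0 = "\<lambda>x. vol i w0 x w2 w3 w4 / ?F" and ?f2.0 = "\<lambda>x. vol i w0 w1 x w3 w4 / ?F"
          and ?f3.0 = "\<lambda>x. vol i w0 w1 w2 x w4 / ?F" and ?f4.0 = "\<lambda>x. vol i w0 w1 w2 w3 x / ?F"];
          (rule sc vol_linear i)?)
        (use F in \<open>simp_all add: vol_alt[OF i] vol_linear[OF i]\<close>)
    from arg_cong[OF this, of "\<lambda>x. ?F *\<^sub>R x"]
    have "?F *\<^sub>R x = vol i x w1 w2 w3 w4 *\<^sub>R w0 + vol i w0 x w2 w3 w4 *\<^sub>R w1
      + vol i w0 w1 x w3 w4 *\<^sub>R w2 + vol i w0 w1 w2 x w4 *\<^sub>R w3 + vol i w0 w1 w2 w3 x *\<^sub>R w4"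
      using F by (simp only: scaleR_add_right scaleR_scaleR) simp
    then show ?thesis using vol_same[OF i] by simp
  qed
  with F show ?thesis using that by blast
qed

lemma nondegenerate:
  assumes i: "i \<in> form_indices" and x: "\<eta> x = 0" "\<And>y. \<omega> i x y = 0"
  shows "x = 0"
proof -
  obtain w0 w1 w2 w3 w4 where F: "vol 1 w0 w1 w2 w3 w4 \<noteq> 0"
    and ex: "\<forall>i\<in>form_indices. \<forall>x. vol 1 w0 w1 w2 w3 w4 *\<^sub>R x = vol i x w1 w2 w3 w4 *\<^sub>R w0
      + vol i w0 x w2 w3 w4 *\<^sub>R w1 + vol i w0 w1 x w3 w4 *\<^sub>R w2 + vol i w0 w1 w2 x w4 *\<^sub>R w3
      + vol i w0 w1 w2 w3 x *\<^sub>R w4" using ex_basis by blast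
  have y: "\<omega> i y x = 0" for y using x(2) anti[OF i, of y x] by simp
  have "vol 1 w0 w1 w2 w3 w4 *\<^sub>R x = 0"
    unfolding ex[rule_format, OF i] unfolding vol_def wedge22_def by (simp add: x y)
  then show ?thesis using F by simp
qed

text \<open>A skew \<open>5 \<times> 5\<close> matrix annihilates the vector of its signed \<open>4 \<times> 4\<close> Pfaffians. For the matrices of
  the \<open>\<omega> i\<close> in a common basis these Pfaffians are, up to a factor, the values of the single 4-form
  \<open>\<omega>i \<and> \<omega>i\<close>, so the three kernels coincide.\<close>

lemma reeb:
  obtains \<xi> where "\<eta> \<xi> = 1" "\<And>i y. i \<in> form_indices \<Longrightarrow> \<omega> i \<xi> y = 0"
proof -
  obtain w0 w1 w2 w3 w4 where F: "vol 1 w0 w1 w2 w3 w4 \<noteq> 0"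
    and ex: "\<forall>i\<in>form_indices. \<forall>x. vol 1 w0 w1 w2 w3 w4 *\<^sub>R x = vol i x w1 w2 w3 w4 *\<^sub>R w0
      + vol i w0 x w2 w3 w4 *\<^sub>R w1 + vol i w0 w1 x w3 w4 *\<^sub>R w2 + vol i w0 w1 w2 x w4 *\<^sub>R w3
      + vol i w0 w1 w2 w3 x *\<^sub>R w4" using ex_basis by blast
  \<comment> \<open>The vector of signed Pfaffians.\<close>
  define k where "k = wedge22 (\<omega> 1) (\<omega> 1) w0 w1 w2 w3 *\<^sub>R w4
      - wedge22 (\<omega> 1) (\<omega> 1) w0 w1 w2 w4 *\<^sub>R w3 + wedge22 (\<omega> 1) (\<omega> 1) w0 w1 w3 w4 *\<^sub>R w2
      - wedge22 (\<omega> 1) (\<omega> 1) w0 w2 w3 w4 *\<^sub>R w1 + wedge22 (\<omega> 1) (\<omega> 1) w1 w2 w3 w4 *\<^sub>R w0"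
  have k: "\<eta> k = vol 1 w0 w1 w2 w3 w4" unfolding k_def vol_def by (simp add: es)
  have 0: "\<omega> i k y = 0" if i: "i \<in> form_indices" for i y
  proof -
    note a = anti[OF i, of w1 w0] anti[OF i, of w2 w0] anti[OF i, of w3 w0] anti[OF i, of w4 w0]
      anti[OF i, of w2 w1] anti[OF i, of w3 w1] anti[OF i, of w4 w1]
      anti[OF i, of w3 w2] anti[OF i, of w4 w2] anti[OF i, of w4 w3]
    have "\<omega> i k w0 = 0" "\<omega> i k w1 = 0" "\<omega> i k w2 = 0" "\<omega> i k w3 = 0" "\<omega> i k w4 = 0"
      unfolding k_def same[OF i, symmetric] unfolding wedge22_def
      by (simp_all add: bs i alt[OF i] a algebra_simps)
    then have "\<omega> i k (vol 1 w0 w1 w2 w3 w4 *\<^sub>R y) = 0"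
      unfolding ex[rule_format, OF i] by (simp add: bs i)
    then show ?thesis using F by (simp add: bs i)
  qed
  show ?thesis
    by (rule that[of "(1 / vol 1 w0 w1 w2 w3 w4) *\<^sub>R k"]) (use F in \<open>simp_all add: es bs k 0\<close>)
qed

text \<open>The form \<open>\<omega> i\<close> alone is degenerate, but \<open>\<omega> i + \<eta> \<otimes> \<eta>\<close> is not: on the diagonal it is the square of
  \<open>\<eta>\<close>. Functionals that vanish on \<open>\<xi>\<close> are then represented inside \<open>ker \<eta>\<close>.\<close>

lemma represent:
  assumes i: "i \<in> form_indices" and \<xi>: "\<eta> \<xi> = 1" "\<And>y. \<omega> i \<xi> y = 0" and \<alpha>: "linear \<alpha>" "\<alpha> \<xi> = 0"
  obtains x where "\<eta> x = 0" "\<And>y. \<omega> i x y = \<alpha> y"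
proof -
  define T where "T = (\<lambda>x. \<Sum>b\<in>Basis. (\<omega> i x b + \<eta> x * \<eta> b) *\<^sub>R b)"
  have lT: "linear T" unfolding T_def
    by (rule linear_compose_sum) (auto intro!: linearI simp: bs i es algebra_simps)
  have ext: "\<omega> i x y + \<eta> x * \<eta> y = \<beta> y"
    if \<beta>: "linear \<beta>" and T: "T x = (\<Sum>b\<in>Basis. \<beta> b *\<^sub>R b)" for x y \<beta>
  proof -
    have "linear (\<lambda>y. \<omega> i x y + \<eta> x * \<eta> y)" by (auto intro!: linearI simp: bs i es algebra_simps)
    moreover have "\<omega> i x b + \<eta> x * \<eta> b = \<beta> b" if "b \<in> Basis" for b
      using arg_cong[OF T, of "\<lambda>z. z \<bullet> b"] that by (simp add: T_def)
    ultimately have "(\<lambda>y. \<omega> i x y + \<eta> x * \<eta> y) = \<beta>" using \<beta> by (intro linear_eq_stdbasis)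
    then show ?thesis by (rule fun_cong)
  qed
  have "inj T"
  proof (subst linear_injective_0[OF lT], intro allI impI)
    fix x assume "T x = 0"
    then have 0: "\<omega> i x y + \<eta> x * \<eta> y = 0" for y
      using ext[of "\<lambda>_. 0" x y] by (simp add: linear_zero)
    have "\<eta> x = 0" using 0[of x] alt[OF i] by simp
    then show "x = 0" using 0 nondegenerate[OF i] by simp
  qed
  then have "surj T" using linear_injective_imp_surjective[OF lT] by simp
  then obtain x where "T x = (\<Sum>b\<in>Basis. \<alpha> b *\<^sub>R b)" by (metis surjD)
  then have x: "\<omega> i x y + \<eta> x * \<eta> y = \<alpha> y" for y by (rule ext[OF \<alpha>(1)])
  have "\<eta> x = 0" using x[of \<xi>] \<xi> \<alpha>(2) anti[OF i, of x \<xi>] by simp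
  with x show ?thesis using that by simp
qed

text \<open>If \<open>\<alpha> \<and> \<omega> = 0\<close> with \<open>\<alpha>\<close> nonzero, then \<open>\<omega>\<close> is a multiple \<open>\<alpha> \<and> \<beta>\<close>, and \<open>\<omega> \<and> \<omega> = 0\<close>.\<close>

lemma wedge_inj:
  assumes i: "i \<in> form_indices" and 0: "\<And>y z w. \<alpha> y * \<omega> i z w - \<alpha> z * \<omega> i y w + \<alpha> w * \<omega> i y z = 0"
  shows "\<alpha> x = 0"
proof (rule ccontr)
  assume a: "\<alpha> x \<noteq> 0"
  define \<beta> where "\<beta> = (\<lambda>z. \<omega> i x z / \<alpha> x)"
  have w: "\<omega> i z w = \<alpha> z * \<beta> w - \<alpha> w * \<beta> z" for z w
    using 0[of x z w] a unfolding \<beta>_def by (simp add: field_simps)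
  obtain w0 w1 w2 w3 w4 where F: "vol 1 w0 w1 w2 w3 w4 \<noteq> 0" using nonzero unfolding vol_def by blast
  have "wedge22 (\<omega> i) (\<omega> i) x y z t = 0" for x y z t
    unfolding wedge22_def w by (simp add: algebra_simps)
  then have "vol i w0 w1 w2 w3 w4 = 0" unfolding vol_def by simp
  then show False using F vol_same[OF i] by simp
qed

text \<open>In other words \<open>J = \<omega>i\<^sup>-\<^sup>1 \<omega>j\<close> is an almost complex structure on \<open>ker \<eta>\<close>. Contracting
  \<open>\<omega>i \<and> \<omega>j = 0\<close> with \<open>x\<close>, and \<open>\<omega>i \<and> \<omega>i = \<omega>j \<and> \<omega>j\<close> with \<open>u\<close>, gives
  \<open>(\<omega>i(u, \<cdot>) + \<omega>j(x, \<cdot>)) \<and> \<omega>i = 0\<close>.\<close>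

lemma swap_forms:
  assumes ij: "i \<in> form_indices" "j \<in> form_indices" "i \<noteq> j" and x: "\<And>y. \<omega> i x y = \<omega> j u y"
  shows "\<omega> j x y = - \<omega> i u y"
proof -
  have "\<omega> i u y + \<omega> j x y = 0"
  proof (rule wedge_inj[OF ij(1), of "\<lambda>y. \<omega> i u y + \<omega> j x y"])
    fix y z w
    show "(\<omega> i u y + \<omega> j x y) * \<omega> i z w - (\<omega> i u z + \<omega> j x z) * \<omega> i y w
      + (\<omega> i u w + \<omega> j x w) * \<omega> i y z = 0"
      using orth[OF ij, of x y z w] same[OF ij(1), of u y z w] same[OF ij(2), of u y z w]
      unfolding wedge22_def x by (simp add: algebra_simps)
  qed
  then show ?thesis by simp
qed

lemma separate_functionals:
  fixes f h :: "'b::real_vector \<Rightarrow> real"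
  assumes f: "linear f" and h: "linear h" and ind: "\<And>l. \<exists>y. f y \<noteq> l * h y"
  obtains y where "f y = 1" "h y = 0"
proof -
  have "\<exists>y. f y \<noteq> 0 \<and> h y = 0"
  proof (rule ccontr)
    assume "\<not> ?thesis"
    then have 0: "f y = 0" if "h y = 0" for y using that by blast
    obtain z where z: "h z \<noteq> 0" using ind[of 0] 0 by fastforce
    have "f y = f z / h z * h y" for y
    proof -
      have "h (y - (h y / h z) *\<^sub>R z) = 0" using z by (simp add: linear_diff[OF h] linear_scale[OF h])
      then have "f (y - (h y / h z) *\<^sub>R z) = 0" by (rule 0)
      then show ?thesis using z by (simp add: linear_diff[OF f] linear_scale[OF f] field_simps)
    qed
    then show False using ind by blast
  qed
  then obtain y where "f y \<noteq> 0" "h y = 0" by blast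
  then show ?thesis using that[of "(1 / f y) *\<^sub>R y"] by (simp add: linear_scale[OF f] linear_scale[OF h])
qed

text \<open>The remaining vectors are the images of \<open>u\<close> under the three almost complex structures, which
  determines every value of the forms up to the single number \<open>g = \<omega>3(x1, u)\<close>. The positivity condition
  of an SU(2)-structure gives \<open>g \<ge> 0\<close>, and \<open>u\<close> is rescaled to make \<open>g = 1\<close>.\<close>

lemma adapted_frame_exists:
  assumes u: "\<eta> u = 0" "u \<noteq> 0"
  obtains e1 e2 e3 e5 r t1 t2 t3 t4 t5 where "r > 0"
    "adapted_coframe e1 e2 e3 (r *\<^sub>R u) e5 t1 t2 t3 t4 t5 \<eta> (\<omega> 1) (\<omega> 2) (\<omega> 3)"
proof -
  note [simp del] = One_nat_def
  obtain \<xi> where \<xi>: "\<eta> \<xi> = 1" "\<And>i y. i \<in> form_indices \<Longrightarrow> \<omega> i \<xi> y = 0" using reeb by blast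
  have \<xi>r: "\<omega> i y \<xi> = 0" if "i \<in> form_indices" for i y using anti[OF that, of y \<xi>] \<xi>(2)[OF that] by simp
  have lin: "linear (\<lambda>y. \<omega> i a y)" "linear (\<lambda>y. - \<omega> i a y)" "linear (\<lambda>y. \<omega> i y a)" if "i \<in> form_indices" for i a
    using that by (auto intro!: linearI simp: bs)
  obtain x1 where x1: "\<eta> x1 = 0" "\<And>y. \<omega> 1 x1 y = \<omega> 2 u y"
    using represent[OF I(1) \<xi>(1) \<xi>(2)[OF I(1)] lin(1)[OF I(2)] \<xi>r[OF I(2)]] by metis
  obtain x2 where x2: "\<eta> x2 = 0" "\<And>y. \<omega> 3 x2 y = - \<omega> 1 u y"
    using represent[OF I(3) \<xi>(1) \<xi>(2)[OF I(3)] lin(2)[OF I(1)]] \<xi>r[OF I(1)]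
    by (metis neg_equal_0_iff_equal)
  obtain x3 where x3: "\<eta> x3 = 0" "\<And>y. \<omega> 3 x3 y = - \<omega> 2 u y"
    using represent[OF I(3) \<xi>(1) \<xi>(2)[OF I(3)] lin(2)[OF I(2)]] \<xi>r[OF I(2)]
    by (metis neg_equal_0_iff_equal)
  have x1': "\<omega> 2 x1 y = - \<omega> 1 u y" for y
    using swap_forms[OF I(1,2) _ x1(2)] by simp
  have x2': "\<omega> 1 x2 y = \<omega> 3 u y" for y
    using swap_forms[OF I(3,1), of x2 "- u"] x2(2) by (simp add: bs I)
  have x3': "\<omega> 2 x3 y = \<omega> 3 u y" for y
    using swap_forms[OF I(3,2), of x3 "- u"] x3(2) by (simp add: bs I)
  define g where "g = \<omega> 3 x1 u"
  note I' = I(1,2,3)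
  note rows = x1(2) x2(2) x3(2) x1' x2' x3'
  have u1: "\<omega> 1 u x1 = 0" "\<omega> 2 u x1 = 0" "\<omega> 3 u x1 = - g" "\<omega> 1 u x2 = 0" "\<omega> 3 u x2 = 0"
    "\<omega> 2 u x3 = 0" "\<omega> 3 u x3 = 0"
    using I'[THEN anti, of u x1] I'[THEN anti, of u x2] I'[THEN anti, of u x3] I'[THEN alt, of u]
    unfolding g_def by (simp_all add: rows)
  have u2: "\<omega> 2 u x2 = g" "\<omega> 1 u x3 = - g"
    using anti[OF I(1), of x1 x2] anti[OF I(2), of x1 x3] by (simp_all add: rows u1)
  have rest: "\<omega> 1 x3 x1 = 0" "\<omega> 1 x3 x2 = 0" "\<omega> 1 x3 u = g" "\<omega> 2 x2 x1 = 0" "\<omega> 2 x2 x3 = 0"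
    "\<omega> 2 x2 u = - g" "\<omega> 3 x1 x2 = 0" "\<omega> 3 x1 x3 = 0" "\<omega> 3 x1 u = g"
    using anti[OF I(1), of x3 x1] anti[OF I(1), of x3 x2] anti[OF I(1), of x3 u]
      anti[OF I(2), of x2 x1] anti[OF I(2), of x2 x3] anti[OF I(2), of x2 u]
      anti[OF I(3), of x1 x2] anti[OF I(3), of x1 x3]
    by (simp_all add: rows u1 u2 g_def)
  note vals = rows u1 u2 rest I'[THEN alt]
  have "g \<noteq> 0"
  proof
    assume g: "g = 0"
    have one: False if "\<And>y. \<omega> 1 u y = l * \<omega> 2 u y" for l
    proof -
      have "u - l *\<^sub>R x1 = 0"
        by (rule nondegenerate[OF I(1)]) (simp_all add: es u x1(1) bs I that x1(2))
      then have ux: "u = l *\<^sub>R x1" by simp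
      have "\<omega> 2 u y = 0" for y
      proof -
        have "\<omega> 2 u y = l * \<omega> 2 x1 y" by (subst ux) (simp add: bs I)
        then have "\<omega> 2 u y = - (l * l) * \<omega> 2 u y" by (simp add: x1' that)
        then have "(1 + l * l) * \<omega> 2 u y = 0" by (simp add: algebra_simps)
        moreover have "1 + l * l \<noteq> 0" using zero_le_square[of l] by linarith
        ultimately show ?thesis by simp
      qed
      then show False using nondegenerate[OF I(2) u(1)] u(2) by blast
    qed
    have two: False if "\<And>y. \<omega> 2 u y = l * \<omega> 1 u y" for l
    proof -
      have "x1 - l *\<^sub>R u = 0"
        by (rule nondegenerate[OF I(1)]) (simp_all add: es u x1(1) bs I that x1(2))
      then have xu: "x1 = l *\<^sub>R u" by simp
      have "\<omega> 1 u y = 0" for y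
      proof -
        have "\<omega> 2 x1 y = l * \<omega> 2 u y" by (subst xu) (simp add: bs I)
        then have "\<omega> 1 u y = - (l * l) * \<omega> 1 u y" by (simp add: x1' that)
        then have "(1 + l * l) * \<omega> 1 u y = 0" by (simp add: algebra_simps)
        moreover have "1 + l * l \<noteq> 0" using zero_le_square[of l] by linarith
        ultimately show ?thesis by simp
      qed
      then show False using nondegenerate[OF I(1) u(1)] u(2) by blast
    qed
    \<comment> \<open>On the pairs \<open>(u, x1)\<close> and \<open>(y, z)\<close> the forms give three \<open>2 \<times> 2\<close> matrices that are orthogonal with equal
    norm for the determinant form; its signature is \<open>(2, 2)\<close>, so there can be no three.\<close>
    obtain y where y: "\<omega> 1 u y = 1" "\<omega> 2 u y = 0"
      using separate_functionals[OF lin(1)[OF I(1), of u] lin(1)[OF I(2), of u]] one by metis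
    obtain z where z: "\<omega> 2 u z = 1" "\<omega> 1 u z = 0"
      using separate_functionals[OF lin(1)[OF I(2), of u] lin(1)[OF I(1), of u]] two by metis
    have "\<omega> 3 x1 z = - \<omega> 3 u y" "\<omega> 3 x1 y = \<omega> 3 u z"
      using orth[OF I(1,3), of u x1 y z] orth[OF I(2,3), of u x1 y z]
      unfolding wedge22_def by (simp_all add: vals y z g)
    moreover have "2 * (\<omega> 3 u z * \<omega> 3 x1 y) - 2 * (\<omega> 3 u y * \<omega> 3 x1 z) = - 2"
      using same[OF I(3), of u x1 y z] unfolding wedge22_def by (simp add: vals y z g)
    ultimately have "\<omega> 3 u z * \<omega> 3 u z + \<omega> 3 u y * \<omega> 3 u y = - 1" by simp
    then show False using zero_le_square[of "\<omega> 3 u z"] zero_le_square[of "\<omega> 3 u y"] by linarith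
  qed
  moreover have "0 \<le> g" unfolding g_def by (rule pos) (rule x1(2))
  ultimately have g: "g > 0" by simp
  define r where "r = 1 / sqrt g"
  have r: "r > 0" "r * (r * g) = 1" using g by (simp_all add: r_def field_simps)
  define e1 where "e1 = r *\<^sub>R x1"
  define e2 where "e2 = r *\<^sub>R x2"
  define e3 where "e3 = r *\<^sub>R x3"
  define e4 where "e4 = r *\<^sub>R u"
  have fr: "\<omega> 1 e1 e2 = 1" "\<omega> 1 e1 e3 = 0" "\<omega> 1 e1 e4 = 0" "\<omega> 1 e2 e3 = 0" "\<omega> 1 e2 e4 = 0"
      "\<omega> 1 e3 e4 = 1"
    "\<omega> 2 e1 e2 = 0" "\<omega> 2 e1 e3 = 1" "\<omega> 2 e1 e4 = 0" "\<omega> 2 e2 e3 = 0" "\<omega> 2 e2 e4 = - 1"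
      "\<omega> 2 e3 e4 = 0"
    "\<omega> 3 e1 e2 = 0" "\<omega> 3 e1 e3 = 0" "\<omega> 3 e1 e4 = 1" "\<omega> 3 e2 e3 = 1" "\<omega> 3 e2 e4 = 0"
      "\<omega> 3 e3 e4 = 0"
    unfolding e1_def e2_def e3_def e4_def by (simp_all add: bs I vals r(2))
  have sw: "\<omega> i e2 e1 = - \<omega> i e1 e2" "\<omega> i e3 e1 = - \<omega> i e1 e3" "\<omega> i e4 e1 = - \<omega> i e1 e4"
    "\<omega> i e3 e2 = - \<omega> i e2 e3" "\<omega> i e4 e2 = - \<omega> i e2 e4" "\<omega> i e4 e3 = - \<omega> i e3 e4" if "i \<in> form_indices" for i
    using anti[OF that] by blast+
  have et: "\<eta> e1 = 0" "\<eta> e2 = 0" "\<eta> e3 = 0" "\<eta> e4 = 0"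
    unfolding e1_def e2_def e3_def e4_def by (simp_all add: es u x1(1) x2(1) x3(1))
  note vs = fr I'[THEN sw(1)] I'[THEN sw(2)] I'[THEN sw(3)] I'[THEN sw(4)] I'[THEN sw(5)]
    I'[THEN sw(6)] I'[THEN alt] I'[THEN \<xi>(2)] I'[THEN \<xi>r] et \<xi>(1)
  define t1 where "t1 = (\<lambda>x. \<omega> 1 x e2)"
  define t2 where "t2 = (\<lambda>x. \<omega> 1 e1 x)"
  define t3 where "t3 = (\<lambda>x. \<omega> 1 x e4)"
  define t4 where "t4 = (\<lambda>x. \<omega> 1 e3 x)"
  note td = t1_def t2_def t3_def t4_def
  have tl: "linear t1" "linear t2" "linear t3" "linear t4"
    unfolding td by (rule lin I(1))+
  have ex: "x = t1 x *\<^sub>R e1 + t2 x *\<^sub>R e2 + t3 x *\<^sub>R e3 + t4 x *\<^sub>R e4 + \<eta> x *\<^sub>R \<xi>" for x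
    by (rule dual_five_expand[OF dim tl eta]) (simp_all add: td vs)
  have om: "\<omega> i x y = \<omega> i (t1 x *\<^sub>R e1 + t2 x *\<^sub>R e2 + t3 x *\<^sub>R e3 + t4 x *\<^sub>R e4 + \<eta> x *\<^sub>R \<xi>)
     (t1 y *\<^sub>R e1 + t2 y *\<^sub>R e2 + t3 y *\<^sub>R e3 + t4 y *\<^sub>R e4 + \<eta> y *\<^sub>R \<xi>)" for i x y
    by (rule arg_cong2[OF ex ex])
  have "adapted_coframe e1 e2 e3 e4 \<xi> t1 t2 t3 t4 \<eta> \<eta> (\<omega> 1) (\<omega> 2) (\<omega> 3)"
  proof
    fix x y
    show "x = t1 x *\<^sub>R e1 + t2 x *\<^sub>R e2 + t3 x *\<^sub>R e3 + t4 x *\<^sub>R e4 + \<eta> x *\<^sub>R \<xi>" by (rule ex)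
    show "\<omega> 1 x y = t1 x * t2 y - t2 x * t1 y + t3 x * t4 y - t4 x * t3 y"
      unfolding om[of 1 x y] by (simp only: bs I vs) (simp add: algebra_simps)
    show "\<omega> 2 x y = t1 x * t3 y - t3 x * t1 y + t4 x * t2 y - t2 x * t4 y"
      unfolding om[of 2 x y] by (simp only: bs I vs) (simp add: algebra_simps)
    show "\<omega> 3 x y = t1 x * t4 y - t4 x * t1 y + t2 x * t3 y - t3 x * t2 y"
      unfolding om[of 3 x y] by (simp only: bs I vs) (simp add: algebra_simps)
  qed (simp_all add: td vs bs I es)
  then show ?thesis using that[OF r(1)] unfolding e4_def by blast
qed

text \<open>Two frames are used. The first is arbitrary and only serves to find the closed form \<open>\<beta>\<close>; the second
  is built on the vector dual to \<open>\<beta>\<close> under \<open>\<omega>3\<close>, so that its first coordinate is a multiple of \<open>\<beta>\<close>.\<close>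

lemma not_solvable_bracket:
  assumes "double_hypo_algebra br \<eta> (\<omega> 1) (\<omega> 2) (\<omega> 3)"
  shows "\<not> lie_algebra.solvable_bracket br"
proof
  interpret double_hypo_algebra br \<eta> "\<omega> 1" "\<omega> 2" "\<omega> 3" by (rule assms)
  assume solv: "solvable_bracket"
  obtain \<xi> where \<xi>: "\<eta> \<xi> = 1" "\<And>i y. i \<in> form_indices \<Longrightarrow> \<omega> i \<xi> y = 0" using reeb by blast
  have "\<exists>u. \<eta> u = 0 \<and> u \<noteq> 0"
  proof (rule ccontr)
    assume no: "\<nexists>u. \<eta> u = 0 \<and> u \<noteq> 0"
    have "\<omega> 1 x y = 0" for x y
    proof -
      have "\<eta> (x - \<eta> x *\<^sub>R \<xi>) = 0" using \<xi>(1) by (simp add: es)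
      then have "x - \<eta> x *\<^sub>R \<xi> = 0" using no by blast
      then have "x = \<eta> x *\<^sub>R \<xi>" by simp
      then have "\<omega> 1 x y = \<omega> 1 (\<eta> x *\<^sub>R \<xi>) y" by (rule arg_cong)
      then show ?thesis by (simp only: bs I \<xi>(2) scaleR_zero_right)
    qed
    then show False using nonzero by (simp add: wedge22_def)
  qed
  then obtain u where u: "\<eta> u = 0" "u \<noteq> 0" by blast
  obtain e1 e2 e3 e5 r t1 t2 t3 t4 t5 where "r > 0"
    and F: "adapted_coframe e1 e2 e3 (r *\<^sub>R u) e5 t1 t2 t3 t4 t5 \<eta> (\<omega> 1) (\<omega> 2) (\<omega> 3)"
    by (rule adapted_frame_exists[OF u])
  interpret F: adapted_coframe e1 e2 e3 "r *\<^sub>R u" e5 t1 t2 t3 t4 t5 \<eta> "\<omega> 1" "\<omega> 2" "\<omega> 3" by (rule F)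
  interpret F: double_hypo_frame br \<eta> "\<omega> 1" "\<omega> 2" "\<omega> 3" e1 e2 e3 "r *\<^sub>R u" e5 t1 t2 t3 t4 t5 ..
  obtain \<beta> :: "'a \<Rightarrow> real" where \<beta>: "linear \<beta>" "\<forall>x y. \<beta> (br x y) = 0" "\<beta> e5 = 0" "\<exists>x. \<beta> x \<noteq> 0"
    by (rule F.closed_form[OF solv])
  have e5: "\<eta> e5 = 1" "\<omega> 3 e5 y = 0" for y
    using F.eta[of e5] F.omega3[of e5 y] by (simp_all add: F.dual)
  have n\<beta>: "linear (\<lambda>y. - \<beta> y)" "- \<beta> e5 = 0"
    using linear_compose_neg[OF \<beta>(1)] \<beta>(3) by simp_all
  obtain v where v: "\<eta> v = 0" "\<And>y. \<omega> 3 v y = - \<beta> y"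
    using represent[OF I(3) e5 n\<beta>] by metis
  have "v \<noteq> 0" using v(2) \<beta>(4) by (auto simp: bs I)
  obtain f1 f2 f3 f5 r s1 s2 s3 s4 s5 where r: "r > 0"
    and K: "adapted_coframe f1 f2 f3 (r *\<^sub>R v) f5 s1 s2 s3 s4 s5 \<eta> (\<omega> 1) (\<omega> 2) (\<omega> 3)"
    by (rule adapted_frame_exists[OF v(1) \<open>v \<noteq> 0\<close>])
  interpret K: adapted_coframe f1 f2 f3 "r *\<^sub>R v" f5 s1 s2 s3 s4 s5 \<eta> "\<omega> 1" "\<omega> 2" "\<omega> 3" by (rule K)
  interpret K: double_hypo_frame br \<eta> "\<omega> 1" "\<omega> 2" "\<omega> 3" f1 f2 f3 "r *\<^sub>R v" f5 s1 s2 s3 s4 s5 ..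
  have "s1 y = r * \<beta> y" for y
  proof -
    have "\<omega> 3 (r *\<^sub>R v) y = - s1 y" unfolding K.omega3[of "r *\<^sub>R v" y] K.dual by simp
    moreover have "\<omega> 3 (r *\<^sub>R v) y = - (r * \<beta> y)" by (simp add: bs I v(2))
    ultimately show ?thesis by simp
  qed
  then have "s1 (br x y) = 0" for x y by (simp only: \<beta>(2) mult_zero_right simp_thms)
  then show False using K.not_solvable solv by blast
qed

end

section \<open>Derivatives of operator-valued maps\<close>

text \<open>The second difference is symmetric in \<open>u\<close> and \<open>w\<close>, so this limit yields the symmetry of second
  derivatives under the weak hypothesis that each directional derivative is differentiable at the point.\<close>

lemma second_difference_limit:
  fixes f :: "'a::real_normed_vector \<Rightarrow> real"
  assumes S: "open S" "z \<in> S" and f: "\<And>x. x \<in> S \<Longrightarrow> (f has_derivative f' x) (at x)"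
    and D: "((\<lambda>x. f' x u) has_derivative D) (at z)"
  shows "((\<lambda>t. (f (z + t *\<^sub>R u + t *\<^sub>R w) - f (z + t *\<^sub>R u) - f (z + t *\<^sub>R w) + f z) / t\<^sup>2) \<longlongrightarrow> D w)
    (at_right 0)"
proof (rule tendstoI)
  fix e :: real assume e: "e > 0"
  define N where "N = norm u + norm w + 1"
  have N: "N > 0" unfolding N_def by (smt (verit) norm_ge_zero)
  define e' where "e' = e / (4 * N)"
  have e': "e' > 0" using e N by (simp add: e'_def)
  obtain d1 where d1: "d1 > 0" "ball z d1 \<subseteq> S" using S open_contains_ball by blast
  obtain d2 where d2: "d2 > 0"
    "\<And>y. norm (y - z) < d2 \<Longrightarrow> norm (f' y u - f' z u - D (y - z)) \<le> e' * norm (y - z)"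
    using D e' unfolding has_derivative_at_alt by blast
  have lD: "linear D" using D has_derivative_linear by blast
  define d where "d = min d1 d2 / N"
  have d: "d > 0" using d1 d2 N by (simp add: d_def)
  have "dist ((f (z + t *\<^sub>R u + t *\<^sub>R w) - f (z + t *\<^sub>R u) - f (z + t *\<^sub>R w) + f z) / t\<^sup>2) (D w) < e"
    if t: "0 < t" "t < d" for t
  proof -
    have tN: "t * N < min d1 d2" using t N unfolding d_def by (simp add: field_simps)
    have nb: "norm (s *\<^sub>R u + r *\<^sub>R w) \<le> t * N" if "0 \<le> s" "s \<le> t" "0 \<le> r" "r \<le> t" for s r
    proof -
      have "norm (s *\<^sub>R u + r *\<^sub>R w) \<le> s * norm u + r * norm w"
        using norm_triangle_ineq[of "s *\<^sub>R u" "r *\<^sub>R w"] that by simp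
      also have "\<dots> \<le> t * norm u + t * norm w" using that by (intro add_mono mult_right_mono) auto
      also have "\<dots> \<le> t * N" using t by (simp add: N_def algebra_simps)
      finally show ?thesis .
    qed
    have inS: "z + s *\<^sub>R u + r *\<^sub>R w \<in> S" if "0 \<le> s" "s \<le> t" "0 \<le> r" "r \<le> t" for s r
    proof -
      have "norm (s *\<^sub>R u + r *\<^sub>R w) < d1" using nb[OF that] tN by linarith
      moreover have "dist z (z + v) = norm v" for v by (simp add: dist_norm)
      ultimately have "z + s *\<^sub>R u + r *\<^sub>R w \<in> ball z d1" unfolding add.assoc mem_ball by simp
      then show ?thesis using d1 by blast
    qed
    define g where "g = (\<lambda>s. f (z + s *\<^sub>R u + t *\<^sub>R w) - f (z + s *\<^sub>R u))"
    define g' where "g' = (\<lambda>s. f' (z + s *\<^sub>R u + t *\<^sub>R w) u - f' (z + s *\<^sub>R u) u)"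
    have der: "(g has_real_derivative g' s) (at s)" if s: "0 \<le> s" "s \<le> t" for s
    proof -
      have lf: "linear (f' x)" if "x \<in> S" for x using f[OF that] has_derivative_linear by blast
      have "z + s *\<^sub>R u + t *\<^sub>R w \<in> S" "z + s *\<^sub>R u \<in> S" using inS[of s t] inS[of s 0] s t by simp_all
      note in' = this
      have "((\<lambda>s. f (z + s *\<^sub>R u + t *\<^sub>R w)) has_derivative (\<lambda>h. f' (z + s *\<^sub>R u + t *\<^sub>R w) (h *\<^sub>R u))) (at s)"
        by (rule has_derivative_compose[where g = f and f = "\<lambda>s. z + s *\<^sub>R u + t *\<^sub>R w"
              and g' = "f' (z + s *\<^sub>R u + t *\<^sub>R w)" and f' = "\<lambda>h. h *\<^sub>R u"])
          (rule derivative_eq_intros f in' refl | simp)+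
      moreover have "((\<lambda>s. f (z + s *\<^sub>R u)) has_derivative (\<lambda>h. f' (z + s *\<^sub>R u) (h *\<^sub>R u))) (at s)"
        by (rule has_derivative_compose[where g = f and f = "\<lambda>s. z + s *\<^sub>R u"
              and g' = "f' (z + s *\<^sub>R u)" and f' = "\<lambda>h. h *\<^sub>R u"])
          (rule derivative_eq_intros f in' refl | simp)+
      ultimately have "(g has_derivative (\<lambda>h. f' (z + s *\<^sub>R u + t *\<^sub>R w) (h *\<^sub>R u)
          - f' (z + s *\<^sub>R u) (h *\<^sub>R u))) (at s)"
        unfolding g_def by (rule has_derivative_diff)
      moreover have "(\<lambda>h. f' (z + s *\<^sub>R u + t *\<^sub>R w) (h *\<^sub>R u) - f' (z + s *\<^sub>R u) (h *\<^sub>R u)) = (\<lambda>h. g' s * h)"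
        unfolding g'_def linear_scale[OF lf[OF in'(1)]] linear_scale[OF lf[OF in'(2)]]
        by (auto simp: algebra_simps)
      ultimately show ?thesis unfolding has_field_derivative_def by simp
    qed
    obtain s where s: "0 < s" "s < t" "g t - g 0 = (t - 0) * g' s"
      using MVT2[OF t(1), of g g'] der by auto
    have a: "norm (f' (z + s *\<^sub>R u + t *\<^sub>R w) u - f' z u - D (s *\<^sub>R u + t *\<^sub>R w)) \<le> e' * (t * N)"
      using d2(2)[of "z + s *\<^sub>R u + t *\<^sub>R w"] nb[of s t] s t tN e'
      by (simp add: add.assoc) (smt (verit) mult_left_mono)
    have b: "norm (f' (z + s *\<^sub>R u) u - f' z u - D (s *\<^sub>R u)) \<le> e' * (t * N)"
      using d2(2)[of "z + s *\<^sub>R u"] nb[of s 0] s t tN e'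
      by simp (smt (verit) mult_left_mono)
    have "g' s - t * D w = (f' (z + s *\<^sub>R u + t *\<^sub>R w) u - f' z u - D (s *\<^sub>R u + t *\<^sub>R w))
        - (f' (z + s *\<^sub>R u) u - f' z u - D (s *\<^sub>R u))"
      unfolding g'_def by (simp add: linear_add[OF lD] linear_scale[OF lD])
    then have "\<bar>g' s - t * D w\<bar> \<le> 2 * (e' * (t * N))" using a b by (simp add: abs_le_iff)
    also have "\<dots> = t * (e / 2)" using N by (simp add: e'_def field_simps)
    finally have c: "\<bar>g' s - t * D w\<bar> \<le> t * (e / 2)" .
    have "f (z + t *\<^sub>R u + t *\<^sub>R w) - f (z + t *\<^sub>R u) - f (z + t *\<^sub>R w) + f z = t * g' s"
      using s(3) unfolding g_def by simp
    then have "(f (z + t *\<^sub>R u + t *\<^sub>R w) - f (z + t *\<^sub>R u) - f (z + t *\<^sub>R w) + f z) / t\<^sup>2 - D w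
        = (g' s - t * D w) / t"
      using t by (simp add: power2_eq_square field_simps)
    then have "dist ((f (z + t *\<^sub>R u + t *\<^sub>R w) - f (z + t *\<^sub>R u) - f (z + t *\<^sub>R w) + f z) / t\<^sup>2) (D w)
        = \<bar>g' s - t * D w\<bar> / t"
      using t by (simp add: dist_real_def)
    also have "\<dots> \<le> e / 2" using c t by (simp add: field_simps)
    finally show ?thesis using e by simp
  qed
  then show "\<forall>\<^sub>F t in at_right 0.
      dist ((f (z + t *\<^sub>R u + t *\<^sub>R w) - f (z + t *\<^sub>R u) - f (z + t *\<^sub>R w) + f z) / t\<^sup>2) (D w) < e"
    using eventually_at_right_less d unfolding eventually_at_right_field by blast
qed

lemma second_derivative_symmetric_real:
  fixes f :: "'a::real_normed_vector \<Rightarrow> real"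
  assumes S: "open S" "z \<in> S" and f: "\<And>x. x \<in> S \<Longrightarrow> (f has_derivative f' x) (at x)"
    and D: "((\<lambda>x. f' x u) has_derivative Du) (at z)" "((\<lambda>x. f' x w) has_derivative Dw) (at z)"
  shows "Du w = Dw u"
proof (rule tendsto_unique[OF trivial_limit_at_right_real second_difference_limit[OF S f D(1)]])
  show "((\<lambda>t. (f (z + t *\<^sub>R u + t *\<^sub>R w) - f (z + t *\<^sub>R u) - f (z + t *\<^sub>R w) + f z) / t\<^sup>2) \<longlongrightarrow> Dw u)
    (at_right 0)"
    using second_difference_limit[OF S f D(2), of u] by (simp add: algebra_simps)
qed

lemma second_derivative_symmetric:
  fixes f :: "'a::real_normed_vector \<Rightarrow> 'b::euclidean_space"
  assumes S: "open S" "z \<in> S" and f: "\<And>x. x \<in> S \<Longrightarrow> (f has_derivative f' x) (at x)"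
    and D: "((\<lambda>x. f' x u) has_derivative Du) (at z)" "((\<lambda>x. f' x w) has_derivative Dw) (at z)"
  shows "Du w = Dw u"
proof (rule euclidean_eqI)
  fix b :: 'b
  show "Du w \<bullet> b = Dw u \<bullet> b"
    by (rule second_derivative_symmetric_real[OF S, of "\<lambda>x. f x \<bullet> b" "\<lambda>x h. f' x h \<bullet> b"])
      (auto intro!: has_derivative_inner_left f D)
qed

lemma smooth_on_differentiable:
  assumes "smooth_on S f" "x \<in> S"
  shows "f differentiable (at x)" "(\<lambda>x. frechet_derivative f (at x) v) differentiable (at x)"
proof -
  have "Ck_on (Suc (Suc 0)) S f" using assms unfolding smooth_on_def by blast
  then show "f differentiable (at x)" "(\<lambda>x. frechet_derivative f (at x) v) differentiable (at x)"
    using assms(2) by auto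
qed

lemma has_derivative_blinfun_pointwise:
  fixes F F' :: "'x::real_normed_vector \<Rightarrow> ('a::euclidean_space \<Rightarrow>\<^sub>L 'b::real_normed_vector)"
  assumes D: "\<And>v. ((\<lambda>x. F x v) has_derivative (\<lambda>h. F' h v)) (at p)" and l: "bounded_linear F'"
  shows "(F has_derivative F') (at p)"
  unfolding has_derivative_iff_norm
proof (intro conjI l)
  have "((\<lambda>y. \<Sum>b\<in>Basis. norm ((F y b - F p b) - F' (y - p) b) / norm (y - p)) \<longlongrightarrow> (\<Sum>b\<in>(Basis::'a set). 0))
      (at p)"
    using D unfolding has_derivative_iff_norm by (intro tendsto_sum) blast
  then have lim: "((\<lambda>y. \<Sum>b\<in>Basis. norm ((F y b - F p b) - F' (y - p) b) / norm (y - p)) \<longlongrightarrow> 0) (at p)"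
    by simp
  show "((\<lambda>y. norm (F y - F p - F' (y - p)) / norm (y - p)) \<longlongrightarrow> 0) (at p)"
  proof (rule Lim_null_comparison[OF _ lim], rule always_eventually, rule allI)
    fix y
    have "norm (F y - F p - F' (y - p)) \<le> (\<Sum>b\<in>Basis. norm ((F y - F p - F' (y - p)) b))"
      by (rule norm_blinfun_euclidean_le)
    then have "norm (F y - F p - F' (y - p)) / norm (y - p)
        \<le> (\<Sum>b\<in>Basis. norm ((F y - F p - F' (y - p)) b)) / norm (y - p)"
      by (intro divide_right_mono) auto
    then show "norm (norm (F y - F p - F' (y - p)) / norm (y - p))
        \<le> (\<Sum>b\<in>Basis. norm ((F y b - F p b) - F' (y - p) b) / norm (y - p))"
      by (simp add: sum_divide_distrib blinfun.diff_left)
  qed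
qed

lemma blinfun_compose_assoc: "(f o\<^sub>L g) o\<^sub>L h = f o\<^sub>L (g o\<^sub>L h)"
  by (rule blinfun_eqI) simp

lemma compose_id: "f o\<^sub>L id_blinfun = f"
  by (rule blinfun_eqI) simp

text \<open>From \<open>A - 1 = (L - 1) - (R - 1) - (R - 1)(A - 1)\<close>, absorbing the last term on the left. It gives
  continuity of \<open>A\<close> without inverting \<open>R\<close>.\<close>

lemma norm_factor_bound:
  fixes R A L :: "'a::real_normed_vector \<Rightarrow>\<^sub>L 'a"
  assumes "R o\<^sub>L A = L" and R: "norm (R - id_blinfun) \<le> 1 / 2"
  shows "norm (A - id_blinfun) \<le> 2 * (norm (L - id_blinfun) + norm (R - id_blinfun))"
proof -
  have "A - id_blinfun = (L - id_blinfun) - (R - id_blinfun) - ((R - id_blinfun) o\<^sub>L (A - id_blinfun))"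
    unfolding assms(1)[symmetric] by (rule blinfun_eqI) (simp add: blinfun.bilinear_simps)
  then have "norm (A - id_blinfun) \<le> norm (L - id_blinfun) + norm (R - id_blinfun)
      + norm ((R - id_blinfun) o\<^sub>L (A - id_blinfun))"
    using norm_triangle_ineq4[of "(L - id_blinfun) - (R - id_blinfun)" "(R - id_blinfun) o\<^sub>L (A - id_blinfun)"]
      norm_triangle_ineq4[of "L - id_blinfun" "R - id_blinfun"] by simp
  moreover have "norm ((R - id_blinfun) o\<^sub>L (A - id_blinfun)) \<le> 1 / 2 * norm (A - id_blinfun)"
    using norm_blinfun_compose[of "R - id_blinfun" "A - id_blinfun"] mult_right_mono[OF R norm_ge_zero[of "A - id_blinfun"]] by (rule order_trans)
  ultimately show ?thesis by simp
qed

lemma tendsto_factor: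
  fixes R A L :: "'x \<Rightarrow> ('a::real_normed_vector \<Rightarrow>\<^sub>L 'a)"
  assumes eq: "\<forall>\<^sub>F x in F. R x o\<^sub>L A x = L x"
    and R: "(R \<longlongrightarrow> id_blinfun) F" and L: "(L \<longlongrightarrow> id_blinfun) F"
  shows "(A \<longlongrightarrow> id_blinfun) F"
proof -
  have "((\<lambda>x. 2 * (norm (L x - id_blinfun) + norm (R x - id_blinfun))) \<longlongrightarrow> 2 * (0 + 0)) F"
    using tendsto_norm_zero[OF LIM_zero[OF L]] tendsto_norm_zero[OF LIM_zero[OF R]]
    by (intro tendsto_intros)
  then have lim: "((\<lambda>x. 2 * (norm (L x - id_blinfun) + norm (R x - id_blinfun))) \<longlongrightarrow> 0) F" by simp
  have "\<forall>\<^sub>F x in F. norm (R x - id_blinfun) < 1 / 2"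
    using tendstoD[OF R, of "1 / 2"] by (simp add: dist_norm)
  with eq have "\<forall>\<^sub>F x in F. norm (A x - id_blinfun) \<le> 2 * (norm (L x - id_blinfun) + norm (R x - id_blinfun))"
    by eventually_elim (rule norm_factor_bound, auto)
  then have "((\<lambda>x. A x - id_blinfun) \<longlongrightarrow> 0) F" by (rule Lim_null_comparison[OF _ lim])
  then show ?thesis by (rule LIM_zero_cancel)
qed

text \<open>Differentiation of \<open>A = R\<^sup>-\<^sup>1 L\<close> at a point where all factors are the identity: in the expansion of
  \<open>A - 1\<close> above, the product \<open>(R - 1)(A - 1)\<close> is of second order.\<close>

lemma has_derivative_factor:
  fixes R A L :: "'x::real_normed_vector \<Rightarrow> ('a::real_normed_vector \<Rightarrow>\<^sub>L 'a)"
  assumes S: "open S" "p \<in> S" and eq: "\<And>x. x \<in> S \<Longrightarrow> R x o\<^sub>L A x = L x"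
    and R: "(R has_derivative R') (at p)" "R p = id_blinfun"
    and L: "(L has_derivative L') (at p)" "L p = id_blinfun"
  shows "(A has_derivative (\<lambda>h. L' h - R' h)) (at p)"
proof -
  define Q where "Q = (\<lambda>x. (R x - id_blinfun) o\<^sub>L (A x - id_blinfun))"
  have Ap: "A p = id_blinfun"
    using eq[OF S(2)] R(2) L(2) by (auto intro!: blinfun_eqI dest: arg_cong[of _ _ "\<lambda>f. blinfun_apply f _"])
  have ev: "\<forall>\<^sub>F x in at p. R x o\<^sub>L A x = L x"
    using eq S by (auto simp: eventually_at_topological)
  have "(R \<longlongrightarrow> id_blinfun) (at p)" "(L \<longlongrightarrow> id_blinfun) (at p)"
    using has_derivative_continuous[OF R(1)] has_derivative_continuous[OF L(1)] R(2) L(2)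
    by (simp_all add: continuous_within)
  then have A: "(A \<longlongrightarrow> id_blinfun) (at p)" by (rule tendsto_factor[OF ev])
  have Q: "(Q has_derivative (\<lambda>h. 0)) (at p)"
    unfolding has_derivative_at_alt
  proof (intro conjI allI impI)
    show "bounded_linear (\<lambda>h::'x. 0 :: 'a \<Rightarrow>\<^sub>L 'a)" by (rule bounded_linear_zero)
    fix e :: real assume e: "e > 0"
    obtain K where K: "K > 0" "\<And>h. norm (R' h) \<le> norm h * K"
      using bounded_linear.pos_bounded[OF has_derivative_bounded_linear[OF R(1)]] by blast
    obtain d1 where d1: "d1 > 0"
      "\<And>y. norm (y - p) < d1 \<Longrightarrow> norm (R y - R p - R' (y - p)) \<le> 1 * norm (y - p)"
      using R(1) unfolding has_derivative_at_alt using zero_less_one by blast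
    have "e / (K + 1) > 0" using e K by simp
    then obtain d2 where d2: "d2 > 0"
      "\<And>y. y \<noteq> p \<Longrightarrow> dist y p < d2 \<Longrightarrow> dist (A y) id_blinfun < e / (K + 1)"
      using A unfolding Lim_at zero_less_dist_iff by blast
    have "norm (Q y - Q p - 0) \<le> e * norm (y - p)" if y: "norm (y - p) < min d1 d2" for y
    proof (cases "y = p")
      case False
      have "norm (R y - id_blinfun) \<le> norm (R y - R p - R' (y - p)) + norm (R' (y - p))"
        using R(2) norm_triangle_ineq[of "R y - R p - R' (y - p)" "R' (y - p)"] by simp
      also have "\<dots> \<le> (K + 1) * norm (y - p)"
        using d1(2)[of y] K(2)[of "y - p"] y by (simp add: algebra_simps)
      finally have r: "norm (R y - id_blinfun) \<le> (K + 1) * norm (y - p)" .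
      have a: "norm (A y - id_blinfun) \<le> e / (K + 1)"
        using d2(2)[OF False] y by (simp add: dist_norm)
      have "norm (Q y) \<le> norm (R y - id_blinfun) * norm (A y - id_blinfun)"
        unfolding Q_def by (rule norm_blinfun_compose)
      also have "\<dots> \<le> ((K + 1) * norm (y - p)) * (e / (K + 1))"
        using r a K by (intro mult_mono) auto
      also have "\<dots> = e * norm (y - p)" using K by simp
      finally show ?thesis by (simp add: Q_def Ap)
    qed simp
    then show "\<exists>d>0. \<forall>y. norm (y - p) < d \<longrightarrow> norm (Q y - Q p - 0) \<le> e * norm (y - p)"
      using d1(1) d2(1) by (intro exI[of _ "min d1 d2"]) auto
  qed
  have "((\<lambda>x. id_blinfun + (L x - id_blinfun) - (R x - id_blinfun) - Q x) has_derivative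
      (\<lambda>h. 0 + (L' h - 0) - (R' h - 0) - 0)) (at p)"
    by (intro has_derivative_diff has_derivative_add has_derivative_const R(1) L(1) Q)
  then have D: "((\<lambda>x. id_blinfun + (L x - id_blinfun) - (R x - id_blinfun) - Q x) has_derivative
      (\<lambda>h. L' h - R' h)) (at p)" by simp
  show ?thesis
  proof (rule has_derivative_transform_within_open[OF D S])
    fix x assume "x \<in> S"
    show "id_blinfun + (L x - id_blinfun) - (R x - id_blinfun) - Q x = A x"
      unfolding Q_def eq[OF \<open>x \<in> S\<close>, symmetric]
      by (rule blinfun_eqI) (simp add: blinfun.bilinear_simps)
  qed
qed



section \<open>Tangents of abstract subgroups under a representation\<close>

text \<open>The families \<open>h\<close> are not required to be continuous; a one-sided difference quotient of \<open>\<rho>\<close> suffices.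
  So the notion makes sense for a subgroup that is not closed, such as a derived subgroup may be.\<close>

definition tangent_cone :: "('g \<Rightarrow> ('a::real_normed_vector \<Rightarrow>\<^sub>L 'a)) \<Rightarrow> 'g set \<Rightarrow> ('a \<Rightarrow>\<^sub>L 'a) set" where
  "tangent_cone \<rho> H = {X. \<exists>h. (\<forall>t>0. h t \<in> H) \<and>
     ((\<lambda>t. (1 / t) *\<^sub>R (\<rho> (h t) - id_blinfun)) \<longlongrightarrow> X) (at_right 0)}"

lemma tangent_curve_tendsto:
  fixes r :: "real \<Rightarrow> ('a::real_normed_vector \<Rightarrow>\<^sub>L 'a)"
  assumes "((\<lambda>t. (1 / t) *\<^sub>R (r t - id_blinfun)) \<longlongrightarrow> X) (at_right 0)"
  shows "(r \<longlongrightarrow> id_blinfun) (at_right 0)"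
proof -
  have "((\<lambda>t. t *\<^sub>R ((1 / t) *\<^sub>R (r t - id_blinfun))) \<longlongrightarrow> 0 *\<^sub>R X) (at_right 0)"
    by (intro tendsto_intros assms)
  moreover have "\<forall>\<^sub>F t in at_right 0. t *\<^sub>R ((1 / t) *\<^sub>R (r t - id_blinfun)) = r t - id_blinfun"
    using eventually_at_right_less[of 0] by eventually_elim simp
  ultimately have "((\<lambda>t. r t - id_blinfun) \<longlongrightarrow> 0 *\<^sub>R X) (at_right 0)"
    by (rule Lim_transform_eventually)
  then have "((\<lambda>t. r t - id_blinfun) \<longlongrightarrow> 0) (at_right 0)" by simp
  then show ?thesis by (rule LIM_zero_cancel)
qed

locale group_representation = group G for G (structure) +
  fixes \<rho> :: "'a \<Rightarrow> ('v::real_normed_vector \<Rightarrow>\<^sub>L 'v)"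
  assumes rho_mult: "x \<in> carrier G \<Longrightarrow> y \<in> carrier G \<Longrightarrow> \<rho> (x \<otimes> y) = \<rho> x o\<^sub>L \<rho> y"
    and rho_one: "\<rho> \<one> = id_blinfun"
begin

lemma tangent_cone_one: "tangent_cone \<rho> {\<one>} = {0}"
proof -
  have "X = 0" if X: "X \<in> tangent_cone \<rho> {\<one>}" for X
  proof -
    obtain h where h: "\<And>t. t > 0 \<Longrightarrow> h t = \<one>"
      "((\<lambda>t. (1 / t) *\<^sub>R (\<rho> (h t) - id_blinfun)) \<longlongrightarrow> X) (at_right (0::real))"
      using X unfolding tangent_cone_def by auto
    have "\<forall>\<^sub>F t in at_right 0. (1 / t) *\<^sub>R (\<rho> (h t) - id_blinfun) = 0"
      using eventually_at_right_less[of 0] by eventually_elim (simp add: h(1) rho_one)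
    then have "((\<lambda>t. (1 / t) *\<^sub>R (\<rho> (h t) - id_blinfun)) \<longlongrightarrow> 0) (at_right 0)"
      by (rule tendsto_eventually)
    then show ?thesis using tendsto_unique[OF trivial_limit_at_right_real h(2)] by simp
  qed
  moreover have "0 \<in> tangent_cone \<rho> {\<one>}"
    unfolding tangent_cone_def by (auto intro!: exI[of _ "\<lambda>_. \<one>"] simp: rho_one)
  ultimately show ?thesis by blast
qed

lemma tangent_cone_add:
  assumes H: "subgroup H G" and X: "X \<in> tangent_cone \<rho> H" and Y: "Y \<in> tangent_cone \<rho> H"
  shows "X + Y \<in> tangent_cone \<rho> H"
proof -
  obtain h where h: "\<And>t. t > 0 \<Longrightarrow> h t \<in> H"
    "((\<lambda>t. (1 / t) *\<^sub>R (\<rho> (h t) - id_blinfun)) \<longlongrightarrow> X) (at_right 0)"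
    using X unfolding tangent_cone_def by blast
  obtain k where k: "\<And>t. t > 0 \<Longrightarrow> k t \<in> H"
    "((\<lambda>t. (1 / t) *\<^sub>R (\<rho> (k t) - id_blinfun)) \<longlongrightarrow> Y) (at_right 0)"
    using Y unfolding tangent_cone_def by blast
  have "((\<lambda>t. ((1 / t) *\<^sub>R (\<rho> (h t) - id_blinfun) o\<^sub>L \<rho> (k t)) + (1 / t) *\<^sub>R (\<rho> (k t) - id_blinfun))
      \<longlongrightarrow> (X o\<^sub>L id_blinfun) + Y) (at_right 0)"
    by (intro tendsto_add bounded_bilinear.tendsto[OF bounded_bilinear_blinfun_compose] h k
        tangent_curve_tendsto[OF k(2)])
  moreover have "\<forall>\<^sub>F t in at_right 0. ((1 / t) *\<^sub>R (\<rho> (h t) - id_blinfun) o\<^sub>L \<rho> (k t))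
      + (1 / t) *\<^sub>R (\<rho> (k t) - id_blinfun) = (1 / t) *\<^sub>R (\<rho> (h t \<otimes> k t) - id_blinfun)"
    using eventually_at_right_less[of 0]
  proof eventually_elim
    case (elim t)
    then have "h t \<in> carrier G" "k t \<in> carrier G" using h(1) k(1) subgroup.mem_carrier[OF H] by auto
    then show ?case
      by (intro blinfun_eqI) (simp add: rho_mult blinfun.bilinear_simps algebra_simps)
  qed
  ultimately have "((\<lambda>t. (1 / t) *\<^sub>R (\<rho> (h t \<otimes> k t) - id_blinfun)) \<longlongrightarrow> X + Y) (at_right 0)"
    unfolding compose_id by (rule Lim_transform_eventually)
  moreover have "h t \<otimes> k t \<in> H" if "t > 0" for t
    using h(1) k(1) that subgroup.m_closed[OF H] by blast
  ultimately show ?thesis unfolding tangent_cone_def by (auto intro!: exI[of _ "\<lambda>t. h t \<otimes> k t"])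
qed

lemma tangent_cone_scale:
  assumes H: "subgroup H G" and X: "X \<in> tangent_cone \<rho> H" and c: "0 \<le> c"
  shows "c *\<^sub>R X \<in> tangent_cone \<rho> H"
proof (cases "c = 0")
  case True
  then show ?thesis unfolding tangent_cone_def
    using subgroup.one_closed[OF H] by (auto intro!: exI[of _ "\<lambda>_. \<one>"] simp: rho_one)
next
  case False
  with c have c: "c > 0" by simp
  obtain h where h: "\<And>t. t > 0 \<Longrightarrow> h t \<in> H"
    "((\<lambda>t. (1 / t) *\<^sub>R (\<rho> (h t) - id_blinfun)) \<longlongrightarrow> X) (at_right 0)"
    using X unfolding tangent_cone_def by blast
  have "filterlim (\<lambda>t. c * t) (at_right 0) (at_right 0)"
    unfolding filterlim_at
  proof
    show "((\<lambda>t. c * t) \<longlongrightarrow> 0) (at_right 0)" by (auto intro!: tendsto_eq_intros)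
    show "\<forall>\<^sub>F t in at_right 0. c * t \<in> {0<..} \<and> c * t \<noteq> 0"
      using eventually_at_right_less[of 0] by eventually_elim (use c in simp)
  qed
  then have "((\<lambda>t. (1 / (c * t)) *\<^sub>R (\<rho> (h (c * t)) - id_blinfun)) \<longlongrightarrow> X) (at_right 0)"
    by (rule filterlim_compose[OF h(2)])
  then have "((\<lambda>t. c *\<^sub>R ((1 / (c * t)) *\<^sub>R (\<rho> (h (c * t)) - id_blinfun))) \<longlongrightarrow> c *\<^sub>R X) (at_right 0)"
    by (intro tendsto_intros)
  then have "((\<lambda>t. (1 / t) *\<^sub>R (\<rho> (h (c * t)) - id_blinfun)) \<longlongrightarrow> c *\<^sub>R X) (at_right 0)"
    using c by simp
  moreover have "h (c * t) \<in> H" if "t > 0" for t using h(1) c that by simp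
  ultimately show ?thesis unfolding tangent_cone_def by (auto intro!: exI[of _ "\<lambda>t. h (c * t)"])
qed

text \<open>For \<open>h(t) = 1 + t X + o(t)\<close> and \<open>k(t) = 1 + t Y + o(t)\<close> the commutator is
  \<open>1 + t\<^sup>2 (X Y - Y X) + o(t\<^sup>2)\<close>, so it is evaluated at the square root of the parameter.\<close>

lemma tangent_cone_commutator:
  assumes H: "subgroup H G" and X: "X \<in> tangent_cone \<rho> H" and Y: "Y \<in> tangent_cone \<rho> H"
  shows "(X o\<^sub>L Y) - (Y o\<^sub>L X) \<in> tangent_cone \<rho> (derived G H)"
proof -
  obtain h where h: "\<And>t. t > 0 \<Longrightarrow> h t \<in> H"
    "((\<lambda>t. (1 / t) *\<^sub>R (\<rho> (h t) - id_blinfun)) \<longlongrightarrow> X) (at_right 0)"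
    using X unfolding tangent_cone_def by blast
  obtain k where k: "\<And>t. t > 0 \<Longrightarrow> k t \<in> H"
    "((\<lambda>t. (1 / t) *\<^sub>R (\<rho> (k t) - id_blinfun)) \<longlongrightarrow> Y) (at_right 0)"
    using Y unfolding tangent_cone_def by blast
  note bcomp = bounded_bilinear.tendsto[OF bounded_bilinear_blinfun_compose]
  define x where "x = (\<lambda>t. (1 / t) *\<^sub>R (\<rho> (h t) - id_blinfun))"
  define y where "y = (\<lambda>t. (1 / t) *\<^sub>R (\<rho> (k t) - id_blinfun))"
  define c where "c = (\<lambda>t. h t \<otimes> k t \<otimes> inv (h t) \<otimes> inv (k t))"
  define A where "A = (\<lambda>t. \<rho> (inv (k t \<otimes> h t)))"
  have carr: "h t \<in> carrier G" "k t \<in> carrier G" if "t > 0" for t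
    using h(1) k(1) that subgroup.mem_carrier[OF H] by auto
  have id: "id_blinfun o\<^sub>L id_blinfun = (id_blinfun :: 'v \<Rightarrow>\<^sub>L 'v)" by (rule blinfun_eqI) simp
  have kh: "((\<lambda>t. \<rho> (k t) o\<^sub>L \<rho> (h t)) \<longlongrightarrow> id_blinfun) (at_right 0)"
    using bcomp[OF tangent_curve_tendsto[OF k(2)] tangent_curve_tendsto[OF h(2)]] by (simp add: id)
  have "(A \<longlongrightarrow> id_blinfun) (at_right 0)"
  proof (rule tendsto_factor[OF _ kh tendsto_const])
    show "\<forall>\<^sub>F t in at_right 0. \<rho> (k t) o\<^sub>L \<rho> (h t) o\<^sub>L A t = id_blinfun"
      using eventually_at_right_less[of 0]
    proof eventually_elim
      case (elim t)
      then show ?case unfolding A_def using carr[of t]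
        by (simp add: rho_mult[symmetric] r_inv rho_one)
    qed
  qed
  then have lim: "((\<lambda>t. ((x t o\<^sub>L y t) - (y t o\<^sub>L x t)) o\<^sub>L A t)
      \<longlongrightarrow> ((X o\<^sub>L Y) - (Y o\<^sub>L X)) o\<^sub>L id_blinfun) (at_right 0)"
    using h(2) k(2) unfolding x_def y_def by (intro bcomp tendsto_diff)
  have sq: "((x t o\<^sub>L y t) - (y t o\<^sub>L x t)) o\<^sub>L A t = (1 / t\<^sup>2) *\<^sub>R (\<rho> (c t) - id_blinfun)" if t: "t > 0" for t
  proof -
    note ca = carr[OF t]
    have kh: "inv (k t) \<otimes> (k t \<otimes> h t) = h t" using ca by (simp add: m_assoc[symmetric])
    have "c t \<otimes> (k t \<otimes> h t) = h t \<otimes> (k t \<otimes> (inv (h t) \<otimes> (inv (k t) \<otimes> (k t \<otimes> h t))))"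
      unfolding c_def using ca by (simp add: m_assoc)
    also have "\<dots> = h t \<otimes> k t" unfolding kh using ca by simp
    finally have c: "c t \<otimes> (k t \<otimes> h t) = h t \<otimes> k t" "c t \<in> carrier G"
      unfolding c_def using ca by simp_all
    have "\<rho> (c t) = \<rho> (c t) o\<^sub>L (\<rho> (k t \<otimes> h t) o\<^sub>L A t)"
      unfolding A_def using ca c by (simp add: rho_mult[symmetric] r_inv rho_one compose_id)
    also have "\<dots> = (\<rho> (h t) o\<^sub>L \<rho> (k t)) o\<^sub>L A t"
      using ca c by (simp add: rho_mult[symmetric] blinfun_compose_assoc[symmetric])
    finally have 1: "\<rho> (c t) = (\<rho> (h t) o\<^sub>L \<rho> (k t)) o\<^sub>L A t" .
    have 2: "id_blinfun = (\<rho> (k t) o\<^sub>L \<rho> (h t)) o\<^sub>L A t"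
      unfolding A_def using ca by (simp add: rho_mult[symmetric] r_inv rho_one)
    have "(x t o\<^sub>L y t) - (y t o\<^sub>L x t) = (1 / t\<^sup>2) *\<^sub>R ((\<rho> (h t) o\<^sub>L \<rho> (k t)) - (\<rho> (k t) o\<^sub>L \<rho> (h t)))"
      unfolding x_def y_def
      by (rule blinfun_eqI) (simp add: blinfun.bilinear_simps power2_eq_square algebra_simps)
    then have "((x t o\<^sub>L y t) - (y t o\<^sub>L x t)) o\<^sub>L A t
        = (1 / t\<^sup>2) *\<^sub>R (((\<rho> (h t) o\<^sub>L \<rho> (k t)) o\<^sub>L A t) - ((\<rho> (k t) o\<^sub>L \<rho> (h t)) o\<^sub>L A t))"
      by (intro blinfun_eqI) (simp add: blinfun.bilinear_simps)
    then show ?thesis unfolding 1[symmetric] 2[symmetric] .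
  qed
  have "filterlim sqrt (at_right 0) (at_right 0)"
    unfolding filterlim_at
  proof
    show "(sqrt \<longlongrightarrow> 0) (at_right 0)" by (auto intro!: tendsto_eq_intros)
    show "\<forall>\<^sub>F t in at_right 0. sqrt t \<in> {0<..} \<and> sqrt t \<noteq> 0"
      using eventually_at_right_less[of 0] by eventually_elim simp
  qed
  from filterlim_compose[OF lim this]
  have "((\<lambda>t. ((x (sqrt t) o\<^sub>L y (sqrt t)) - (y (sqrt t) o\<^sub>L x (sqrt t))) o\<^sub>L A (sqrt t))
      \<longlongrightarrow> ((X o\<^sub>L Y) - (Y o\<^sub>L X)) o\<^sub>L id_blinfun) (at_right 0)" .
  moreover have "\<forall>\<^sub>F t in at_right 0. ((x (sqrt t) o\<^sub>L y (sqrt t)) - (y (sqrt t) o\<^sub>L x (sqrt t))) o\<^sub>L A (sqrt t)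
      = (1 / t) *\<^sub>R (\<rho> (c (sqrt t)) - id_blinfun)"
    using eventually_at_right_less[of 0] by eventually_elim (subst sq, simp_all)
  ultimately have "((\<lambda>t. (1 / t) *\<^sub>R (\<rho> (c (sqrt t)) - id_blinfun))
      \<longlongrightarrow> ((X o\<^sub>L Y) - (Y o\<^sub>L X)) o\<^sub>L id_blinfun) (at_right 0)"
    by (rule Lim_transform_eventually)
  then have "((\<lambda>t. (1 / t) *\<^sub>R (\<rho> (c (sqrt t)) - id_blinfun))
      \<longlongrightarrow> (X o\<^sub>L Y) - (Y o\<^sub>L X)) (at_right 0)" by (simp only: compose_id)
  moreover have "c t \<in> derived G H" if "t > 0" for t
    using h(1)[OF that] k(1)[OF that] unfolding c_def derived_def by (blast intro: generate.incl)
  ultimately show ?thesis unfolding tangent_cone_def by (auto intro!: exI[of _ "\<lambda>t. c (sqrt t)"])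
qed

text \<open>A set contained in the span of its brackets stays tangent to every term of the derived series. The
  tangents form only a cone, but the set of brackets is symmetric by \<open>neg\<close>, so the cone contains their
  span.\<close>

lemma solvable_imp_tangent_vanishes:
  assumes solv: "solvable G"
    and lin: "linear a" and ad: "\<And>X Y. a (br X Y) = (a X o\<^sub>L a Y) - (a Y o\<^sub>L a X)"
    and neg: "\<And>X Y. br Y X = - br X Y"
    and tan: "\<And>X. X \<in> S \<Longrightarrow> a X \<in> tangent_cone \<rho> (carrier G)"
    and S: "S \<subseteq> span {br X Y | X Y. X \<in> S \<and> Y \<in> S}" and X: "X \<in> S"
  shows "a X = 0"
proof -
  have sub: "subgroup ((derived G ^^ n) (carrier G)) G" for n
    by (rule exp_of_derived_is_subgroup[OF subgroup_self])
  have "\<forall>X\<in>S. a X \<in> tangent_cone \<rho> ((derived G ^^ n) (carrier G))" for n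
  proof (induction n)
    case 0
    then show ?case using tan by simp
  next
    case (Suc n)
    let ?K = "(derived G ^^ Suc n) (carrier G)"
    have br: "a (br X Y) \<in> tangent_cone \<rho> ?K" if "X \<in> S" "Y \<in> S" for X Y
      using tangent_cone_commutator[OF sub[of n], of "a X" "a Y"] Suc that by (simp add: ad)
    have "a Z \<in> tangent_cone \<rho> ?K" if "Z \<in> span {br X Y | X Y. X \<in> S \<and> Y \<in> S}" for Z
      using that
    proof (induction rule: span_induct_alt)
      case base
      have "0 *\<^sub>R id_blinfun \<in> tangent_cone \<rho> ?K"
        unfolding tangent_cone_def using subgroup.one_closed[OF sub[of "Suc n"]]
        by (auto intro!: exI[of _ "\<lambda>_. \<one>"] simp: rho_one)
      then show ?case using linear_0[OF lin] by simp
    next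
      case (step c x y)
      then obtain X Y where x: "x = br X Y" "X \<in> S" "Y \<in> S" by blast
      have "a (c *\<^sub>R x) \<in> tangent_cone \<rho> ?K"
      proof (cases "0 \<le> c")
        case True
        then show ?thesis
          using tangent_cone_scale[OF sub[of "Suc n"] br[OF x(2,3)] True] by (simp add: linear_scale[OF lin] x(1))
      next
        case False
        then have "(- c) *\<^sub>R a (br Y X) \<in> tangent_cone \<rho> ?K"
          by (intro tangent_cone_scale[OF sub[of "Suc n"] br] x) simp
        then show ?thesis
          by (simp add: linear_scale[OF lin] linear_neg[OF lin] x(1) neg[of Y X])
      qed
      then show ?case
        using tangent_cone_add[OF sub[of "Suc n"]] step.IH by (simp add: linear_add[OF lin])
    qed
    then show ?case using S by blast
  qed
  note all = this
  obtain n where n: "(derived G ^^ n) (carrier G) = {\<one>}"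
    using solv solvable_iff_trivial_derived_seq by blast
  show ?thesis using all[of n] X unfolding n tangent_cone_one by blast
qed

end

section \<open>The Lie algebra of a Lie group in a chart at the identity\<close>

lemma differentiable_transform_open:
  assumes "f differentiable (at x)" "open S" "x \<in> S" "\<And>y. y \<in> S \<Longrightarrow> f y = g y"
  shows "g differentiable (at x)"
  using assms has_derivative_transform_within_open unfolding differentiable_def by blast

locale lie_group_chart =
  fixes G :: "('g::{t2_space, second_countable_topology}) monoid" (structure)
    and A :: "('g, 'v::euclidean_space) chart set" and U :: "'g set" and \<phi> :: "'g \<Rightarrow> 'v"
  assumes lie: "lie_group G A" and chart: "(U, \<phi>) \<in> A" and one_U: "\<one> \<in> U"
begin

sublocale group G using lie by (simp add: lie_group_def)

lemma carrier: "carrier G = UNIV" using lie by (simp add: lie_group_def)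

lemma in_carrier [simp]: "x \<in> carrier G" by (simp add: carrier)

lemma chart_facts:
  assumes "(V, \<kappa>) \<in> A"
  shows "open V" "open (\<kappa> ` V)" "continuous_on V \<kappa>" "continuous_on (\<kappa> ` V) (inv_into V \<kappa>)"
    "\<And>x. x \<in> V \<Longrightarrow> inv_into V \<kappa> (\<kappa> x) = x"
    "\<And>y. y \<in> \<kappa> ` V \<Longrightarrow> \<kappa> (inv_into V \<kappa> y) = y" "\<And>y. y \<in> \<kappa> ` V \<Longrightarrow> inv_into V \<kappa> y \<in> V" "inj_on \<kappa> V"
proof -
  have "is_chart (V, \<kappa>)" using assms lie by (auto simp: lie_group_def smooth_atlas_def)
  then have c: "open V" "open (\<kappa> ` V)" and h: "homeomorphism V (\<kappa> ` V) \<kappa> (inv_into V \<kappa>)"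
    by (simp_all add: is_chart_def)
  show "open V" "open (\<kappa> ` V)" by (rule c)+
  show "continuous_on V \<kappa>" "continuous_on (\<kappa> ` V) (inv_into V \<kappa>)"
    using h by (auto simp: homeomorphism_def)
  show i: "inv_into V \<kappa> (\<kappa> x) = x" if "x \<in> V" for x using h that by (simp add: homeomorphism_def)
  show "\<kappa> (inv_into V \<kappa> y) = y" "inv_into V \<kappa> y \<in> V" if "y \<in> \<kappa> ` V" for y
    using that by (auto simp: f_inv_into_f inv_into_into)
  show "inj_on \<kappa> V" using i by (metis inj_onI)
qed

lemma chart_at: obtains V \<kappa> where "(V, \<kappa>) \<in> A" "x \<in> V"
proof -
  have "(\<Union>(U, \<phi>)\<in>A. U) = UNIV" using lie by (simp add: lie_group_def smooth_atlas_def)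
  then have "x \<in> (\<Union>(U, \<phi>)\<in>A. U)" by simp
  then show ?thesis using that by blast
qed

lemma continuous_mult: "continuous_on UNIV (\<lambda>(x, y). x \<otimes> y)"
  using lie by (simp add: lie_group_def smooth_map_def)

lemma continuous_translations:
  "continuous_on UNIV (\<lambda>x. g \<otimes> x)" "continuous_on UNIV (\<lambda>x. x \<otimes> g)"
proof -
  have "continuous_on UNIV ((\<lambda>(x, y). x \<otimes> y) \<circ> (\<lambda>x. (g, x)))"
    by (intro continuous_on_compose continuous_intros continuous_on_subset[OF continuous_mult]) simp
  then show "continuous_on UNIV (\<lambda>x. g \<otimes> x)" by (simp add: o_def)
  have "continuous_on UNIV ((\<lambda>(x, y). x \<otimes> y) \<circ> (\<lambda>x. (x, g)))"
    by (intro continuous_on_compose continuous_intros continuous_on_subset[OF continuous_mult]) simp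
  then show "continuous_on UNIV (\<lambda>x. x \<otimes> g)" by (simp add: o_def)
qed

lemma open_chart_preimage:
  assumes V: "(V, \<kappa>) \<in> A" and f: "continuous_on UNIV f" and W: "open W"
  shows "open {y \<in> \<kappa> ` V. f (inv_into V \<kappa> y) \<in> W}"
proof -
  have "continuous_on (\<kappa> ` V) (f \<circ> inv_into V \<kappa>)"
    by (intro continuous_on_compose chart_facts(4)[OF V] continuous_on_subset[OF f]) simp
  then have "open (\<kappa> ` V \<inter> (f \<circ> inv_into V \<kappa>) -` W)"
    by (rule continuous_open_preimage[OF _ chart_facts(2)[OF V] W])
  moreover have "\<kappa> ` V \<inter> (f \<circ> inv_into V \<kappa>) -` W = {y \<in> \<kappa> ` V. f (inv_into V \<kappa> y) \<in> W}" by auto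
  ultimately show ?thesis by simp
qed

text \<open>The multiplication in the coordinates of three charts, written with the inverse of the product
  chart exactly as in the definition of smoothness, so that smoothness applies to it literally.\<close>

definition mult_rep where
  "mult_rep U1 \<phi>1 U2 \<phi>2 \<phi>3 = \<phi>3 \<circ> (\<lambda>(x, y). x \<otimes> y) \<circ> inv_into (U1 \<times> U2) (map_prod \<phi>1 \<phi>2)"

lemma mult_rep_eq:
  assumes "(U1, \<phi>1) \<in> A" "(U2, \<phi>2) \<in> A" "a \<in> \<phi>1 ` U1" "b \<in> \<phi>2 ` U2"
  shows "mult_rep U1 \<phi>1 U2 \<phi>2 \<phi>3 (a, b) = \<phi>3 (inv_into U1 \<phi>1 a \<otimes> inv_into U2 \<phi>2 b)"
proof -
  have inj: "inj_on (map_prod \<phi>1 \<phi>2) (U1 \<times> U2)"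
    using chart_facts(8)[OF assms(1)] chart_facts(8)[OF assms(2)] by (rule map_prod_inj_on)
  have "(a, b) = map_prod \<phi>1 \<phi>2 (inv_into U1 \<phi>1 a, inv_into U2 \<phi>2 b)"
    using chart_facts(6)[OF assms(1,3)] chart_facts(6)[OF assms(2,4)] by simp
  moreover have "(inv_into U1 \<phi>1 a, inv_into U2 \<phi>2 b) \<in> U1 \<times> U2"
    using chart_facts(7)[OF assms(1,3)] chart_facts(7)[OF assms(2,4)] by simp
  ultimately have "inv_into (U1 \<times> U2) (map_prod \<phi>1 \<phi>2) (a, b) = (inv_into U1 \<phi>1 a, inv_into U2 \<phi>2 b)"
    by (metis inv_into_f_f inj)
  then show ?thesis by (simp add: mult_rep_def)
qed

lemma mult_rep_differentiable:
  assumes c: "(U1, \<phi>1) \<in> A" "(U2, \<phi>2) \<in> A" "(U3, \<phi>3) \<in> A" and x: "x \<in> U1" "y \<in> U2" "x \<otimes> y \<in> U3"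
  shows "mult_rep U1 \<phi>1 U2 \<phi>2 \<phi>3 differentiable (at (\<phi>1 x, \<phi>2 y))"
    "(\<lambda>z. frechet_derivative (mult_rep U1 \<phi>1 U2 \<phi>2 \<phi>3) (at z) v) differentiable (at (\<phi>1 x, \<phi>2 y))"
proof -
  have "(U1 \<times> U2, map_prod \<phi>1 \<phi>2) \<in> prod_atlas A A" using c unfolding prod_atlas_def by blast
  moreover have "smooth_map (prod_atlas A A) A (\<lambda>(x, y). x \<otimes> y)" using lie by (simp add: lie_group_def)
  ultimately have "smooth_on (map_prod \<phi>1 \<phi>2 ` (U1 \<times> U2 \<inter> (\<lambda>(x, y). x \<otimes> y) -` U3)) (mult_rep U1 \<phi>1 U2 \<phi>2 \<phi>3)"
    using c(3) unfolding smooth_map_def mult_rep_def by blast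
  moreover have "(\<phi>1 x, \<phi>2 y) \<in> map_prod \<phi>1 \<phi>2 ` (U1 \<times> U2 \<inter> (\<lambda>(x, y). x \<otimes> y) -` U3)"
    using x by force
  ultimately show "mult_rep U1 \<phi>1 U2 \<phi>2 \<phi>3 differentiable (at (\<phi>1 x, \<phi>2 y))"
    "(\<lambda>z. frechet_derivative (mult_rep U1 \<phi>1 U2 \<phi>2 \<phi>3) (at z) v) differentiable (at (\<phi>1 x, \<phi>2 y))"
    by (rule smooth_on_differentiable)+
qed

lemma translation_differentiable:
  assumes c: "(V, \<kappa>) \<in> A" "(W, \<theta>) \<in> A" and x: "x \<in> V"
  shows "g \<otimes> x \<in> W \<Longrightarrow> (\<lambda>y. \<theta> (g \<otimes> inv_into V \<kappa> y)) differentiable (at (\<kappa> x))"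
    "x \<otimes> g \<in> W \<Longrightarrow> (\<lambda>y. \<theta> (inv_into V \<kappa> y \<otimes> g)) differentiable (at (\<kappa> x))"
proof -
  obtain Z \<zeta> where Z: "(Z, \<zeta>) \<in> A" "g \<in> Z" by (rule chart_at)
  have \<kappa>x: "\<kappa> x \<in> \<kappa> ` V" "\<zeta> g \<in> \<zeta> ` Z" using x Z by auto
  show "(\<lambda>y. \<theta> (g \<otimes> inv_into V \<kappa> y)) differentiable (at (\<kappa> x))" if "g \<otimes> x \<in> W"
  proof -
    have "(mult_rep Z \<zeta> V \<kappa> \<theta> \<circ> (\<lambda>y. (\<zeta> g, y))) differentiable (at (\<kappa> x))"
      by (rule differentiable_chain_at)
        (auto intro!: derivative_intros mult_rep_differentiable(1)[OF Z(1) c Z(2) x that])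
    then show ?thesis
    proof (rule differentiable_transform_open)
      show "open (\<kappa> ` V)" "\<kappa> x \<in> \<kappa> ` V" by (rule chart_facts c \<kappa>x)+
      show "(mult_rep Z \<zeta> V \<kappa> \<theta> \<circ> (\<lambda>y. (\<zeta> g, y))) y = \<theta> (g \<otimes> inv_into V \<kappa> y)" if "y \<in> \<kappa> ` V" for y
        using that Z \<kappa>x by (simp add: mult_rep_eq c(1) chart_facts(5))
    qed
  qed
  show "(\<lambda>y. \<theta> (inv_into V \<kappa> y \<otimes> g)) differentiable (at (\<kappa> x))" if "x \<otimes> g \<in> W"
  proof -
    have "(mult_rep V \<kappa> Z \<zeta> \<theta> \<circ> (\<lambda>y. (y, \<zeta> g))) differentiable (at (\<kappa> x))"
      by (rule differentiable_chain_at)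
        (auto intro!: derivative_intros mult_rep_differentiable(1)[OF c(1) Z(1) c(2) x Z(2) that])
    then show ?thesis
    proof (rule differentiable_transform_open)
      show "open (\<kappa> ` V)" "\<kappa> x \<in> \<kappa> ` V" by (rule chart_facts c \<kappa>x)+
      show "(mult_rep V \<kappa> Z \<zeta> \<theta> \<circ> (\<lambda>y. (y, \<zeta> g))) y = \<theta> (inv_into V \<kappa> y \<otimes> g)" if "y \<in> \<kappa> ` V" for y
        using that Z \<kappa>x by (simp add: mult_rep_eq c(1) chart_facts(5))
    qed
  qed
qed

abbreviation \<psi> where "\<psi> \<equiv> inv_into U \<phi>"
abbreviation coords where "coords \<equiv> \<phi> ` U"
definition p0 where "p0 = \<phi> \<one>"
definition mult_coord where "mult_coord = mult_rep U \<phi> U \<phi> \<phi>"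

lemmas cf = chart_facts[OF chart]

lemma p0 [simp]: "p0 \<in> coords" "\<psi> p0 = \<one>" using one_U cf by (auto simp: p0_def)

lemma mult_coord_eq: "x \<in> coords \<Longrightarrow> y \<in> coords \<Longrightarrow> mult_coord (x, y) = \<phi> (\<psi> x \<otimes> \<psi> y)"
  unfolding mult_coord_def by (rule mult_rep_eq[OF chart chart])

text \<open>Conjugation in the chart, for an arbitrary \<open>g\<close>: its derivative at the identity is needed for all
  \<open>g\<close>, so that \<open>Ad\<close> is a representation of the whole group.\<close>

definition conj_rep where "conj_rep g y = \<phi> (g \<otimes> \<psi> y \<otimes> inv g)"

lemma conj_p0 [simp]: "conj_rep g p0 = p0" by (simp add: conj_rep_def) (simp add: p0_def)

definition conj_dom where "conj_dom g = {y \<in> coords. g \<otimes> \<psi> y \<otimes> inv g \<in> U}"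

lemma conj_dom: "open (conj_dom g)" "p0 \<in> conj_dom g" "y \<in> conj_dom g \<Longrightarrow> y \<in> coords"
  "y \<in> conj_dom g \<Longrightarrow> conj_rep g y \<in> coords" "y \<in> conj_dom g \<Longrightarrow> \<psi> (conj_rep g y) = g \<otimes> \<psi> y \<otimes> inv g"
proof -
  have "continuous_on UNIV ((\<lambda>x. x \<otimes> inv g) \<circ> (\<lambda>x. g \<otimes> x))"
    by (intro continuous_on_compose continuous_translations continuous_on_subset[OF continuous_translations(2)]) simp
  then show "open (conj_dom g)" unfolding conj_dom_def
    by (intro open_chart_preimage chart cf) (simp add: o_def)
  show "p0 \<in> conj_dom g" by (simp add: conj_dom_def one_U)
  show "y \<in> conj_dom g \<Longrightarrow> y \<in> coords" "y \<in> conj_dom g \<Longrightarrow> conj_rep g y \<in> coords"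
    "y \<in> conj_dom g \<Longrightarrow> \<psi> (conj_rep g y) = g \<otimes> \<psi> y \<otimes> inv g" by (auto simp: conj_dom_def conj_rep_def cf)
qed

lemma conj_differentiable: "conj_rep g differentiable (at p0)"
proof -
  obtain V \<kappa> where V: "(V, \<kappa>) \<in> A" "g \<in> V" by (rule chart_at)
  define a where "a = (\<lambda>y. \<kappa> (g \<otimes> \<psi> y))"
  define b where "b = (\<lambda>z. \<phi> (inv_into V \<kappa> z \<otimes> inv g))"
  have "a differentiable (at p0)"
    unfolding a_def p0_def by (rule translation_differentiable[OF chart V(1) one_U]) (simp add: V)
  moreover have "a p0 = \<kappa> g" by (simp add: a_def)
  moreover have "b differentiable (at (\<kappa> g))"
    unfolding b_def by (rule translation_differentiable[OF V(1) chart V(2)]) (simp add: one_U)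
  ultimately have "(b \<circ> a) differentiable (at p0)" by (intro differentiable_chain_at) simp_all
  then show ?thesis
  proof (rule differentiable_transform_open)
    show "open {y \<in> coords. g \<otimes> \<psi> y \<in> V}"
      by (rule open_chart_preimage[OF chart continuous_translations(1) chart_facts(1)[OF V(1)]])
    show "p0 \<in> {y \<in> coords. g \<otimes> \<psi> y \<in> V}" using V by simp
    show "(b \<circ> a) y = conj_rep g y" if "y \<in> {y \<in> coords. g \<otimes> \<psi> y \<in> V}" for y
      using that by (simp add: a_def b_def conj_rep_def chart_facts(5)[OF V(1)])
  qed
qed

definition Ad where "Ad g = Blinfun (frechet_derivative (conj_rep g) (at p0))"

lemma conj_derivative: "(conj_rep g has_derivative blinfun_apply (Ad g)) (at p0)"
proof -
  have "(conj_rep g has_derivative frechet_derivative (conj_rep g) (at p0)) (at p0)"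
    using conj_differentiable frechet_derivative_works by blast
  then show ?thesis unfolding Ad_def
    by (simp add: bounded_linear_Blinfun_apply has_derivative_bounded_linear)
qed

lemma Ad_mult: "Ad (g \<otimes> h) = Ad g o\<^sub>L Ad h"
proof -
  have "((conj_rep g \<circ> conj_rep h) has_derivative (blinfun_apply (Ad g) \<circ> blinfun_apply (Ad h))) (at p0)"
    by (rule diff_chain_at) (simp_all add: conj_derivative)
  then have "(conj_rep (g \<otimes> h) has_derivative (blinfun_apply (Ad g) \<circ> blinfun_apply (Ad h))) (at p0)"
  proof (rule has_derivative_transform_within_open[OF _ conj_dom(1,2)[of h]])
    show "(conj_rep g \<circ> conj_rep h) y = conj_rep (g \<otimes> h) y" if "y \<in> conj_dom h" for y
      using conj_dom(5)[OF that] by (simp add: conj_rep_def[of g] conj_rep_def[of "g \<otimes> h"] m_assoc inv_mult_group)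
  qed
  from has_derivative_unique[OF this conj_derivative]
  show ?thesis by (intro blinfun_eqI) (metis blinfun_apply_blinfun_compose comp_apply)
qed

lemma Ad_one: "Ad \<one> = id_blinfun"
proof -
  have "((\<lambda>y. y) has_derivative (\<lambda>y. y)) (at p0)" by (rule has_derivative_ident)
  then have "(conj_rep \<one> has_derivative (\<lambda>y. y)) (at p0)"
    by (rule has_derivative_transform_within_open[OF _ cf(2) p0(1)]) (simp add: conj_rep_def cf)
  from has_derivative_unique[OF this conj_derivative]
  show ?thesis by (intro blinfun_eqI) (metis blinfun_apply_id_blinfun id_apply)
qed

sublocale group_representation G Ad
  by unfold_locales (simp_all add: Ad_mult Ad_one)

definition D_mult where "D_mult z = frechet_derivative mult_coord (at z)"

lemma mult_coord_derivative:
  assumes "x \<in> coords" "y \<in> coords" "\<psi> x \<otimes> \<psi> y \<in> U"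
  shows "(mult_coord has_derivative D_mult (x, y)) (at (x, y))"
    "(\<lambda>z. D_mult z v) differentiable (at (x, y))"
  using mult_rep_differentiable[OF chart chart chart cf(7)[OF assms(1)] cf(7)[OF assms(2)] assms(3)]
  unfolding mult_coord_def[symmetric] D_mult_def cf(6)[OF assms(1)] cf(6)[OF assms(2)]
  by (simp_all add: frechet_derivative_works[symmetric])

text \<open>The derivatives at the identity of left and right translation by the element with coordinate \<open>x\<close>.\<close>

definition ltrans where "ltrans x = Blinfun (\<lambda>v. D_mult (x, p0) (0, v))"
definition rtrans where "rtrans x = Blinfun (\<lambda>v. D_mult (p0, x) (v, 0))"

lemma trans_apply:
  assumes x: "x \<in> coords"
  shows "ltrans x v = D_mult (x, p0) (0, v)" "rtrans x v = D_mult (p0, x) (v, 0)"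
proof -
  have "bounded_linear (D_mult (x, p0))" "bounded_linear (D_mult (p0, x))"
    using mult_coord_derivative(1)[of x p0] mult_coord_derivative(1)[of p0 x] x cf(7)[OF x] has_derivative_bounded_linear by auto
  then have "bounded_linear (\<lambda>v. D_mult (x, p0) (0, v))" "bounded_linear (\<lambda>v. D_mult (p0, x) (v, 0))"
    by (auto intro!: bounded_linear_compose[of "D_mult _"] bounded_linear_Pair bounded_linear_zero bounded_linear_ident)
  then show "ltrans x v = D_mult (x, p0) (0, v)" "rtrans x v = D_mult (p0, x) (v, 0)"
    unfolding ltrans_def rtrans_def by (simp_all add: bounded_linear_Blinfun_apply)
qed

lemma trans_p0: "ltrans p0 = id_blinfun" "rtrans p0 = id_blinfun"
proof -
  have D: "(mult_coord has_derivative D_mult (p0, p0)) (at (p0, p0))" by (rule mult_coord_derivative) (simp_all add: one_U)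
  have "((\<lambda>y. mult_coord (p0, y)) has_derivative (\<lambda>v. D_mult (p0, p0) (0, v))) (at p0)"
    by (rule has_derivative_compose[where g = mult_coord and f = "\<lambda>y. (p0, y)"]) (auto intro!: derivative_eq_intros D)
  then have "((\<lambda>y. y) has_derivative (\<lambda>v. D_mult (p0, p0) (0, v))) (at p0)"
    by (rule has_derivative_transform_within_open[OF _ cf(2) p0(1)]) (simp add: mult_coord_eq cf)
  from has_derivative_unique[OF this has_derivative_ident]
  show "ltrans p0 = id_blinfun" by (intro blinfun_eqI) (simp add: trans_apply fun_eq_iff)
  have "((\<lambda>y. mult_coord (y, p0)) has_derivative (\<lambda>v. D_mult (p0, p0) (v, 0))) (at p0)"
    by (rule has_derivative_compose[where g = mult_coord and f = "\<lambda>y. (y, p0)"]) (auto intro!: derivative_eq_intros D)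
  then have "((\<lambda>y. y) has_derivative (\<lambda>v. D_mult (p0, p0) (v, 0))) (at p0)"
    by (rule has_derivative_transform_within_open[OF _ cf(2) p0(1)]) (simp add: mult_coord_eq cf)
  from has_derivative_unique[OF this has_derivative_ident]
  show "rtrans p0 = id_blinfun" by (intro blinfun_eqI) (simp add: trans_apply fun_eq_iff)
qed

end

context lie_group_chart begin

definition mult_dom where "mult_dom = {z \<in> coords \<times> coords. \<psi> (fst z) \<otimes> \<psi> (snd z) \<in> U}"

lemma open_mult_dom: "open mult_dom"
proof -
  have "continuous_on (coords \<times> coords) ((\<lambda>(x, y). x \<otimes> y) \<circ> (\<lambda>z. (\<psi> (fst z), \<psi> (snd z))))"
  proof (intro continuous_on_compose continuous_on_Pair continuous_on_subset[OF continuous_mult])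
    show "continuous_on (coords \<times> coords) (\<lambda>z. \<psi> (fst z))"
      by (rule continuous_on_compose2[OF cf(4)]) (auto intro!: continuous_intros)
    show "continuous_on (coords \<times> coords) (\<lambda>z. \<psi> (snd z))"
      by (rule continuous_on_compose2[OF cf(4)]) (auto intro!: continuous_intros)
  qed simp
  then have "open ((coords \<times> coords) \<inter> ((\<lambda>(x, y). x \<otimes> y) \<circ> (\<lambda>z. (\<psi> (fst z), \<psi> (snd z)))) -` U)"
    by (rule continuous_open_preimage) (auto intro!: open_Times cf)
  moreover have "(coords \<times> coords) \<inter> ((\<lambda>(x, y). x \<otimes> y) \<circ> (\<lambda>z. (\<psi> (fst z), \<psi> (snd z)))) -` U = mult_dom"
    by (auto simp: mult_dom_def)
  ultimately show ?thesis by simp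
qed

lemma p0_mult_dom: "(p0, p0) \<in> mult_dom" by (simp add: mult_dom_def one_U)

definition DD_mult where "DD_mult v = frechet_derivative (\<lambda>z. D_mult z v) (at (p0, p0))"

lemma DD_mult: "((\<lambda>z. D_mult z v) has_derivative DD_mult v) (at (p0, p0))"
  unfolding DD_mult_def by (rule iffD1[OF frechet_derivative_works mult_coord_derivative(2)]) (simp_all add: one_U)

lemma DD_mult_symmetric: "DD_mult u w = DD_mult w u"
proof (rule second_derivative_symmetric[OF open_mult_dom p0_mult_dom _ DD_mult DD_mult])
  show "(mult_coord has_derivative D_mult z) (at z)" if "z \<in> mult_dom" for z
    using that mult_coord_derivative(1)[of "fst z" "snd z"] by (auto simp: mult_dom_def)
qed

text \<open>The mixed second derivative of the multiplication at the identity; its antisymmetrization is the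
  Lie bracket.\<close>

definition ltrans_d where "ltrans_d X = Blinfun (\<lambda>v. DD_mult (0, v) (X, 0))"

lemma ltrans_pointwise: "((\<lambda>x. ltrans x v) has_derivative (\<lambda>X. DD_mult (0, v) (X, 0))) (at p0)"
proof -
  have "((\<lambda>x. D_mult (x, p0) (0, v)) has_derivative (\<lambda>X. DD_mult (0, v) (X, 0))) (at p0)"
    by (rule has_derivative_compose[where g = "\<lambda>z. D_mult z (0, v)" and f = "\<lambda>x. (x, p0)"])
      (auto intro!: derivative_eq_intros DD_mult)
  then show ?thesis
    by (rule has_derivative_transform_within_open[OF _ cf(2) p0(1)]) (simp add: trans_apply)
qed

lemma rtrans_pointwise: "((\<lambda>x. rtrans x v) has_derivative (\<lambda>X. DD_mult (v, 0) (0, X))) (at p0)"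
proof -
  have "((\<lambda>x. D_mult (p0, x) (v, 0)) has_derivative (\<lambda>X. DD_mult (v, 0) (0, X))) (at p0)"
    by (rule has_derivative_compose[where g = "\<lambda>z. D_mult z (v, 0)" and f = "\<lambda>x. (p0, x)"])
      (auto intro!: derivative_eq_intros DD_mult)
  then show ?thesis
    by (rule has_derivative_transform_within_open[OF _ cf(2) p0(1)]) (simp add: trans_apply)
qed

lemma DD_mult_bilinear: "linear (\<lambda>v. DD_mult (0, v) (X, 0))" "linear (\<lambda>X. DD_mult (0, v) (X, 0))"
proof -
  show "linear (\<lambda>X. DD_mult (0, v) (X, 0))" using ltrans_pointwise has_derivative_linear by blast
  show "linear (\<lambda>v. DD_mult (0, v) (X, 0))"
  proof (rule linearI)
    fix v w :: 'v and c :: real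
    have "((\<lambda>x. ltrans x v + ltrans x w) has_derivative (\<lambda>X. DD_mult (0, v) (X, 0) + DD_mult (0, w) (X, 0))) (at p0)"
      by (intro has_derivative_add ltrans_pointwise)
    then have "((\<lambda>x. ltrans x (v + w)) has_derivative (\<lambda>X. DD_mult (0, v) (X, 0) + DD_mult (0, w) (X, 0))) (at p0)"
      by (simp add: blinfun.bilinear_simps)
    from has_derivative_unique[OF ltrans_pointwise this]
    show "DD_mult (0, v + w) (X, 0) = DD_mult (0, v) (X, 0) + DD_mult (0, w) (X, 0)" by (rule fun_cong)
    have "((\<lambda>x. c *\<^sub>R ltrans x v) has_derivative (\<lambda>X. c *\<^sub>R DD_mult (0, v) (X, 0))) (at p0)"
      by (intro has_derivative_scaleR_right ltrans_pointwise)
    then have "((\<lambda>x. ltrans x (c *\<^sub>R v)) has_derivative (\<lambda>X. c *\<^sub>R DD_mult (0, v) (X, 0))) (at p0)"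
      by (simp add: blinfun.bilinear_simps)
    from has_derivative_unique[OF ltrans_pointwise this]
    show "DD_mult (0, c *\<^sub>R v) (X, 0) = c *\<^sub>R DD_mult (0, v) (X, 0)" by (rule fun_cong)
  qed
qed

lemma ltrans_d_apply: "ltrans_d X v = DD_mult (0, v) (X, 0)"
  unfolding ltrans_d_def
  by (simp add: bounded_linear_Blinfun_apply DD_mult_bilinear flip: linear_conv_bounded_linear)

lemma linear_ltrans_d: "linear ltrans_d"
  by (rule linearI; rule blinfun_eqI)
    (simp_all add: ltrans_d_apply blinfun.bilinear_simps linear_add[OF DD_mult_bilinear(2)]
      linear_scale[OF DD_mult_bilinear(2)])

lemma ltrans_derivative: "(ltrans has_derivative ltrans_d) (at p0)"
proof (rule has_derivative_blinfun_pointwise)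
  show "((\<lambda>x. ltrans x v) has_derivative (\<lambda>X. ltrans_d X v)) (at p0)" for v
    using ltrans_pointwise by (simp add: ltrans_d_apply)
  show "bounded_linear ltrans_d" using linear_ltrans_d by (simp add: linear_conv_bounded_linear)
qed

definition br where "br X Y = ltrans_d X Y - ltrans_d Y X"

definition ad where "ad X = Blinfun (br X)"

lemma br_bilinear: "linear (br X)" "linear (\<lambda>X. br X Y)"
  unfolding br_def
  by (auto intro!: linearI simp: blinfun.bilinear_simps linear_add[OF linear_ltrans_d]
      linear_scale[OF linear_ltrans_d] algebra_simps)

lemma ad_apply [simp]: "ad X Y = br X Y"
  unfolding ad_def by (simp add: bounded_linear_Blinfun_apply br_bilinear flip: linear_conv_bounded_linear)

lemma linear_ad: "linear ad"
  by (rule linearI; rule blinfun_eqI)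
    (simp_all add: blinfun.bilinear_simps linear_add[OF br_bilinear(2)] linear_scale[OF br_bilinear(2)])

text \<open>The symmetry of the second derivative of the multiplication exchanges the roles of the two
  translations; this is what relates \<open>ad\<close>, the derivative of \<open>Ad\<close>, to an antisymmetric bracket.\<close>

lemma rtrans_derivative: "(rtrans has_derivative (\<lambda>X. ltrans_d X - ad X)) (at p0)"
proof (rule has_derivative_blinfun_pointwise)
  show "((\<lambda>x. rtrans x v) has_derivative (\<lambda>X. (ltrans_d X - ad X) v)) (at p0)" for v
    using rtrans_pointwise[of v] DD_mult_symmetric[of "(v, 0)"]
    by (simp add: blinfun.bilinear_simps br_def ltrans_d_apply)
  show "bounded_linear (\<lambda>X. ltrans_d X - ad X)"
    using linear_compose_sub[OF linear_ltrans_d linear_ad] by (simp add: linear_conv_bounded_linear)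
qed

text \<open>The derivative at the identity of \<open>(g y g\<^sup>-\<^sup>1) g = g y\<close>.\<close>

lemma Ad_coord:
  assumes x: "x \<in> coords"
  shows "rtrans x o\<^sub>L Ad (\<psi> x) = ltrans x"
proof -
  let ?g = "\<psi> x"
  have "((\<lambda>y. mult_coord (conj_rep ?g y, x)) has_derivative (\<lambda>v. D_mult (p0, x) (Ad ?g v, 0))) (at p0)"
    by (rule has_derivative_compose[where g = mult_coord and f = "\<lambda>y. (conj_rep ?g y, x)"])
      (use x cf(7)[OF x] in \<open>auto intro!: derivative_eq_intros conj_derivative mult_coord_derivative\<close>)
  then have 1: "((\<lambda>y. mult_coord (x, y)) has_derivative (\<lambda>v. D_mult (p0, x) (Ad ?g v, 0))) (at p0)"
  proof (rule has_derivative_transform_within_open[OF _ conj_dom(1,2)[of ?g]])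
    show "mult_coord (conj_rep ?g y, x) = mult_coord (x, y)" if "y \<in> conj_dom ?g" for y
      using conj_dom(3-5)[OF that] x by (simp add: mult_coord_eq m_assoc)
  qed
  have "((\<lambda>y. mult_coord (x, y)) has_derivative (\<lambda>v. D_mult (x, p0) (0, v))) (at p0)"
    by (rule has_derivative_compose[where g = mult_coord and f = "\<lambda>y. (x, y)"])
      (use x cf(7)[OF x] in \<open>auto intro!: derivative_eq_intros mult_coord_derivative\<close>)
  from has_derivative_unique[OF 1 this] show ?thesis
    by (intro blinfun_eqI) (simp add: trans_apply x fun_eq_iff)
qed

lemma Ad_derivative: "((\<lambda>x. Ad (\<psi> x)) has_derivative ad) (at p0)"
  using has_derivative_factor[OF cf(2) p0(1) Ad_coord rtrans_derivative trans_p0(2) ltrans_derivative trans_p0(1)]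
  by simp

lemma bounded_bilinear_br: "bounded_bilinear br"
  using br_bilinear by (simp add: bilinear_conv_bounded_bilinear[symmetric] bilinear_def)

text \<open>The derivative at \<open>h = 1\<close> of \<open>Ad (g h g\<^sup>-\<^sup>1) = Ad g Ad h Ad g\<^sup>-\<^sup>1\<close>.\<close>

lemma Ad_br: "br (Ad g X) (Ad g Y) = Ad g (br X Y)"
proof -
  have "((\<lambda>y. Ad (\<psi> (conj_rep g y))) has_derivative (\<lambda>X. ad (Ad g X))) (at p0)"
    by (rule has_derivative_compose[where g = "\<lambda>x. Ad (\<psi> x)" and f = "conj_rep g"])
      (simp_all add: conj_derivative Ad_derivative)
  then have 1: "((\<lambda>y. Ad g o\<^sub>L (Ad (\<psi> y) o\<^sub>L Ad (inv g))) has_derivative (\<lambda>X. ad (Ad g X))) (at p0)"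
    by (rule has_derivative_transform_within_open[OF _ conj_dom(1,2)[of g]])
      (simp add: conj_dom Ad_mult blinfun_compose_assoc)
  have 2: "((\<lambda>y. Ad g o\<^sub>L (Ad (\<psi> y) o\<^sub>L Ad (inv g))) has_derivative
      (\<lambda>X. Ad g o\<^sub>L (ad X o\<^sub>L Ad (inv g)))) (at p0)"
    by (intro bounded_linear.has_derivative[OF bounded_bilinear.bounded_linear_right[OF bounded_bilinear_blinfun_compose]]
        bounded_linear.has_derivative[OF bounded_bilinear.bounded_linear_left[OF bounded_bilinear_blinfun_compose]]
        Ad_derivative)
  have 3: "Ad (inv g) (Ad g Y) = Y"
  proof -
    have "Ad (inv g) o\<^sub>L Ad g = id_blinfun" using Ad_mult[of "inv g" g] by (simp add: Ad_one)
    from arg_cong[OF this, of "\<lambda>f. blinfun_apply f Y"] show ?thesis by simp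
  qed
  have "ad (Ad g X) = Ad g o\<^sub>L (ad X o\<^sub>L Ad (inv g))"
    using has_derivative_unique[OF 1 2] by (rule fun_cong)
  from arg_cong[OF this, of "\<lambda>f. blinfun_apply f (Ad g Y)"]
  show ?thesis by (simp add: 3)
qed

text \<open>The derivative of the previous identity at \<open>g = 1\<close>; no third derivatives of the multiplication are
  involved.\<close>

lemma br_derivation: "br Z (br X Y) = br (br Z X) Y + br X (br Z Y)"
proof -
  have ap: "((\<lambda>x. Ad (\<psi> x) X) has_derivative (\<lambda>Z. br Z X)) (at p0)" for X
    using bounded_linear.has_derivative[OF blinfun.bounded_linear_left Ad_derivative, of X] by simp
  have "((\<lambda>x. br (Ad (\<psi> x) X) (Ad (\<psi> x) Y)) has_derivative
      (\<lambda>Z. br (Ad (\<psi> p0) X) (br Z Y) + br (br Z X) (Ad (\<psi> p0) Y))) (at p0)"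
    by (rule bounded_bilinear.FDERIV[OF bounded_bilinear_br ap ap])
  then have "((\<lambda>x. Ad (\<psi> x) (br X Y)) has_derivative (\<lambda>Z. br X (br Z Y) + br (br Z X) Y)) (at p0)"
    by (simp add: Ad_br Ad_one)
  from has_derivative_unique[OF ap this] show ?thesis by (simp add: fun_eq_iff add.commute)
qed

lemma lie_algebra_br: "lie_algebra br"
proof
  show "bilinear br" using br_bilinear by (simp add: bilinear_def)
  show "br X X = 0" for X by (simp add: br_def)
  have neg: "br Y X = - br X Y" for X Y by (simp add: br_def)
  show "br X (br Y Z) + br Y (br Z X) + br Z (br X Y) = 0" for X Y Z
    using br_derivation[of X Y Z] neg[of "br X Y" Z] neg[of X Z] linear_neg[OF br_bilinear(1)] by simp
qed

lemma ad_tangent: "ad X \<in> tangent_cone Ad (carrier G)"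
proof -
  have "((\<lambda>t. Ad (\<psi> (p0 + t *\<^sub>R X))) has_derivative (\<lambda>t. ad (t *\<^sub>R X))) (at 0)"
    by (rule has_derivative_compose[where g = "\<lambda>x. Ad (\<psi> x)" and f = "\<lambda>t. p0 + t *\<^sub>R X"])
      (auto intro!: derivative_eq_intros Ad_derivative)
  then have "((\<lambda>t. Ad (\<psi> (p0 + t *\<^sub>R X))) has_derivative (\<lambda>t. ad (t *\<^sub>R X))) (at_right 0)"
    by (rule has_derivative_at_withinI)
  then have "((\<lambda>t. norm (Ad (\<psi> (p0 + t *\<^sub>R X)) - id_blinfun - t *\<^sub>R ad X) / \<bar>t\<bar>) \<longlongrightarrow> 0) (at_right 0)"
    unfolding has_derivative_iff_norm by (simp add: Ad_one linear_scale[OF linear_ad])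
  moreover have "\<forall>\<^sub>F t in at_right 0. norm (Ad (\<psi> (p0 + t *\<^sub>R X)) - id_blinfun - t *\<^sub>R ad X) / \<bar>t\<bar>
      = norm ((1 / t) *\<^sub>R (Ad (\<psi> (p0 + t *\<^sub>R X)) - id_blinfun) - ad X)"
    using eventually_at_right_less[of 0]
  proof eventually_elim
    case (elim t)
    have "(1 / t) *\<^sub>R (Ad (\<psi> (p0 + t *\<^sub>R X)) - id_blinfun) - ad X
        = (1 / t) *\<^sub>R (Ad (\<psi> (p0 + t *\<^sub>R X)) - id_blinfun - t *\<^sub>R ad X)"
      using elim by (simp add: scaleR_diff_right)
    then show ?case using elim by simp
  qed
  ultimately have "((\<lambda>t. norm ((1 / t) *\<^sub>R (Ad (\<psi> (p0 + t *\<^sub>R X)) - id_blinfun) - ad X)) \<longlongrightarrow> 0) (at_right 0)"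
    by (rule Lim_transform_eventually)
  then have "((\<lambda>t. (1 / t) *\<^sub>R (Ad (\<psi> (p0 + t *\<^sub>R X)) - id_blinfun)) \<longlongrightarrow> ad X) (at_right 0)"
    by (rule LIM_zero_cancel[OF tendsto_norm_zero_cancel])
  then show ?thesis unfolding tangent_cone_def by (auto intro!: exI[of _ "\<lambda>t. \<psi> (p0 + t *\<^sub>R X)"])
qed

lemma solvable_bracket_br:
  assumes "solvable G"
  shows "lie_algebra.solvable_bracket br"
proof -
  interpret L: lie_algebra br by (rule lie_algebra_br)
  have "S \<subseteq> {0}" if S: "S \<subseteq> span {br X Y | X Y. X \<in> S \<and> Y \<in> S}" for S
  proof -
    have "ad X = 0" if "X \<in> S" for X
    proof (rule solvable_imp_tangent_vanishes[OF assms linear_ad _ _ _ S that])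
      show "ad (br X Y) = (ad X o\<^sub>L ad Y) - (ad Y o\<^sub>L ad X)" for X Y
        by (rule blinfun_eqI) (simp add: blinfun.bilinear_simps br_derivation[of X Y])
      show "br Y X = - br X Y" for X Y by (rule L.anti)
    qed (rule ad_tangent)
    then have "br X Y = 0" if "X \<in> S" for X Y using that by (metis ad_apply blinfun.zero_left)
    then have "{br X Y | X Y. X \<in> S \<and> Y \<in> S} \<subseteq> {0}" by blast
    then have "span {br X Y | X Y. X \<in> S \<and> Y \<in> S} \<subseteq> span {0}" by (rule span_mono)
    then show ?thesis using S by simp
  qed
  then show ?thesis unfolding L.solvable_bracket_def by blast
qed

text \<open>The derivative, at the point with coordinate \<open>x\<close>, of the left translation that moves this point to the
  identity.\<close>

definition to_one where "to_one x = Blinfun (frechet_derivative (\<lambda>y. \<phi> (inv (\<psi> x) \<otimes> \<psi> y)) (at x))"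

lemma to_one_works:
  assumes x: "x \<in> coords"
  shows "((\<lambda>y. \<phi> (inv (\<psi> x) \<otimes> \<psi> y)) has_derivative blinfun_apply (to_one x)) (at x)"
    "blinfun_apply (to_one x) = frechet_derivative (\<lambda>y. \<phi> (inv (\<psi> x) \<otimes> \<psi> y)) (at x)"
proof -
  have "(\<lambda>y. \<phi> (inv (\<psi> x) \<otimes> \<psi> y)) differentiable (at (\<phi> (\<psi> x)))"
    by (rule translation_differentiable[OF chart chart cf(7)[OF x]]) (simp add: one_U)
  then have D: "((\<lambda>y. \<phi> (inv (\<psi> x) \<otimes> \<psi> y)) has_derivative
      frechet_derivative (\<lambda>y. \<phi> (inv (\<psi> x) \<otimes> \<psi> y)) (at x)) (at x)"
    using cf(6)[OF x] by (simp add: frechet_derivative_works[symmetric])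
  show e: "blinfun_apply (to_one x) = frechet_derivative (\<lambda>y. \<phi> (inv (\<psi> x) \<otimes> \<psi> y)) (at x)"
    unfolding to_one_def by (rule bounded_linear_Blinfun_apply[OF has_derivative_bounded_linear[OF D]])
  show "((\<lambda>y. \<phi> (inv (\<psi> x) \<otimes> \<psi> y)) has_derivative blinfun_apply (to_one x)) (at x)"
    using D unfolding e .
qed

lemma ltrans_to_one:
  assumes x: "x \<in> coords"
  shows "ltrans x o\<^sub>L to_one x = id_blinfun"
proof -
  let ?g = "inv (\<psi> x)"
  let ?S = "{y \<in> coords. ?g \<otimes> \<psi> y \<in> U}"
  have S: "open ?S" "x \<in> ?S"
    using open_chart_preimage[OF chart continuous_translations(1) cf(1)] x by (simp_all add: one_U)
  have "\<phi> (?g \<otimes> \<psi> x) = p0" by (simp add: p0_def)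
  then have "((\<lambda>y. mult_coord (x, \<phi> (?g \<otimes> \<psi> y))) has_derivative (\<lambda>v. D_mult (x, p0) (0, to_one x v))) (at x)"
    by (intro has_derivative_compose[where g = mult_coord and f = "\<lambda>y. (x, \<phi> (?g \<otimes> \<psi> y))"])
      (use x cf(7)[OF x] in \<open>auto intro!: derivative_eq_intros to_one_works(1) mult_coord_derivative\<close>)
  then have 1: "((\<lambda>y. y) has_derivative (\<lambda>v. D_mult (x, p0) (0, to_one x v))) (at x)"
  proof (rule has_derivative_transform_within_open[OF _ S])
    show "mult_coord (x, \<phi> (?g \<otimes> \<psi> y)) = y" if "y \<in> ?S" for y
      using that x by (auto simp: mult_coord_eq cf(5) m_assoc[symmetric])
  qed
  from has_derivative_unique[OF 1 has_derivative_ident] show ?thesis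
    by (intro blinfun_eqI) (simp add: trans_apply x fun_eq_iff)
qed

lemma to_one_derivative: "(to_one has_derivative (\<lambda>X. - ltrans_d X)) (at p0)"
  using has_derivative_factor[OF cf(2) p0(1) ltrans_to_one ltrans_derivative trans_p0(1) has_derivative_const]
  by simp

lemma to_one_p0: "to_one p0 = id_blinfun"
  using ltrans_to_one[OF p0(1)] by (auto intro!: blinfun_eqI simp: trans_p0 dest: arg_cong[of _ _ "\<lambda>f. blinfun_apply f _"])

lemma left_invariant_coord:
  assumes "left_invariant G A \<alpha>" "x \<in> coords"
  shows "\<alpha> (U, \<phi>) x v = \<alpha> (U, \<phi>) p0 (\<lambda>i. to_one x (v i))"
proof -
  have "invariant_under A (\<lambda>z. inv (\<psi> x) \<otimes> z) \<alpha>" using assms(1) by (simp add: left_invariant_def)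
  then have "\<alpha> (U, \<phi>) (\<phi> (\<psi> x)) = pullback (frechet_derivative (\<phi> \<circ> (\<lambda>z. inv (\<psi> x) \<otimes> z) \<circ> \<psi>) (at (\<phi> (\<psi> x))))
      (\<alpha> (U, \<phi>) (\<phi> (inv (\<psi> x) \<otimes> \<psi> x)))"
    using chart cf(7)[OF assms(2)] unfolding invariant_under_def by (fastforce simp: one_U)
  then show ?thesis
    using cf(6)[OF assms(2)] to_one_works(2)[OF assms(2)] by (simp add: pullback_def o_def p0_def)
qed

end

section \<open>Wedge products in low degree\<close>

text \<open>Expansion along the last slot; repeated use evaluates the sums over permutations in \<open>wedge\<close>.\<close>

lemma signed_permutation_sum_insert:
  assumes "finite S" "a \<notin> S"
  shows "(\<Sum>p | p permutes insert a S. of_int (sign p) * F p) =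
    (\<Sum>b\<in>insert a S. (if a = b then 1 else - 1) *
      (\<Sum>q | q permutes S. of_int (sign q) * F (Transposition.transpose a b \<circ> q)) :: real)"
proof -
  have "(\<Sum>p | p permutes insert a S. of_int (sign p) * F p) =
    (\<Sum>b\<in>insert a S. \<Sum>q | q permutes S. of_int (sign (Transposition.transpose a b \<circ> q)) * F (Transposition.transpose a b \<circ> q))"
    by (rule sum_over_permutations_insert[OF assms])
  also have "\<dots> = (\<Sum>b\<in>insert a S. (if a = b then 1 else - 1) *
      (\<Sum>q | q permutes S. of_int (sign q) * F (Transposition.transpose a b \<circ> q)))"
  proof (intro sum.cong refl)
    fix b
    have "sign (Transposition.transpose a b \<circ> q) = (if a = b then 1 else - 1) * sign q" if "q permutes S" for q
    proof -
      have "permutation q" using that assms(1) permutation_permutes by blast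
      then show ?thesis using sign_compose[OF permutation_swap_id[of a b]] by (simp add: sign_swap_id)
    qed
    then show "(\<Sum>q | q permutes S. of_int (sign (Transposition.transpose a b \<circ> q)) * F (Transposition.transpose a b \<circ> q)) =
      (if a = b then 1 else - 1) * (\<Sum>q | q permutes S. of_int (sign q) * F (Transposition.transpose a b \<circ> q))"
      by (simp add: sum_distrib_left mult.assoc)
  qed
  finally show ?thesis .
qed

lemma signed_permutation_sum_3:
  fixes F :: "nat \<Rightarrow> nat \<Rightarrow> nat \<Rightarrow> real"
  shows "(\<Sum>p | p permutes {..<3}. of_int (sign p) * F (p 0) (p 1) (p 2)) =
    F 0 1 2 - F 1 0 2 - F 0 2 1 - F 2 1 0 + F 1 2 0 + F 2 0 1"
proof -
  have "{..<3::nat} = {2, 1, 0}" by auto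
  then show ?thesis
    by (simp add: signed_permutation_sum_insert)
qed

lemma signed_permutation_sum_4:
  fixes F :: "nat \<Rightarrow> nat \<Rightarrow> nat \<Rightarrow> nat \<Rightarrow> real"
  shows "(\<Sum>p | p permutes {..<4}. of_int (sign p) * F (p 0) (p 1) (p 2) (p 3)) =
    F 0 1 2 3 - F 1 0 2 3 - F 0 2 1 3 - F 2 1 0 3 + F 1 2 0 3 + F 2 0 1 3
    - F 0 1 3 2 + F 1 0 3 2 + F 0 3 1 2 + F 3 1 0 2 - F 1 3 0 2 - F 3 0 1 2
    - F 0 3 2 1 + F 3 0 2 1 + F 0 2 3 1 + F 2 3 0 1 - F 3 2 0 1 - F 2 0 3 1
    - F 3 1 2 0 + F 1 3 2 0 + F 3 2 1 0 + F 2 1 3 0 - F 1 2 3 0 - F 2 3 1 0"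
proof -
  have "{..<4::nat} = {3, 2, 1, 0}" by auto
  then show ?thesis
    by (simp add: signed_permutation_sum_insert)
qed

text \<open>A \<open>k\<close>-form takes a sequence of vectors of which only the first \<open>k\<close> matter. These two definitions turn
  forms of degrees 1 and 2 into ordinary functions of vectors.\<close>

definition eval1 :: "'v form \<Rightarrow> 'v \<Rightarrow> real" where
  "eval1 \<alpha> x = \<alpha> (\<lambda>_. x)"

definition eval2 :: "'v form \<Rightarrow> 'v \<Rightarrow> 'v \<Rightarrow> real" where
  "eval2 \<alpha> x y = \<alpha> (case_nat x (\<lambda>_. y))"

lemma alternating_form_1:
  assumes "alternating_form 1 \<alpha>"
  shows "\<alpha> v = eval1 \<alpha> (v 0)" "linear (eval1 \<alpha>)"
proof -
  have loc: "\<alpha> v = \<alpha> w" if "v 0 = w 0" for v w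
  proof -
    have *: "\<forall>v w. (\<forall>i<1. v i = w i) \<longrightarrow> \<alpha> v = \<alpha> w" using assms unfolding alternating_form_def by blast
    show ?thesis by (rule *[rule_format]) (use that in simp)
  qed
  show "\<alpha> v = eval1 \<alpha> (v 0)" unfolding eval1_def by (rule loc) simp
  have "\<forall>i<1. \<forall>v. linear (\<lambda>x. \<alpha> (v(i := x)))" using assms unfolding alternating_form_def by blast
  from this[rule_format, of 0 "\<lambda>_. 0"] have "linear (\<lambda>x. \<alpha> ((\<lambda>_. 0)(0 := x)))" by simp
  moreover have "\<alpha> ((\<lambda>_. 0)(0 := x)) = eval1 \<alpha> x" for x unfolding eval1_def by (rule loc) simp
  ultimately show "linear (eval1 \<alpha>)" by simp
qed

lemma alternating_form_2:
  assumes "alternating_form 2 \<alpha>"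
  shows "\<alpha> v = eval2 \<alpha> (v 0) (v 1)" "bilinear (eval2 \<alpha>)" "eval2 \<alpha> x x = 0" "eval2 \<alpha> y x = - eval2 \<alpha> x y"
proof -
  have loc: "\<alpha> v = \<alpha> w" if "v 0 = w 0" "v 1 = w 1" for v w
  proof -
    have *: "\<forall>v w. (\<forall>i<2. v i = w i) \<longrightarrow> \<alpha> v = \<alpha> w" using assms unfolding alternating_form_def by blast
    show ?thesis by (rule *[rule_format]) (use that in \<open>auto simp: less_2_cases_iff\<close>)
  qed
  have two: "\<alpha> v = eval2 \<alpha> (v 0) (v 1)" for v unfolding eval2_def by (rule loc) simp_all
  then show "\<alpha> v = eval2 \<alpha> (v 0) (v 1)" .
  have lin: "\<forall>i<2. \<forall>v. linear (\<lambda>x. \<alpha> (v(i := x)))"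
    using assms unfolding alternating_form_def by blast
  have "linear (\<lambda>x. eval2 \<alpha> x y)" for y
    using lin[rule_format, of 0 "\<lambda>_. y"] unfolding two[of "_(_ := _)"] by simp
  moreover have "linear (\<lambda>y. eval2 \<alpha> x y)" for x
    using lin[rule_format, of 1 "\<lambda>_. x"] unfolding two[of "_(_ := _)"] by simp
  ultimately show bil: "bilinear (eval2 \<alpha>)" by (simp add: bilinear_def)
  have "\<forall>v. \<forall>i<2. \<forall>j<2. i \<noteq> j \<and> v i = v j \<longrightarrow> \<alpha> v = 0"
    using assms unfolding alternating_form_def by blast
  note * = this
  have alt: "eval2 \<alpha> z z = 0" for z
    unfolding two[of "\<lambda>_. z", symmetric] by (rule *[rule_format, of 0 1]) simp_all
  then show "eval2 \<alpha> x x = 0" .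
  have "eval2 \<alpha> (x + y) (x + y) = eval2 \<alpha> x x + eval2 \<alpha> y x + (eval2 \<alpha> x y + eval2 \<alpha> y y)"
    by (simp only: bilinear_ladd[OF bil] bilinear_radd[OF bil])
  then have "eval2 \<alpha> y x + eval2 \<alpha> x y = 0" unfolding alt by simp
  then show "eval2 \<alpha> y x = - eval2 \<alpha> x y" by linarith
qed

lemma wedge_1_2_eval:
  assumes "alternating_form 1 \<alpha>" "alternating_form 2 \<beta>"
  shows "wedge 1 2 \<alpha> \<beta> v = wedge12 (eval1 \<alpha>) (eval2 \<beta>) (v 0) (v 1) (v 2)"
proof -
  let ?a = "eval1 \<alpha>" and ?b = "eval2 \<beta>"
  have a: "\<alpha> (\<lambda>i. v (p i)) = ?a (v (p 0))" for p by (rule alternating_form_1(1)[OF assms(1)])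
  have b: "\<beta> (\<lambda>i. v (p (1 + i))) = ?b (v (p 1)) (v (p 2))" for p
    using alternating_form_2(1)[OF assms(2), of "\<lambda>i. v (p (1 + i))"] by (simp only: add_0_right one_add_one)
  have "wedge 1 2 \<alpha> \<beta> v = (\<Sum>p | p permutes {..<1 + 2}. of_int (sign p) * ?a (v (p 0)) * ?b (v (p 1)) (v (p 2)))
      / (fact 1 * fact 2)"
    unfolding wedge_def a b ..
  also have "\<dots> = (\<Sum>p | p permutes {..<3}. of_int (sign p) *
      (?a (v (p 0)) * ?b (v (p 1)) (v (p 2)))) / 2"
    by (simp add: mult.assoc fact_numeral numeral_3_eq_3)
  also have "\<dots> = wedge12 ?a ?b (v 0) (v 1) (v 2)"
    unfolding signed_permutation_sum_3[of "\<lambda>i j k. ?a (v i) * ?b (v j) (v k)"] wedge12_def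
    unfolding alternating_form_2(4)[OF assms(2), of "v 0" "v 1"]
      alternating_form_2(4)[OF assms(2), of "v 0" "v 2"]
      alternating_form_2(4)[OF assms(2), of "v 1" "v 2"] by simp
  finally show ?thesis .
qed
lemma wedge_2_2_eval:
  assumes "alternating_form 2 \<alpha>" "alternating_form 2 \<beta>"
  shows "wedge 2 2 \<alpha> \<beta> v = wedge22 (eval2 \<alpha>) (eval2 \<beta>) (v 0) (v 1) (v 2) (v 3)"
proof -
  let ?a = "eval2 \<alpha>" and ?b = "eval2 \<beta>"
  have a: "\<alpha> (\<lambda>i. v (p i)) = ?a (v (p 0)) (v (p 1))" for p by (rule alternating_form_2(1)[OF assms(1)])
  have b: "\<beta> (\<lambda>i. v (p (2 + i))) = ?b (v (p 2)) (v (p 3))" for p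
    using alternating_form_2(1)[OF assms(2), of "\<lambda>i. v (p (2 + i))"]
    by (simp add: numeral_2_eq_2 numeral_3_eq_3)
  have "wedge 2 2 \<alpha> \<beta> v = (\<Sum>p | p permutes {..<2 + 2}. of_int (sign p) * ?a (v (p 0)) (v (p 1))
      * ?b (v (p 2)) (v (p 3))) / (fact 2 * fact 2)"
    unfolding wedge_def a b ..
  also have "\<dots> = (\<Sum>p | p permutes {..<4}. of_int (sign p) *
      (?a (v (p 0)) (v (p 1)) * ?b (v (p 2)) (v (p 3)))) / 4"
    by (simp add: mult.assoc fact_numeral)
  also have "\<dots> = wedge22 ?a ?b (v 0) (v 1) (v 2) (v 3)"
    unfolding signed_permutation_sum_4[of "\<lambda>i j k l. ?a (v i) (v j) * ?b (v k) (v l)"] wedge22_def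
    unfolding assms[THEN alternating_form_2(4), of "v 0" "v 1"]
      assms[THEN alternating_form_2(4), of "v 0" "v 2"]
      assms[THEN alternating_form_2(4), of "v 0" "v 3"]
      assms[THEN alternating_form_2(4), of "v 1" "v 2"]
      assms[THEN alternating_form_2(4), of "v 1" "v 3"]
      assms[THEN alternating_form_2(4), of "v 2" "v 3"] by simp
  finally show ?thesis .
qed
text \<open>The sum over permutations splits according to the vector on which \<open>\<eta>\<close> is evaluated; the remaining 24
  permutations contribute equally because \<open>\<alpha> \<and> \<alpha>\<close> is alternating.\<close>

lemma wedge_4_1_eval:
  fixes \<alpha> \<eta> :: "'v::real_vector form"
  assumes \<alpha>: "alternating_form 2 \<alpha>" and \<eta>: "alternating_form 1 \<eta>"
  shows "wedge 4 1 (wedge 2 2 \<alpha> \<alpha>) \<eta> v =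
    wedge22 (eval2 \<alpha>) (eval2 \<alpha>) (v 0) (v 1) (v 2) (v 3) * eval1 \<eta> (v 4)
    - wedge22 (eval2 \<alpha>) (eval2 \<alpha>) (v 0) (v 1) (v 2) (v 4) * eval1 \<eta> (v 3)
    + wedge22 (eval2 \<alpha>) (eval2 \<alpha>) (v 0) (v 1) (v 3) (v 4) * eval1 \<eta> (v 2)
    - wedge22 (eval2 \<alpha>) (eval2 \<alpha>) (v 0) (v 2) (v 3) (v 4) * eval1 \<eta> (v 1)
    + wedge22 (eval2 \<alpha>) (eval2 \<alpha>) (v 1) (v 2) (v 3) (v 4) * eval1 \<eta> (v 0)"
proof -
  let ?a = "eval2 \<alpha>" and ?e = "eval1 \<eta>"
  let ?w = "wedge22 ?a ?a"
  have an: "?a y x = - ?a x y" for x y by (rule alternating_form_2(4)[OF \<alpha>])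
  have s: "?w y x z t = - ?w x y z t" "?w x z y t = - ?w x y z t" "?w x y t z = - ?w x y z t" for x y z t
    unfolding wedge22_def using an[of x y] an[of x z] an[of x t] an[of y z] an[of y t] an[of z t]
    by (simp_all add: algebra_simps)
  have S: "(\<Sum>q | q permutes {..<4}. of_int (sign q) * (?w (y (q 0)) (y (q 1)) (y (q 2)) (y (q 3)) * c))
      = 24 * (?w (y 0) (y 1) (y 2) (y 3) * c)" for y :: "nat \<Rightarrow> 'v" and c
    unfolding signed_permutation_sum_4[of "\<lambda>i j k l. ?w (y i) (y j) (y k) (y l) * c"]
    unfolding wedge22_def an[of "y 0" "y 1"] an[of "y 0" "y 2"] an[of "y 0" "y 3"] an[of "y 1" "y 2"]
      an[of "y 1" "y 3"] an[of "y 2" "y 3"]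
    by (simp add: algebra_simps)
  have five: "{..<5::nat} = insert 4 {..<4}" by auto
  have e: "\<eta> (\<lambda>i. v (p (4 + i))) = ?e (v (p 4))" for p
    using alternating_form_1(1)[OF \<eta>, of "\<lambda>i. v (p (4 + i))"] by simp
  have "wedge 4 1 (wedge 2 2 \<alpha> \<alpha>) \<eta> v = (\<Sum>p | p permutes {..<4 + 1}. of_int (sign p)
      * ?w (v (p 0)) (v (p 1)) (v (p 2)) (v (p 3)) * ?e (v (p 4))) / (fact 4 * fact 1)"
    unfolding wedge_def[of 4] wedge_2_2_eval[OF \<alpha> \<alpha>] e ..
  also have "\<dots> = (\<Sum>p | p permutes {..<5}. of_int (sign p) *
      (?w (v (p 0)) (v (p 1)) (v (p 2)) (v (p 3)) * ?e (v (p 4)))) / 24"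
    by (simp add: mult.assoc fact_numeral)
  also have "\<dots> = (\<Sum>b\<in>insert 4 {..<4}. (if 4 = b then 1 else - 1) *
     (\<Sum>q | q permutes {..<4}. of_int (sign q) *
      (?w (v (Transposition.transpose 4 b (q 0))) (v (Transposition.transpose 4 b (q 1))) (v (Transposition.transpose 4 b (q 2))) (v (Transposition.transpose 4 b (q 3)))
        * ?e (v (Transposition.transpose 4 b (q 4)))))) / 24"
    unfolding five by (subst signed_permutation_sum_insert) simp_all
  also have "\<dots> = (\<Sum>b\<in>insert 4 {..<4}. (if 4 = b then 1 else - 1) *
     (\<Sum>q | q permutes {..<4}. of_int (sign q) *
      (?w (v (Transposition.transpose 4 b (q 0))) (v (Transposition.transpose 4 b (q 1))) (v (Transposition.transpose 4 b (q 2))) (v (Transposition.transpose 4 b (q 3)))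
        * ?e (v b)))) / 24"
  proof -
    have T: "q 4 = 4" if "q permutes {..<4}" for q :: "nat \<Rightarrow> nat" using that by (auto simp: permutes_def)
    show ?thesis by (intro arg_cong2[where f = "(/)"] sum.cong refl arg_cong2[where f = "(*)"]) (auto simp: T)
  qed
  also have "\<dots> = (\<Sum>b\<in>insert 4 {..<4}. (if 4 = b then 1 else - 1) *
     (24 * (?w (v (Transposition.transpose 4 b 0)) (v (Transposition.transpose 4 b 1))
       (v (Transposition.transpose 4 b 2)) (v (Transposition.transpose 4 b 3)) * ?e (v b)))) / 24"
    unfolding S[of "\<lambda>i. v (Transposition.transpose 4 _ i)"] ..
  also have "insert 4 {..<4::nat} = {4, 3, 2, 1, 0}" by auto
  finally have eq: "wedge 4 1 (wedge 2 2 \<alpha> \<alpha>) \<eta> v = (\<Sum>b\<in>{4, 3, 2, 1, 0}. (if 4 = b then 1 else - 1) *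
     (24 * (?w (v (Transposition.transpose 4 b 0)) (v (Transposition.transpose 4 b 1))
       (v (Transposition.transpose 4 b 2)) (v (Transposition.transpose 4 b 3)) * ?e (v b)))) / 24" .
  have r: "?w (v 0) (v 1) (v 4) (v 3) = - ?w (v 0) (v 1) (v 3) (v 4)"
    "?w (v 0) (v 4) (v 2) (v 3) = ?w (v 0) (v 2) (v 3) (v 4)"
    "?w (v 4) (v 1) (v 2) (v 3) = - ?w (v 1) (v 2) (v 3) (v 4)"
    using s(3)[of "v 0" "v 1" "v 3" "v 4"] s(2)[of "v 0" "v 2" "v 4" "v 3"] s(3)[of "v 0" "v 2" "v 3" "v 4"]
      s(1)[of "v 1" "v 4" "v 2" "v 3"] s(2)[of "v 1" "v 2" "v 4" "v 3"] s(3)[of "v 1" "v 2" "v 3" "v 4"]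
    by linarith+
  show ?thesis unfolding eq by (simp add: Transposition.transpose_def r del: One_nat_def)
qed


section \<open>The exterior derivative of left-invariant forms\<close>

context lie_group_chart begin

lemma to_one_apply_derivative: "((\<lambda>x. to_one x u) has_derivative (\<lambda>X. - ltrans_d X u)) (at p0)"
  using bounded_linear.has_derivative[OF blinfun.bounded_linear_left to_one_derivative, of u]
  by (simp add: blinfun.minus_left)

lemma linear_to_one_derivative:
  fixes e :: "'v \<Rightarrow> real"
  assumes "linear e"
  shows "((\<lambda>x. e (to_one x u)) has_derivative (\<lambda>X. - e (ltrans_d X u))) (at p0)"
proof -
  have "bounded_linear e" using assms by (simp add: linear_conv_bounded_linear)
  from bounded_linear.has_derivative[OF this to_one_apply_derivative] show ?thesis
    by (simp add: linear_neg[OF assms])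
qed

lemma bilinear_to_one_derivative:
  fixes w :: "'v \<Rightarrow> 'v \<Rightarrow> real"
  assumes "bilinear w"
  shows "((\<lambda>x. w (to_one x u) (to_one x v)) has_derivative (\<lambda>X. - w u (ltrans_d X v) - w (ltrans_d X u) v)) (at p0)"
proof -
  have "bounded_bilinear w" using assms by (simp add: bilinear_conv_bounded_bilinear)
  from bounded_bilinear.FDERIV[OF this to_one_apply_derivative to_one_apply_derivative, of u v] show ?thesis
    by (simp add: to_one_p0 bilinear_lneg[OF assms] bilinear_rneg[OF assms])
qed

definition form_at_one :: "('g, 'v) dform \<Rightarrow> 'v form" where
  "form_at_one \<alpha> = \<alpha> (U, \<phi>) p0"

lemma alternating_at:
  assumes "diff_form A k \<alpha>" "x \<in> coords"
  shows "alternating_form k (\<alpha> (U, \<phi>) x)"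
proof -
  have "\<forall>c\<in>A. case c of (U, \<phi>) \<Rightarrow> \<forall>p\<in>\<phi> ` U. alternating_form k (\<alpha> (U, \<phi>) p)"
    using assms(1) unfolding diff_form_def by blast
  from bspec[OF this chart] assms(2) show ?thesis unfolding prod.case by (rule bspec)
qed

lemma eval1_coord:
  assumes "diff_form A 1 \<eta>" "left_invariant G A \<eta>" "x \<in> coords"
  shows "eval1 (\<eta> (U, \<phi>) x) u = eval1 (form_at_one \<eta>) (to_one x u)"
  unfolding eval1_def form_at_one_def by (rule left_invariant_coord[OF assms(2,3)])

lemma eval2_coord:
  assumes "diff_form A 2 \<omega>" "left_invariant G A \<omega>" "x \<in> coords"
  shows "eval2 (\<omega> (U, \<phi>) x) u v = eval2 (form_at_one \<omega>) (to_one x u) (to_one x v)"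
proof -
  have "eval2 (\<omega> (U, \<phi>) x) u v = \<omega> (U, \<phi>) p0 (\<lambda>i. to_one x (case_nat u (\<lambda>_. v) i))"
    unfolding eval2_def by (rule left_invariant_coord[OF assms(2,3)])
  also have "\<dots> = eval2 (\<omega> (U, \<phi>) p0) (to_one x u) (to_one x v)"
    using alternating_form_2(1)[OF alternating_at[OF assms(1) p0(1)], of "\<lambda>i. to_one x (case_nat u (\<lambda>_. v) i)"] by simp
  finally show ?thesis unfolding form_at_one_def .
qed

text \<open>In the chart the form at \<open>q\<close> is the form at the identity composed with \<open>to_one q\<close>, whose derivative is
  minus the mixed second derivative of the multiplication; alternating over the arguments leaves only
  brackets. In particular the forms need not be differentiated themselves.\<close>

lemma ext_deriv_2:
  assumes d: "diff_form A 2 \<omega>" and inv: "left_invariant G A \<omega>"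
  shows "ext_deriv 2 \<omega> (U, \<phi>) p0 v = two_d br (eval2 (form_at_one \<omega>)) (v 0) (v 1) (v 2)"
proof -
  let ?w = "eval2 (form_at_one \<omega>)"
  note alt = alternating_at[OF d p0(1), folded form_at_one_def]
  note bil = alternating_form_2(2)[OF alt]
  have D: "frechet_derivative (\<lambda>q. \<omega> (U, \<phi>) q u) (at p0)
      = (\<lambda>X. - ?w (u 0) (ltrans_d X (u 1)) - ?w (ltrans_d X (u 0)) (u 1))" for u
  proof -
    have "((\<lambda>q. \<omega> (U, \<phi>) q u) has_derivative (\<lambda>X. - ?w (u 0) (ltrans_d X (u 1)) - ?w (ltrans_d X (u 0)) (u 1))) (at p0)"
    proof (rule has_derivative_transform_within_open[OF bilinear_to_one_derivative[OF bil] cf(2) p0(1)])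
      show "?w (to_one q (u 0)) (to_one q (u 1)) = \<omega> (U, \<phi>) q u" if q: "q \<in> coords" for q
        using eval2_coord[OF d inv q] alternating_form_2(1)[OF alternating_at[OF d q], of u] by simp
    qed
    then show ?thesis by (rule frechet_derivative_at[symmetric])
  qed
  have an: "?w y (ltrans_d a b) = - ?w (ltrans_d a b) y" for y a b by (rule alternating_form_2(4)[OF alt])
  have "{..2::nat} = {0, 1, 2}" by auto
  then show ?thesis
    unfolding ext_deriv_def two_d_def br_def D
    by (simp add: an bilinear_lsub[OF bil] numeral_2_eq_2)
qed

lemma ext_deriv_3:
  assumes de: "diff_form A 1 \<eta>" and ie: "left_invariant G A \<eta>"
    and d: "diff_form A 2 \<omega>" and inv: "left_invariant G A \<omega>"
  shows "ext_deriv 3 (dwedge 1 2 \<eta> \<omega>) (U, \<phi>) p0 v =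
    wedge22 (one_d br (eval1 (form_at_one \<eta>))) (eval2 (form_at_one \<omega>)) (v 0) (v 1) (v 2) (v 3)
    - wedge13 (eval1 (form_at_one \<eta>)) (two_d br (eval2 (form_at_one \<omega>))) (v 0) (v 1) (v 2) (v 3)"
proof -
  let ?w = "eval2 (form_at_one \<omega>)" and ?e = "eval1 (form_at_one \<eta>)"
  note alt = alternating_at[OF d p0(1), folded form_at_one_def]
  note alte = alternating_at[OF de p0(1), folded form_at_one_def]
  note bil = alternating_form_2(2)[OF alt] and lin = alternating_form_1(2)[OF alte]
  let ?D = "\<lambda>u X. - (wedge12 ?e ?w (ltrans_d X (u 0)) (u 1) (u 2) + wedge12 ?e ?w (u 0) (ltrans_d X (u 1)) (u 2)
      + wedge12 ?e ?w (u 0) (u 1) (ltrans_d X (u 2)))"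
  have D: "frechet_derivative (\<lambda>q. dwedge 1 2 \<eta> \<omega> (U, \<phi>) q u) (at p0) = ?D u" for u
  proof -
    have "((\<lambda>q. wedge12 ?e ?w (to_one q (u 0)) (to_one q (u 1)) (to_one q (u 2))) has_derivative ?D u) (at p0)"
      unfolding wedge12_def
      by (rule has_derivative_eq_rhs,
          (rule has_derivative_add has_derivative_diff has_derivative_mult linear_to_one_derivative[OF lin]
            bilinear_to_one_derivative[OF bil])+)
        (auto simp: to_one_p0 algebra_simps)
    then have "((\<lambda>q. dwedge 1 2 \<eta> \<omega> (U, \<phi>) q u) has_derivative ?D u) (at p0)"
    proof (rule has_derivative_transform_within_open[OF _ cf(2) p0(1)])
      show "wedge12 ?e ?w (to_one q (u 0)) (to_one q (u 1)) (to_one q (u 2)) = dwedge 1 2 \<eta> \<omega> (U, \<phi>) q u" if q: "q \<in> coords" for q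
        unfolding dwedge_def wedge_1_2_eval[OF alternating_at[OF de q] alternating_at[OF d q]]
        by (simp add: wedge12_def eval1_coord[OF de ie q] eval2_coord[OF d inv q])
    qed
    then show ?thesis by (rule frechet_derivative_at[symmetric])
  qed
  have an: "?w y (ltrans_d a b) = - ?w (ltrans_d a b) y" for y a b by (rule alternating_form_2(4)[OF alt])
  have "{..3::nat} = {0, 1, 2, 3}" by auto
  then show ?thesis
    unfolding ext_deriv_def D
    by (simp add: wedge12_def wedge13_def wedge22_def one_d_def two_d_def br_def an
        bilinear_lsub[OF bil] linear_diff[OF lin] numeral_2_eq_2 numeral_3_eq_3 algebra_simps)
qed

end



section \<open>Left-invariant double hypo structures\<close>

lemma dform_eq_at:
  assumes "dform_eq A \<alpha> \<beta>" "(U, \<phi>) \<in> A" "p \<in> \<phi> ` U"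
  shows "\<alpha> (U, \<phi>) p = \<beta> (U, \<phi>) p"
proof -
  have "\<forall>p\<in>\<phi> ` U. \<alpha> (U, \<phi>) p = \<beta> (U, \<phi>) p"
    using bspec[OF assms(1)[unfolded dform_eq_def] assms(2)] unfolding prod.case .
  then show ?thesis using assms(3) by (rule bspec)
qed

theorem mainTheorem8:
  fixes G :: "('g::{t2_space, second_countable_topology}) monoid"
    and A :: "('g, real^5) chart set"
  assumes "lie_group G A"
    and "solvable G"
  shows "\<not> (\<exists>\<eta> \<omega>. left_invariant G A \<eta> \<and> (\<forall>i\<in>{1, 2, 3}. left_invariant G A (\<omega> i)) \<and>
                  double_hypo A \<eta> \<omega>)"
proof
  assume "\<exists>\<eta> \<omega>. left_invariant G A \<eta> \<and> (\<forall>i\<in>{1, 2, 3}. left_invariant G A (\<omega> i)) \<and> double_hypo A \<eta> \<omega>"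
  then obtain \<eta> \<omega> where *: "left_invariant G A \<eta> \<and> (\<forall>i\<in>{1, 2, 3}. left_invariant G A (\<omega> i)) \<and> double_hypo A \<eta> \<omega>"
    by (elim exE)
  have inv1: "left_invariant G A \<eta>" using * by blast
  have inv2: "left_invariant G A (\<omega> i)" if "i \<in> {1, 2, 3}" for i
    using * that by blast
  have dh: "double_hypo A \<eta> \<omega>" using * by blast
  have "(\<Union>(U, \<phi>)\<in>A. U) = UNIV" using assms(1) by (simp add: lie_group_def smooth_atlas_def)
  then have "\<one>\<^bsub>G\<^esub> \<in> (\<Union>(U, \<phi>)\<in>A. U)" by simp
  then obtain U \<phi> where U: "(U, \<phi>) \<in> A" "\<one>\<^bsub>G\<^esub> \<in> U" by blast
  interpret lie_group_chart G A U \<phi> using assms(1) U by unfold_locales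
  have nh: "nearly_hypo A \<eta> \<omega>" and h: "hypo A \<eta> \<omega>" using dh unfolding double_hypo_def by blast+
  have su2: "SU2_structure A \<eta> \<omega>" using h unfolding hypo_def by blast
  note su2' = su2[unfolded SU2_structure_def]
  have d1: "diff_form A 1 \<eta>" by (rule conjunct1[OF su2'])
  have d2: "diff_form A 2 (\<omega> i)" if "i \<in> {1, 2, 3}" for i
    by (rule bspec[OF conjunct1[OF conjunct2[OF su2']] that])
  obtain v where v: "(\<forall>i\<in>{1, 2, 3}. \<forall>j\<in>{1, 2, 3}.
      dform_eq A (dwedge 2 2 (\<omega> i) (\<omega> j)) (if i = j then v else dzero)) \<and> nowhere_zero A (dwedge 4 1 v \<eta>)"
    using conjunct1[OF conjunct2[OF conjunct2[OF su2']]] by (elim exE conjE) (rule that, rule conjI)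
  have wd: "dform_eq A (dwedge 2 2 (\<omega> i) (\<omega> j)) (if i = j then v else dzero)"
    if "i \<in> {1, 2, 3}" "j \<in> {1, 2, 3}" for i j
    by (rule bspec[OF bspec[OF conjunct1[OF v] that(1)] that(2)])
  note nz = conjunct2[OF v]
  note posi = conjunct2[OF conjunct2[OF conjunct2[OF su2']]]
  define E where "E = eval1 (form_at_one \<eta>)"
  define W where "W i = eval2 (form_at_one (\<omega> i))" for i
  note at = dform_eq_at[OF _ chart p0(1)]
  have alt1: "alternating_form 1 (form_at_one \<eta>)"
    unfolding form_at_one_def by (rule alternating_at[OF d1 p0(1)])
  have alt2: "alternating_form 2 (form_at_one (\<omega> i))" if "i \<in> {1, 2, 3}" for i
    unfolding form_at_one_def by (rule alternating_at[OF d2[OF that] p0(1)])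
  have w22: "dwedge 2 2 (\<omega> i) (\<omega> j) (U, \<phi>) p0 u = wedge22 (W i) (W j) (u 0) (u 1) (u 2) (u 3)"
    if "i \<in> {1, 2, 3}" "j \<in> {1, 2, 3}" for i j u
    unfolding dwedge_def W_def form_at_one_def[of "\<omega> i", symmetric] form_at_one_def[of "\<omega> j", symmetric]
    by (rule wedge_2_2_eval[OF alt2[OF that(1)] alt2[OF that(2)]])
  have w12: "dwedge 1 2 \<eta> (\<omega> i) (U, \<phi>) p0 u = wedge12 E (W i) (u 0) (u 1) (u 2)" if "i \<in> {1, 2, 3}" for i u
    unfolding dwedge_def W_def E_def form_at_one_def[of "\<omega> i", symmetric] form_at_one_def[of \<eta>, symmetric]
    by (rule wedge_1_2_eval[OF alt1 alt2[OF that]])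
  define q where "q x y z w = (\<lambda>n::nat. if n = 0 then x else if n = 1 then y else if n = 2 then z else w)"
    for x y z w :: "real^5"
  have q: "q x y z w 0 = x" "q x y z w 1 = y" "q x y z w 2 = z" "q x y z w 3 = w" "q x y z w (Suc 0) = y" for x y z w
    by (simp_all add: q_def)
  have prods: "wedge22 (W i) (W j) x y z w = (if i = j then v (U, \<phi>) p0 (q x y z w) else 0)"
    if "i \<in> {1, 2, 3}" "j \<in> {1, 2, 3}" for i j x y z w
  proof -
    have "wedge22 (W i) (W j) x y z w = dwedge 2 2 (\<omega> i) (\<omega> j) (U, \<phi>) p0 (q x y z w)"
      unfolding w22[OF that] q ..
    also have "\<dots> = (if i = j then v else dzero) (U, \<phi>) p0 (q x y z w)"
      by (rule fun_cong[OF at[OF wd[OF that]]])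
    finally show ?thesis by (simp add: dzero_def)
  qed
  have one: "1 \<in> {1, 2, 3::nat}" by simp
  have v: "v (U, \<phi>) p0 = wedge 2 2 (form_at_one (\<omega> 1)) (form_at_one (\<omega> 1))"
    using at[OF wd[OF one one]] unfolding dwedge_def form_at_one_def by simp
  interpret S: su2_point E W
  proof (rule su2_point.intro, unfold form_indices_def)
    show "DIM(real^5) = 5" by simp
    show "linear E" unfolding E_def by (rule alternating_form_1(2)[OF alt1])
    show "bilinear (W i)" "W i x x = 0" if "i \<in> {1, 2, 3}" for i x
      unfolding W_def by (rule alternating_form_2[OF alt2[OF that]])+
    show "wedge22 (W i) (W j) x y z w = 0" if "i \<in> {1, 2, 3}" "j \<in> {1, 2, 3}" "i \<noteq> j" for i j x y z w
      using prods[OF that(1,2)] that(3) by simp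
    show "wedge22 (W i) (W i) x y z w = wedge22 (W 1) (W 1) x y z w" if "i \<in> {1, 2, 3}" for i x y z w
      using prods[OF that that] prods[of 1 1] by simp
    have "dwedge 4 1 v \<eta> (U, \<phi>) p0 \<noteq> (\<lambda>v. 0)"
      using bspec[OF nz[unfolded nowhere_zero_def] chart] p0(1) unfolding prod.case by blast
    then obtain u where u: "wedge 4 1 (wedge 2 2 (form_at_one (\<omega> 1)) (form_at_one (\<omega> 1))) (form_at_one \<eta>) u \<noteq> 0"
      unfolding dwedge_def v form_at_one_def[of \<eta>, symmetric] by blast
    have a1: "alternating_form 2 (form_at_one (\<omega> 1))" by (rule alt2) simp
    show "\<exists>w0 w1 w2 w3 w4. wedge22 (W 1) (W 1) w0 w1 w2 w3 * E w4
      - wedge22 (W 1) (W 1) w0 w1 w2 w4 * E w3 + wedge22 (W 1) (W 1) w0 w1 w3 w4 * E w2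
      - wedge22 (W 1) (W 1) w0 w2 w3 w4 * E w1 + wedge22 (W 1) (W 1) w1 w2 w3 w4 * E w0 \<noteq> 0"
      using u unfolding wedge_4_1_eval[OF a1 alt1] W_def E_def by (intro exI)
    show "0 \<le> W 3 X Y" if "\<And>z. W 1 X z = W 2 Y z" for X Y
    proof -
      have "interior_product X (form_at_one (\<omega> 1)) = interior_product Y (form_at_one (\<omega> 2))"
      proof
        fix u
        show "interior_product X (form_at_one (\<omega> 1)) u = interior_product Y (form_at_one (\<omega> 2)) u"
          using that[of "u 0"] alternating_form_2(1)[OF alt2[of 1], of "case_nat X u"]
            alternating_form_2(1)[OF alt2[of 2], of "case_nat Y u"]
          by (simp add: interior_product_def W_def)
      qed
      then have "0 \<le> form_at_one (\<omega> 3) (case_nat X (\<lambda>_. Y))"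
        using bspec[OF posi chart] p0(1) unfolding prod.case form_at_one_def by blast
      then show ?thesis unfolding W_def eval2_def .
    qed
  qed
  have ext2: "ext_deriv 2 (\<omega> i) (U, \<phi>) p0 u = two_d br (W i) (u 0) (u 1) (u 2)" if "i \<in> {1, 2, 3}" for i u
    unfolding W_def by (rule ext_deriv_2[OF d2[OF that] inv2[OF that]])
  have ext3: "ext_deriv 3 (dwedge 1 2 \<eta> (\<omega> i)) (U, \<phi>) p0 u =
      wedge22 (one_d br E) (W i) (u 0) (u 1) (u 2) (u 3) - wedge13 E (two_d br (W i)) (u 0) (u 1) (u 2) (u 3)"
    if "i \<in> {1, 2, 3}" for i u
    unfolding W_def E_def by (rule ext_deriv_3[OF d1 inv1 d2[OF that] inv2[OF that]])
  have n: "dform_eq A (ext_deriv 2 (\<omega> 1)) (dscale 3 (dwedge 1 2 \<eta> (\<omega> 2)))"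
    "dform_eq A (ext_deriv 3 (dwedge 1 2 \<eta> (\<omega> 3))) (dscale (- 2) (dwedge 2 2 (\<omega> 1) (\<omega> 1)))"
    "dform_eq A (ext_deriv 2 (\<omega> 3)) dzero"
    "dform_eq A (ext_deriv 3 (dwedge 1 2 \<eta> (\<omega> 1))) dzero"
    "dform_eq A (ext_deriv 3 (dwedge 1 2 \<eta> (\<omega> 2))) dzero"
    using nh h unfolding nearly_hypo_def hypo_def by blast+
  interpret L: lie_algebra br by (rule lie_algebra_br)
  have "double_hypo_algebra br E (W 1) (W 2) (W 3)"
  proof
    fix x y z w
    let ?q = "q x y z w"
    show "two_d br (W 1) x y z = 3 * wedge12 E (W 2) x y z"
      using fun_cong[OF at[OF n(1)], of ?q] ext2[of 1 ?q] w12[of 2 ?q]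
      by (simp add: dscale_def q)
    show "two_d br (W 3) x y z = 0"
      using fun_cong[OF at[OF n(3)], of ?q] ext2[of 3 ?q]
      by (simp add: dzero_def q)
    show "wedge22 (one_d br E) (W 3) x y z w - wedge13 E (two_d br (W 3)) x y z w = - 2 * wedge22 (W 1) (W 1) x y z w"
      using fun_cong[OF at[OF n(2)], of ?q] ext3[of 3 ?q] w22[of 1 1 ?q]
      by (simp add: dscale_def q)
    show "wedge22 (one_d br E) (W 1) x y z w - wedge13 E (two_d br (W 1)) x y z w = 0"
      using fun_cong[OF at[OF n(4)], of ?q] ext3[of 1 ?q]
      by (simp add: dzero_def q)
    show "wedge22 (one_d br E) (W 2) x y z w - wedge13 E (two_d br (W 2)) x y z w = 0"
      using fun_cong[OF at[OF n(5)], of ?q] ext3[of 2 ?q]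
      by (simp add: dzero_def q)
  qed
  from S.not_solvable_bracket[OF this] solvable_bracket_br[OF assms(2)] show False by contradiction
qed

end
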